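(* Let $\ell_1,\ell_2\ge1$ be integers and $L>0$. Set $d=\lceil n^{2/5}\rceil$ and $\tau=\zeta n^{1/5}$, and let $\psi_\tau(\mathcal D_N)$ be the test described in the context. There is $\zeta_0$ depending only on $L$ such that for every $\zeta\ge\zeta_0$ there is a constant $c$ depending only on $\zeta,L,\ell_1,\ell_2$ such that for all $n\ge1$ and all $\varepsilon\ge c\,n^{-2/5}$, $$\sup_{p\in\mathcal P'_{0,[0,1],\mathrm{TV}^2}(L)\cup\mathcal P'_{0,[0,1],\mathrm{TV}}(L)\cup\mathcal P'_{0,[0,1],\chi^2}(L)}\mathbb E_p[\psi_\tau(\mathcal D_N)]\le\frac1{10},$$ $$\sup_{p\in\{p\in\mathcal Q'_{0,[0,1],\mathrm{TV}}(L):\ \inf_{q\in\mathcal P'_{0,[0,1]}}\|p-q\|_1\ge\varepsilon\}}\mathbb E_p[1-\psi_\tau(\mathcal D_N)]\le\frac1{10}+\exp(-n/8).$$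
   Context: Notation: $[\ell]=\{1,\dots,\ell\}$; $\|p-q\|_1=\int|\frac{dp}{d\nu}-\frac{dq}{d\nu}|d\nu$ for a common dominating measure $\nu$; $d_{\chi^2}(p,q)=\int(\frac{dp}{dq}-1)^2dq$ if $p\ll q$, $\infty$ otherwise. A supremum over the empty set is $0$. $\mathcal E'_{0,[0,1]}$ is the set of distributions $p=p_{X,Y,Z}$ of triples such that $Z$ has a distribution $p_Z$ supported on $[0,1]$ and absolutely continuous with respect to Lebesgue measure, and for almost all $z$ the conditional distribution $p_{X,Y|Z=z}$ is supported on $[\ell_1]\times[\ell_2]$. $\mathcal P'_{0,[0,1]}$ is the subset with $X$ and $Y$ conditionally independent given $Z$, and $\mathcal Q'_{0,[0,1]}=\mathcal E'_{0,[0,1]}\setminus\mathcal P'_{0,[0,1]}$. Conditions at every $z$ refer to a suitable version of the conditional distributions. - $\mathcal P'_{0,[0,1],\mathrm{TV}}(L)$, $\mathcal P'_{0,[0,1],\mathrm{TV}^2}(L)$, $\mathcal P'_{0,[0,1],\chi^2}(L)$: those $p\in\mathcal P'_{0,[0,1]}$ such that for all $z,z'\in[0,1]$ and for both $W=X$ and $W=Y$, respectively, $\|p_{W|Z=z}-p_{W|Z=z'}\|_1\le L|z-z'|$; $\|p_{W|Z=z}-p_{W|Z=z'}\|_1\le\sqrt{L|z-z'|}$; $d_{\chi^2}(p_{W|Z=z},p_{W|Z=z'})\le L|z-z'|$. - $\mathcal Q'_{0,[0,1],\mathrm{TV}}(L)$: those $p\in\mathcal Q'_{0,[0,1]}$ with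 $\|p_{X,Y|Z=z}-p_{X,Y|Z=z'}\|_1\le L|z-z'|$ for all $z,z'\in[0,1]$. U-statistic: for $\sigma\ge4$ observations $\mathcal D=\{(X_1',Y_1'),\dots,(X'_\sigma,Y'_\sigma)\}$ in $[\ell_1]\times[\ell_2]$ put $\phi_{ij}(xy)=\mathbf 1(X'_i=x,Y'_i=y)-\mathbf 1(X'_i=x)\mathbf 1(Y'_j=y)$; for distinct $i,j,k,l$ put $h_{ijkl}=\frac1{4!}\sum_{\pi}\sum_{x\in[\ell_1],y\in[\ell_2]}\phi_{\pi_1\pi_2}(xy)\phi_{\pi_3\pi_4}(xy)$, the sum being over all permutations $\pi$ of $(i,j,k,l)$; and $U(\mathcal D)=\binom\sigma4^{-1}\sum_{i<j<k<l}h_{ijkl}$. Test: we observe $n$ i.i.d. triples $(X_i,Y_i,Z_i)\sim p$. Independently draw $N\sim\mathrm{Poi}(n/2)$. If $N>n$ accept the null hypothesis (the test takes value $0$). If $N\le n$, take an arbitrary $N$ of the samples (say the first $N$), $\mathcal D_N=\{(X_i,Y_i,Z_i)\}_{i\in[N]}$. Partition $[0,1]$ into $d$ intervals $C_1,\dots,C_d$ of length $1/d$; let $\mathcal D_m=\{(X_i,Y_i):Z_i\in C_m,\ i\in[N]\}$, $\sigma_m=|\mathcal D_m|$, $U_m=U(\mathcal D_m)$ when $\sigma_m\ge4$, and $$T=\sum_{m\in[d]}\mathbf 1(\sigma_m\ge4)\,\sigma_mU_m,\qquad \psi_\tau(\mathcal D_N)=\mathbf 1(T\ge\tau).$$ Expectations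 $\mathbb E_p$ are over both the data and $N$. *)

theory Defs
  imports "HOL-Probability.Probability" "HOL-Combinatorics.Permutations"
begin

definition sum_measure :: "'a measure \<Rightarrow> 'a measure \<Rightarrow> 'a measure" where
  "sum_measure P Q = measure_of (space P) (sets P) (\<lambda>A. emeasure P A + emeasure Q A)"

text \<open>The value does not depend on the choice of the dominating measure, see \<open>l1_dist_density\<close>;
  the definition takes $P + Q$. It is meant for finite \<open>P\<close>, \<open>Q\<close> with the same measurable sets.\<close>

definition l1_dist :: "'a measure \<Rightarrow> 'a measure \<Rightarrow> real" where
  "l1_dist P Q = (let \<nu> = sum_measure P Q in
     \<integral>w. \<bar>enn2real (RN_deriv \<nu> P w) - enn2real (RN_deriv \<nu> Q w)\<bar> \<partial>\<nu>)"

definition chi2_dist :: "'a measure \<Rightarrow> 'a measure \<Rightarrow> ennreal" where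
  "chi2_dist P Q =
     (if absolutely_continuous Q P
      then \<integral>\<^sup>+w. ennreal ((enn2real (RN_deriv Q P w) - 1)\<^sup>2) \<partial>Q
      else \<infinity>)"

lemma sets_sum_measure [simp]: "sets (sum_measure P Q) = sets P"
  and space_sum_measure [simp]: "space (sum_measure P Q) = space P"
  by (simp_all add: sum_measure_def)

lemma emeasure_sum_measure:
  assumes "sets P = sets Q" "A \<in> sets P"
  shows "emeasure (sum_measure P Q) A = emeasure P A + emeasure Q A"
proof (rule emeasure_measure_of[OF sum_measure_def])
  show "countably_additive (sets (sum_measure P Q)) (\<lambda>A. emeasure P A + emeasure Q A)"
    unfolding countably_additive_def
  proof (intro allI impI)
    fix F :: "nat \<Rightarrow> 'a set"
    assume "range F \<subseteq> sets (sum_measure P Q)" and "disjoint_family F"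
    then show "(\<Sum>i. emeasure P (F i) + emeasure Q (F i)) = emeasure P (\<Union> (range F)) + emeasure Q (\<Union> (range F))"
      using assms by (subst suminf_add[symmetric]) (simp_all add: suminf_emeasure)
  qed
qed (use assms sets.sets_into_space in \<open>auto simp: positive_def\<close>)

lemma l1_dist_density:
  fixes f g :: "'a \<Rightarrow> real"
  assumes [measurable]: "f \<in> borel_measurable \<nu>" "g \<in> borel_measurable \<nu>"
    and nonneg: "\<And>w. 0 \<le> f w" "\<And>w. 0 \<le> g w"
    and P: "P = density \<nu> f" and Q: "Q = density \<nu> g"
    and fin: "finite_measure P" "finite_measure Q"
  shows "l1_dist P Q = (\<integral>w. \<bar>f w - g w\<bar> \<partial>\<nu>)"
proof -
  let ?S = "sum_measure P Q"
  have setsPQ: "sets P = sets \<nu>" "sets Q = sets \<nu>" by (simp_all add: P Q)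
  have S: "?S = density \<nu> (\<lambda>w. ennreal (f w + g w))"
  proof (rule measure_eqI)
    fix A assume "A \<in> sets ?S"
    then have A [measurable]: "A \<in> sets \<nu>" by (simp add: setsPQ)
    have "emeasure ?S A = emeasure P A + emeasure Q A"
      using A setsPQ by (intro emeasure_sum_measure) auto
    also have "\<dots> = (\<integral>\<^sup>+w. ennreal (f w) * indicator A w + ennreal (g w) * indicator A w \<partial>\<nu>)"
      by (simp add: P Q emeasure_density nn_integral_add)
    also have "\<dots> = emeasure (density \<nu> (\<lambda>w. ennreal (f w + g w))) A"
      by (subst emeasure_density) (auto simp: nonneg ennreal_plus distrib_right intro!: nn_integral_cong simp del: ennreal_plus[symmetric])
    finally show "emeasure ?S A = \<dots>" .
  qed (simp add: setsPQ)
  interpret P: finite_measure P by fact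
  interpret Q: finite_measure Q by fact
  interpret S: finite_measure ?S
  proof (rule finite_measureI)
    have "emeasure ?S (space P) = emeasure P (space P) + emeasure Q (space P)"
      using setsPQ by (intro emeasure_sum_measure) auto
    then show "emeasure ?S (space ?S) \<noteq> \<infinity>"
      by (simp add: ennreal_add_eq_top P.emeasure_finite Q.emeasure_finite)
  qed
  have split: "AE w in ?S. enn2real (RN_deriv ?S (density \<nu> (\<lambda>w. ennreal (h w))) w) = h w / (f w + g w)"
    if h [measurable]: "h \<in> borel_measurable \<nu>" and h0: "\<And>w. 0 \<le> h w" and hle: "\<And>w. h w \<le> f w + g w" for h
  proof -
    have [measurable]: "h \<in> borel_measurable ?S" "f \<in> borel_measurable ?S" "g \<in> borel_measurable ?S"
      by (simp_all add: S)
    have "density ?S (\<lambda>w. ennreal (h w / (f w + g w))) = density \<nu> (\<lambda>w. ennreal (f w + g w) * ennreal (h w / (f w + g w)))"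
      by (subst S, subst density_density_eq) simp_all
    also have "\<dots> = density \<nu> (\<lambda>w. ennreal (h w))"
    proof (rule density_cong)
      have "ennreal (f w + g w) * ennreal (h w / (f w + g w)) = ennreal (h w)" for w
      proof (cases "f w + g w = 0")
        case True
        then have "h w = 0" using h0[of w] hle[of w] by simp
        then show ?thesis by simp
      next
        case False
        then show ?thesis
          using nonneg[of w] h0[of w] by (subst ennreal_mult[symmetric]) (auto simp del: ennreal_plus)
      qed
      then show "AE w in \<nu>. ennreal (f w + g w) * ennreal (h w / (f w + g w)) = ennreal (h w)" by simp
    qed simp_all
    finally have "AE w in ?S. ennreal (h w / (f w + g w)) = RN_deriv ?S (density \<nu> (\<lambda>w. ennreal (h w))) w"
      by (intro S.RN_deriv_unique) simp_all
    then show ?thesis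
    proof eventually_elim
      case (elim w)
      have "0 \<le> h w / (f w + g w)" using nonneg[of w] h0[of w] by simp
      with elim[symmetric] show ?case by simp
    qed
  qed
  have "l1_dist P Q = (\<integral>w. \<bar>f w / (f w + g w) - g w / (f w + g w)\<bar> \<partial>?S)"
    unfolding l1_dist_def Let_def
  proof (rule integral_cong_AE)
    have [measurable]: "f \<in> borel_measurable ?S" "g \<in> borel_measurable ?S"
      by (simp_all add: S)
    show "AE w in ?S. \<bar>enn2real (RN_deriv ?S P w) - enn2real (RN_deriv ?S Q w)\<bar> = \<bar>f w / (f w + g w) - g w / (f w + g w)\<bar>"
      using split[of f] split[of g] nonneg unfolding P[symmetric] Q[symmetric] by auto
    show "(\<lambda>w. \<bar>f w / (f w + g w) - g w / (f w + g w)\<bar>) \<in> borel_measurable ?S" by measurable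
    show "(\<lambda>w. \<bar>enn2real (RN_deriv ?S P w) - enn2real (RN_deriv ?S Q w)\<bar>) \<in> borel_measurable ?S" by measurable
  qed
  also have "\<dots> = (\<integral>w. (f w + g w) *\<^sub>R \<bar>f w / (f w + g w) - g w / (f w + g w)\<bar> \<partial>\<nu>)"
    unfolding S by (rule integral_density) (auto simp: nonneg)
  also have "\<dots> = (\<integral>w. \<bar>f w - g w\<bar> \<partial>\<nu>)"
  proof (rule Bochner_Integration.integral_cong)
    fix w
    show "(f w + g w) *\<^sub>R \<bar>f w / (f w + g w) - g w / (f w + g w)\<bar> = \<bar>f w - g w\<bar>"
      using nonneg[of w] add_nonneg_eq_0_iff[of "f w" "g w"]
      by (auto simp: diff_divide_distrib[symmetric] abs_divide)
  qed simp
  finally show ?thesis .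
qed

text \<open>The distribution of $(X,Y,Z)$ is a probability measure on \<open>triple_space\<close>. The ambient space
  does not bound $X$ and $Y$; the restriction to $[\ell_1]\times[\ell_2]$ is part of \<open>E0\<close>.\<close>

definition triple_space :: "(nat \<times> nat \<times> real) measure" where
  "triple_space = count_space UNIV \<Otimes>\<^sub>M (count_space UNIV \<Otimes>\<^sub>M borel)"

definition distr_Z :: "(nat \<times> nat \<times> real) measure \<Rightarrow> real measure" where
  "distr_Z p = distr p borel (\<lambda>(x, y, z). z)"

text \<open>\<open>cond_XY p k\<close>: the Markov kernel \<open>k\<close> is a version of $z \mapsto p_{X,Y|Z=z}$.
  Versions are unique only up to \<open>distr_Z p\<close>-null sets.\<close>

definition cond_XY :: "(nat \<times> nat \<times> real) measure \<Rightarrow> (real \<Rightarrow> (nat \<times> nat) pmf) \<Rightarrow> bool" where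
  "cond_XY p k \<longleftrightarrow>
     (\<lambda>z. measure_pmf (k z)) \<in> borel \<rightarrow>\<^sub>M prob_algebra (count_space UNIV) \<and>
     (\<forall>A. \<forall>B \<in> sets borel.
        emeasure p {(x, y, z). (x, y) \<in> A \<and> z \<in> B} =
        (\<integral>\<^sup>+z \<in> B. emeasure (measure_pmf (k z)) A \<partial>distr_Z p))"

definition E0 :: "nat \<Rightarrow> nat \<Rightarrow> (nat \<times> nat \<times> real) measure set" where
  "E0 l1 l2 = {p. prob_space p \<and> sets p = sets triple_space \<and>
     (AE z in distr_Z p. z \<in> {0..1}) \<and>
     absolutely_continuous lborel (distr_Z p) \<and>
     (\<exists>k. cond_XY p k \<and> (AE z in distr_Z p. set_pmf (k z) \<subseteq> {1..l1} \<times> {1..l2}))}"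

definition P0 :: "nat \<Rightarrow> nat \<Rightarrow> (nat \<times> nat \<times> real) measure set" where
  "P0 l1 l2 = {p \<in> E0 l1 l2.
     \<exists>k. cond_XY p k \<and>
       (AE z in distr_Z p. k z = pair_pmf (map_pmf fst (k z)) (map_pmf snd (k z)))}"

definition Q0 :: "nat \<Rightarrow> nat \<Rightarrow> (nat \<times> nat \<times> real) measure set" where
  "Q0 l1 l2 = E0 l1 l2 - P0 l1 l2"

definition P0_TV :: "nat \<Rightarrow> nat \<Rightarrow> real \<Rightarrow> (nat \<times> nat \<times> real) measure set" where
  "P0_TV l1 l2 L = {p \<in> P0 l1 l2. \<exists>k. cond_XY p k \<and>
     (\<forall>z \<in> {0..1}. \<forall>z' \<in> {0..1}. \<forall>W \<in> {fst, snd}.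
        l1_dist (map_pmf W (k z)) (map_pmf W (k z')) \<le> L * \<bar>z - z'\<bar>)}"

definition P0_TV2 :: "nat \<Rightarrow> nat \<Rightarrow> real \<Rightarrow> (nat \<times> nat \<times> real) measure set" where
  "P0_TV2 l1 l2 L = {p \<in> P0 l1 l2. \<exists>k. cond_XY p k \<and>
     (\<forall>z \<in> {0..1}. \<forall>z' \<in> {0..1}. \<forall>W \<in> {fst, snd}.
        l1_dist (map_pmf W (k z)) (map_pmf W (k z')) \<le> sqrt (L * \<bar>z - z'\<bar>))}"

definition P0_chi2 :: "nat \<Rightarrow> nat \<Rightarrow> real \<Rightarrow> (nat \<times> nat \<times> real) measure set" where
  "P0_chi2 l1 l2 L = {p \<in> P0 l1 l2. \<exists>k. cond_XY p k \<and>
     (\<forall>z \<in> {0..1}. \<forall>z' \<in> {0..1}. \<forall>W \<in> {fst, snd}.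
        chi2_dist (map_pmf W (k z)) (map_pmf W (k z')) \<le> ennreal (L * \<bar>z - z'\<bar>))}"

definition Q0_TV :: "nat \<Rightarrow> nat \<Rightarrow> real \<Rightarrow> (nat \<times> nat \<times> real) measure set" where
  "Q0_TV l1 l2 L = {p \<in> Q0 l1 l2. \<exists>k. cond_XY p k \<and>
     (\<forall>z \<in> {0..1}. \<forall>z' \<in> {0..1}. l1_dist (k z) (k z') \<le> L * \<bar>z - z'\<bar>)}"

text \<open>A data set is a list \<open>D\<close> of pairs; observations are numbered from 0.\<close>

definition phi :: "(nat \<times> nat) list \<Rightarrow> nat \<Rightarrow> nat \<Rightarrow> nat \<Rightarrow> nat \<Rightarrow> real" where
  "phi D i j x y =
     of_bool (fst (D ! i) = x \<and> snd (D ! i) = y) - of_bool (fst (D ! i) = x) * of_bool (snd (D ! j) = y)"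

definition U_kernel :: "nat \<Rightarrow> nat \<Rightarrow> (nat \<times> nat) list \<Rightarrow> nat \<Rightarrow> nat \<Rightarrow> nat \<Rightarrow> nat \<Rightarrow> real" where
  "U_kernel l1 l2 D i j k l =
     (1 / fact 4) * (\<Sum>\<pi> | \<pi> permutes {i, j, k, l}. \<Sum>x\<in>{1..l1}. \<Sum>y\<in>{1..l2}.
        phi D (\<pi> i) (\<pi> j) x y * phi D (\<pi> k) (\<pi> l) x y)"

definition U_stat :: "nat \<Rightarrow> nat \<Rightarrow> (nat \<times> nat) list \<Rightarrow> real" where
  "U_stat l1 l2 D =
     (\<Sum>(i, j, k, l) \<in> {(i, j, k, l). i < j \<and> j < k \<and> k < l \<and> l < length D}. U_kernel l1 l2 D i j k l)
     / real (length D choose 4)"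

definition bin :: "nat \<Rightarrow> nat \<Rightarrow> real set" where
  "bin d m = (if m = d then {(real m - 1) / real d .. 1}
              else {(real m - 1) / real d ..< real m / real d})"

text \<open>\<open>\<omega> i\<close> is the \<open>i\<close>-th observed triple, \<open>i \<ge> 1\<close>.\<close>

definition bin_data :: "nat \<Rightarrow> nat \<Rightarrow> (nat \<Rightarrow> nat \<times> nat \<times> real) \<Rightarrow> nat \<Rightarrow> (nat \<times> nat) list" where
  "bin_data d N \<omega> m =
     [(x, y). (x, y, z) \<leftarrow> map \<omega> [1..<N + 1], z \<in> bin d m]"

definition T_stat :: "nat \<Rightarrow> nat \<Rightarrow> nat \<Rightarrow> nat \<Rightarrow> (nat \<Rightarrow> nat \<times> nat \<times> real) \<Rightarrow> real" where
  "T_stat l1 l2 d N \<omega> =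
     (\<Sum>m\<in>{1..d}. let D = bin_data d N \<omega> m; \<sigma> = length D in
        of_bool (\<sigma> \<ge> 4) * real \<sigma> * U_stat l1 l2 D)"

definition psi :: "nat \<Rightarrow> nat \<Rightarrow> nat \<Rightarrow> real \<Rightarrow> nat \<Rightarrow> nat \<Rightarrow> (nat \<Rightarrow> nat \<times> nat \<times> real) \<Rightarrow> real" where
  "psi l1 l2 d \<tau> n N \<omega> = (if N > n then 0 else of_bool (T_stat l1 l2 d N \<omega> \<ge> \<tau>))"

text \<open>Joint law of \<open>N\<close> and of the \<open>n\<close> i.i.d. observations.\<close>

definition sample_law ::
  "nat \<Rightarrow> (nat \<times> nat \<times> real) measure \<Rightarrow> (nat \<times> (nat \<Rightarrow> nat \<times> nat \<times> real)) measure" where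
  "sample_law n p = measure_pmf (poisson_pmf (real n / 2)) \<Otimes>\<^sub>M (\<Pi>\<^sub>M i\<in>{1..n}. p)"

text \<open>Expectation of a nonnegative function; it takes values in \<^typ>\<open>ennreal\<close>, where the supremum
  over the empty set is 0.\<close>

definition expect ::
  "nat \<Rightarrow> (nat \<times> nat \<times> real) measure \<Rightarrow> (nat \<Rightarrow> (nat \<Rightarrow> nat \<times> nat \<times> real) \<Rightarrow> real) \<Rightarrow> ennreal" where
  "expect n p f = (\<integral>\<^sup>+(N, \<omega>). ennreal (f N \<omega>) \<partial>sample_law n p)"

end

(* Conditionally on the bin labels of the first N observations, the contributions sigma_m U_m of
   the bins are uncorrelated, with mean sigma_m D_m and variance O(sigma_m D_m + 1), where D_m is
   the squared Euclidean distance between the law P_m of (X, Y) given Z in C_m and the product of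
   its marginals. Under the null, P_m is a mixture of product laws with nearby factors, so P_m
   minus the product of its marginals is a covariance of order L / d, whence D_m = O(L^2 / d^2),
   and Chebyshev's inequality applies for every fixed N <= n.
   Under the alternative, the law with conditional kernel P_m^X x P_m^Y on C_m belongs to the null
   class; its distance from p bounds the average of |P_m - P_m^X x P_m^Y|_1 from below, hence by
   Cauchy-Schwarz also the average of the D_m. Only bins with at least 6 expected observations
   are kept: there 1(sigma >= 4) sigma >= sigma - 3 loses at most half of the mean, and the other
   bins carry mass O(n^(-3/5)). The random N only enters through two Poisson tail bounds. *)
theory Submission
  imports Defs
begin

subsection \<open>Bounded functions of independent discrete variables\<close>

text \<open>Put a = n^(1/5), so n = a^5 and d is of order a^2. The null bias n L^2 / d^2, the noise
  sqrt d of T and the threshold are then all of order a, and a separation of order a^(-2) also lifts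
  the mean of T to order a, so the constants decide. As \<zeta>0 may depend on L only, the variance
  of the U-statistic is estimated through l1 norms of the vectors \<open>phiv u v\<close>, which are
  at most 2 on any grid. The alphabet sizes enter by Cauchy-Schwarz, where an l1 norm of the gap is
  compared with a Euclidean one, and so affect c alone. T sees Z only through the bin label, so each
  observation can be coded in a countable set. The probabilistic part thus works with product pmfs,
  where everything is measurable and boundedness gives integrability; real-valued Z returns when the
  law in a bin is written as a mixture of the kernel. The classes choose a version of the kernel
  separately for support, independence and smoothness. Almost sure uniqueness moves the first two
  properties to the smooth version, the one that is controlled at every z.\<close>

definition bdd :: "('a \<Rightarrow> real) \<Rightarrow> bool" where
  "bdd f \<longleftrightarrow> (\<exists>K. \<forall>x. \<bar>f x\<bar> \<le> K)"

lemma bddI: "(\<And>x. \<bar>f x\<bar> \<le> K) \<Longrightarrow> bdd f"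
  by (auto simp: bdd_def)

named_theorems bdd_intros

lemma bdd_const [bdd_intros]: "bdd (\<lambda>x. c)"
  by (rule bddI[of _ "\<bar>c\<bar>"]) simp

lemma bdd_of_bool [bdd_intros]: "bdd (\<lambda>x. of_bool (P x))"
  by (rule bddI[of _ 1]) auto

lemma bdd_uminus [bdd_intros]: "bdd f \<Longrightarrow> bdd (\<lambda>x. - f x)"
  by (auto simp: bdd_def)

lemma bdd_add [bdd_intros]: "bdd f \<Longrightarrow> bdd g \<Longrightarrow> bdd (\<lambda>x. f x + g x)"
  unfolding bdd_def by (meson abs_triangle_ineq add_mono order_trans)

lemma bdd_diff [bdd_intros]: "bdd f \<Longrightarrow> bdd g \<Longrightarrow> bdd (\<lambda>x. f x - g x)"
  using bdd_add[of f "\<lambda>x. - g x"] bdd_uminus[of g] by simp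

lemma bdd_mult [bdd_intros]:
  assumes "bdd f" "bdd g" shows "bdd (\<lambda>x. f x * g x)"
proof -
  obtain K K' where "\<And>x. \<bar>f x\<bar> \<le> K" "\<And>x. \<bar>g x\<bar> \<le> K'"
    using assms by (auto simp: bdd_def)
  then have "\<bar>f x * g x\<bar> \<le> K * K'" for x
    unfolding abs_mult by (intro mult_mono) (auto intro: order_trans[OF abs_ge_zero])
  then show ?thesis by (rule bddI)
qed

lemma bdd_power [bdd_intros]: "bdd f \<Longrightarrow> bdd (\<lambda>x. f x ^ k)"
  by (induction k) (auto intro!: bdd_intros)

lemma bdd_divide [bdd_intros]: "bdd f \<Longrightarrow> bdd (\<lambda>x. f x / c)"
  using bdd_mult[OF _ bdd_const, of f "inverse c"] by (simp add: field_simps)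

lemma bdd_sum [bdd_intros]: "(\<And>i. i \<in> A \<Longrightarrow> bdd (f i)) \<Longrightarrow> bdd (\<lambda>x. \<Sum>i\<in>A. f i x)"
  by (induction A rule: infinite_finite_induct) (auto intro!: bdd_intros)

lemma bdd_comp: "bdd f \<Longrightarrow> bdd (\<lambda>x. f (h x))"
  by (auto simp: bdd_def)

lemma bdd_integrable: "bdd f \<Longrightarrow> integrable (measure_pmf M) f"
proof -
  assume "bdd f"
  then obtain K where "\<And>x. \<bar>f x\<bar> \<le> K" by (auto simp: bdd_def)
  then show ?thesis by (intro measure_pmf.integrable_const_bound[where B = K]) auto
qed

lemma expectation_sum_bdd:
  assumes "\<And>i. i \<in> A \<Longrightarrow> bdd (f i)"
  shows "measure_pmf.expectation M (\<lambda>x. \<Sum>i\<in>A. f i x) = (\<Sum>i\<in>A. measure_pmf.expectation M (f i))"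
  using assms by (intro Bochner_Integration.integral_sum bdd_integrable)

section \<open>Functions of some of the independent coordinates\<close>

definition dep_on :: "(('i \<Rightarrow> 'b) \<Rightarrow> 'c) \<Rightarrow> 'i set \<Rightarrow> bool" where
  "dep_on F A \<longleftrightarrow> (\<forall>f g. (\<forall>i\<in>A. f i = g i) \<longrightarrow> F f = F g)"

lemma dep_onD: "dep_on F A \<Longrightarrow> (\<And>i. i \<in> A \<Longrightarrow> f i = g i) \<Longrightarrow> F f = F g"
  by (auto simp: dep_on_def)

lemma dep_on_mono: "dep_on F A \<Longrightarrow> A \<subseteq> B \<Longrightarrow> dep_on F B"
  by (auto simp: dep_on_def)

lemma dep_on_mult: "dep_on F A \<Longrightarrow> dep_on G A \<Longrightarrow> dep_on (\<lambda>f. F f * G f :: real) A"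
  by (auto simp: dep_on_def) (metis (no_types))

lemma expectation_bind_pmf_bdd:
  assumes "bdd f"
  shows "measure_pmf.expectation (bind_pmf M N) f =
    measure_pmf.expectation M (\<lambda>x. measure_pmf.expectation (N x) f)"
proof -
  obtain K where K: "\<And>x. \<bar>f x\<bar> \<le> K" using assms by (auto simp: bdd_def)
  show ?thesis
    unfolding measure_pmf_bind
    by (rule integral_bind[where K = "count_space UNIV" and B = K and B' = 1])
       (auto simp: K measure_pmf.emeasure_eq_measure measure_pmf_in_subprob_space)
qed

text \<open>\<open>F\<close> reads only coordinates in \<open>A\<close>, and \<open>G\<close> only
  coordinates outside \<open>A\<close>. Splitting the product pmf into its parts on \<open>A\<close>
  and on \<open>I - A\<close> turns them into functions of two independent vectors.\<close>

lemma expectation_Pi_pmf_mult: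
  fixes F G :: "('i \<Rightarrow> 'b) \<Rightarrow> real"
  assumes I: "finite I" "A \<subseteq> I" and dep: "dep_on F A" "dep_on G B" and disj: "A \<inter> B = {}"
    and bd: "bdd F" "bdd G"
  shows "measure_pmf.expectation (Pi_pmf I dflt p) (\<lambda>f. F f * G f) =
    measure_pmf.expectation (Pi_pmf I dflt p) F * measure_pmf.expectation (Pi_pmf I dflt p) G"
proof -
  let ?m = "\<lambda>f g x. if x \<in> A then f x else g x"
  have fin: "finite A" using I finite_subset by auto
  have F: "F (?m f g) = F f" for f g by (rule dep_onD[OF dep(1)]) auto
  have G: "G (?m f g) = G g" for f g by (rule dep_onD[OF dep(2)]) (use disj in auto)
  have *: "measure_pmf.expectation (Pi_pmf I dflt p) H =
     measure_pmf.expectation (Pi_pmf A dflt p)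
       (\<lambda>f. measure_pmf.expectation (Pi_pmf (I - A) dflt p) (\<lambda>g. H (?m f g)))"
    if H: "bdd H" for H
  proof -
    have "I = A \<union> (I - A)" using I by auto
    then have "Pi_pmf I dflt p = Pi_pmf (A \<union> (I - A)) dflt p" by simp
    also have "\<dots> = map_pmf (\<lambda>(f, g). ?m f g) (pair_pmf (Pi_pmf A dflt p) (Pi_pmf (I - A) dflt p))"
      using fin I by (intro Pi_pmf_union) auto
    finally show ?thesis
      by (simp add: case_prod_unfold pair_pmf_def expectation_bind_pmf_bdd[OF bdd_comp[OF H]] cong: if_cong)
  qed
  show ?thesis
    by (simp add: *[OF bd(1)] *[OF bd(2)] *[OF bdd_mult[OF bd]] F G)
qed

text \<open>Expand the square. \<open>R\<close> stands for the overlap of index sets: only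
  overlapping pairs survive, each contributes at most c^2, and every \<open>t\<close> has at most k
  partners.\<close>

lemma second_moment_sum_le:
  fixes Y :: "'t \<Rightarrow> 'a \<Rightarrow> real"
  assumes T: "finite T" and bd: "\<And>t x. t \<in> T \<Longrightarrow> \<bar>Y t x\<bar> \<le> c"
    and card: "\<And>t. t \<in> T \<Longrightarrow> real (card {t' \<in> T. R t t'}) \<le> k"
    and orth: "\<And>t t'. t \<in> T \<Longrightarrow> t' \<in> T \<Longrightarrow> \<not> R t t' \<Longrightarrow>
      measure_pmf.expectation M (\<lambda>x. Y t x * Y t' x) = 0"
  shows "measure_pmf.expectation M (\<lambda>x. (\<Sum>t\<in>T. Y t x)\<^sup>2) \<le> real (card T) * k * c\<^sup>2"
proof -
  have b: "bdd (Y t)" if "t \<in> T" for t using bd[OF that] by (rule bddI)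
  have pr: "measure_pmf.expectation M (\<lambda>x. Y t x * Y t' x) \<le> (if R t t' then c\<^sup>2 else 0)"
    if t: "t \<in> T" "t' \<in> T" for t t'
  proof (cases "R t t'")
    case True
    have "Y t x * Y t' x \<le> c\<^sup>2" for x
    proof -
      have "Y t x * Y t' x \<le> \<bar>Y t x\<bar> * \<bar>Y t' x\<bar>" by (simp add: abs_mult[symmetric])
      also have "\<dots> \<le> c * c" using bd[OF t(1), of x] bd[OF t(2), of x] by (intro mult_mono) auto
      finally show ?thesis by (simp add: power2_eq_square)
    qed
    then show ?thesis using True
      by (auto intro!: measure_pmf.integral_le_const bdd_integrable bdd_mult b t)
  qed (simp add: orth t)
  have "measure_pmf.expectation M (\<lambda>x. (\<Sum>t\<in>T. Y t x)\<^sup>2) =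
     measure_pmf.expectation M (\<lambda>x. \<Sum>t\<in>T. \<Sum>t'\<in>T. Y t x * Y t' x)"
    by (simp add: power2_eq_square sum_product)
  also have "\<dots> = (\<Sum>t\<in>T. \<Sum>t'\<in>T. measure_pmf.expectation M (\<lambda>x. Y t x * Y t' x))"
    by (simp add: expectation_sum_bdd b bdd_mult bdd_sum)
  also have "\<dots> \<le> (\<Sum>t\<in>T. \<Sum>t'\<in>T. if R t t' then c\<^sup>2 else 0)"
    by (intro sum_mono pr)
  also have "\<dots> = (\<Sum>t\<in>T. real (card {t' \<in> T. R t t'}) * c\<^sup>2)"
    using T by (simp add: sum.If_cases Int_def)
  also have "\<dots> \<le> (\<Sum>t\<in>T. k * c\<^sup>2)"
    by (intro sum_mono mult_right_mono card) auto
  finally show ?thesis by simp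
qed

subsection \<open>The kernel of the U-statistic\<close>

definition phiv :: "nat \<times> nat \<Rightarrow> nat \<times> nat \<Rightarrow> nat \<times> nat \<Rightarrow> real" where
  "phiv u v w = of_bool (u = w) - of_bool (fst u = fst w) * of_bool (snd v = snd w)"

definition gap :: "(nat \<times> nat) pmf \<Rightarrow> nat \<times> nat \<Rightarrow> real" where
  "gap P w = pmf P w - pmf (map_pmf fst P) (fst w) * pmf (map_pmf snd P) (snd w)"

text \<open>For independent draws \<open>u\<close>, \<open>v\<close> from \<open>P\<close> the
  vector \<open>phiv u v\<close> is an unbiased estimate of \<open>gap P\<close>, so the difference
  has mean zero.\<close>

definition centered :: "(nat \<times> nat) pmf \<Rightarrow> nat \<times> nat \<Rightarrow> nat \<times> nat \<Rightarrow> nat \<times> nat \<Rightarrow> real" where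
  "centered P u v w = phiv u v w - gap P w"

definition dependence :: "(nat \<times> nat) set \<Rightarrow> (nat \<times> nat) pmf \<Rightarrow> real" where
  "dependence W P = (\<Sum>w\<in>W. (gap P w)\<^sup>2)"

lemma phi_eq_phiv: "phi D i j x y = phiv (D ! i) (D ! j) (x, y)"
  by (simp add: phi_def phiv_def prod_eq_iff)

lemma sum_pmf_le_1: "finite W \<Longrightarrow> (\<Sum>w\<in>W. pmf P w) \<le> 1"
  by (simp add: measure_measure_pmf_finite[symmetric])

text \<open>At most two entries are nonzero, those at \<open>u\<close> and at the recombined pair
  \<open>(fst u, snd v)\<close>. The size of \<open>W\<close> therefore does not enter, and the
  constants of the variance bound inherit this.\<close>

lemma sum_abs_phiv_le:
  assumes "finite W" shows "(\<Sum>w\<in>W. \<bar>phiv u v w\<bar>) \<le> 2"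
proof -
  have "(\<Sum>w\<in>W. \<bar>phiv u v w\<bar>) \<le> (\<Sum>w\<in>W. of_bool (w = u) + of_bool (w = (fst u, snd v)))"
    by (intro sum_mono) (auto simp: phiv_def)
  also have "\<dots> \<le> 2"
    using assms by (simp add: sum.distrib of_bool_def sum.delta)
  finally show ?thesis .
qed

lemma sum_abs_gap_le:
  assumes "finite W" shows "(\<Sum>w\<in>W. \<bar>gap P w\<bar>) \<le> 2"
proof -
  have "(\<Sum>w\<in>W. \<bar>gap P w\<bar>) \<le> (\<Sum>w\<in>W. pmf P w + pmf (pair_pmf (map_pmf fst P) (map_pmf snd P)) w)"
    unfolding gap_def pmf_pair[symmetric] by (intro sum_mono) (auto simp: abs_le_iff)
  also have "\<dots> \<le> 1 + 1"
    unfolding sum.distrib by (intro add_mono sum_pmf_le_1 assms)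
  finally show ?thesis by simp
qed

lemma abs_gap_le: "\<bar>gap P w\<bar> \<le> 1"
  using sum_abs_gap_le[of "{w}" P] pmf_le_1[of P w] pmf_nonneg[of P w]
    mult_le_one[OF pmf_le_1 pmf_nonneg pmf_le_1, of "map_pmf fst P" "fst w" "map_pmf snd P" "snd w"]
    mult_nonneg_nonneg[OF pmf_nonneg pmf_nonneg, of "map_pmf fst P" "fst w" "map_pmf snd P" "snd w"]
  unfolding gap_def by linarith

lemma abs_phiv_le: "\<bar>phiv u v w\<bar> \<le> 1"
  by (auto simp: phiv_def)

lemma abs_centered_le: "\<bar>centered P u v w\<bar> \<le> 2"
  using abs_gap_le[of P w] abs_phiv_le[of u v w] by (simp add: centered_def)

lemma sum_abs_centered_le:
  assumes "finite W" shows "(\<Sum>w\<in>W. \<bar>centered P u v w\<bar>) \<le> 4"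
proof -
  have "(\<Sum>w\<in>W. \<bar>centered P u v w\<bar>) \<le> (\<Sum>w\<in>W. \<bar>phiv u v w\<bar> + \<bar>gap P w\<bar>)"
    unfolding centered_def by (intro sum_mono abs_triangle_ineq4)
  also have "\<dots> \<le> 2 + 2"
    unfolding sum.distrib by (intro add_mono sum_abs_phiv_le sum_abs_gap_le assms)
  finally show ?thesis by simp
qed

lemma dependence_nonneg: "0 \<le> dependence W P"
  by (auto simp: dependence_def intro: sum_nonneg)

lemma dependence_le:
  assumes "finite W" shows "dependence W P \<le> 2"
proof -
  have "dependence W P \<le> (\<Sum>w\<in>W. \<bar>gap P w\<bar>)"
    unfolding dependence_def
  proof (rule sum_mono)
    fix w show "(gap P w)\<^sup>2 \<le> \<bar>gap P w\<bar>"
      using mult_left_mono[OF abs_gap_le[of P w], of "\<bar>gap P w\<bar>"]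
      by (simp add: power2_eq_square abs_mult[symmetric])
  qed
  then show ?thesis using sum_abs_gap_le[OF assms, of P] by simp
qed

text \<open>Maximum norm 2 of one vector times l1 norm 4 of the other.\<close>

lemma abs_sum_centered_centered_le:
  assumes "finite W" shows "\<bar>\<Sum>w\<in>W. centered P u v w * centered P u' v' w\<bar> \<le> 8"
proof -
  have "\<bar>\<Sum>w\<in>W. centered P u v w * centered P u' v' w\<bar> \<le> (\<Sum>w\<in>W. \<bar>centered P u v w\<bar> * 2)"
    by (intro order_trans[OF sum_abs] sum_mono)
       (auto simp: abs_mult intro!: mult_left_mono abs_centered_le)
  also have "\<dots> \<le> 8"
    using sum_abs_centered_le[OF assms, of P u v] by (simp add: sum_distrib_right[symmetric])
  finally show ?thesis .
qed

text \<open>Cauchy-Schwarz; the squared Euclidean norm of the centered vector is at most 2 * 4.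
  Keeping the factor \<open>dependence W P\<close> is what later makes the variance of the linear
  part proportional to the mean.\<close>

lemma abs_sum_centered_gap_le:
  assumes "finite W" shows "\<bar>\<Sum>w\<in>W. centered P u v w * gap P w\<bar> \<le> sqrt (8 * dependence W P)"
proof -
  have "(\<Sum>w\<in>W. (centered P u v w)\<^sup>2) \<le> (\<Sum>w\<in>W. \<bar>centered P u v w\<bar> * 2)"
  proof (rule sum_mono)
    fix w show "(centered P u v w)\<^sup>2 \<le> \<bar>centered P u v w\<bar> * 2"
      using mult_left_mono[OF abs_centered_le[of P u v w], of "\<bar>centered P u v w\<bar>"]
      by (simp add: power2_eq_square abs_mult[symmetric])
  qed
  also have "\<dots> \<le> 8"
    using sum_abs_centered_le[OF assms, of P u v] by (simp add: sum_distrib_right[symmetric])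
  finally have "(\<Sum>w\<in>W. (centered P u v w)\<^sup>2) * dependence W P \<le> 8 * dependence W P"
    by (intro mult_right_mono dependence_nonneg)
  moreover have "(\<Sum>w\<in>W. centered P u v w * gap P w)\<^sup>2 \<le> (\<Sum>w\<in>W. (centered P u v w)\<^sup>2) * dependence W P"
    unfolding dependence_def by (rule Cauchy_Schwarz_ineq_sum)
  ultimately have "sqrt ((\<Sum>w\<in>W. centered P u v w * gap P w)\<^sup>2) \<le> sqrt (8 * dependence W P)"
    by (intro real_sqrt_le_mono) linarith
  then show ?thesis by simp
qed

lemma sum_phiv_phiv_eq:
  "(\<Sum>w\<in>W. phiv u v w * phiv u' v' w) = dependence W P +
     ((\<Sum>w\<in>W. centered P u v w * gap P w) + (\<Sum>w\<in>W. centered P u' v' w * gap P w)) +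
     (\<Sum>w\<in>W. centered P u v w * centered P u' v' w)"
  unfolding dependence_def sum.distrib[symmetric]
  by (rule sum.cong) (simp_all add: centered_def power2_eq_square algebra_simps)

lemma expectation_coord:
  fixes f :: "'b \<Rightarrow> real"
  assumes "finite I" "i \<in> I"
  shows "measure_pmf.expectation (Pi_pmf I dflt (\<lambda>_. P)) (\<lambda>X. f (X i)) = measure_pmf.expectation P f"
  using Pi_pmf_component[OF assms(1), of i dflt "\<lambda>_. P"] assms(2)
    integral_map_pmf[of "\<lambda>X. X i" "Pi_pmf I dflt (\<lambda>_. P)" f] by simp

lemma expectation_of_bool_eq:
  "measure_pmf.expectation M (\<lambda>u. of_bool (f u = a)) = pmf (map_pmf f M) a"
proof -
  have "(\<lambda>u. of_bool (f u = a) :: real) = indicator (f -` {a})"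
    by (auto simp: fun_eq_iff)
  then show ?thesis by (simp add: pmf.rep_eq)
qed

lemma dep_on_centered: "dep_on (\<lambda>X. centered P (X i) (X j) w) {i, j}"
  by (auto simp: dep_on_def)

lemma bdd_centered [bdd_intros]: "bdd (\<lambda>X. centered P (X i) (X j) w)"
  using abs_centered_le by (rule bddI)

context
  fixes I :: "'i set" and dflt :: "nat \<times> nat" and P :: "(nat \<times> nat) pmf"
  assumes I: "finite I"
begin

lemma expectation_centered:
  assumes "i \<in> I" "j \<in> I" "i \<noteq> j"
  shows "measure_pmf.expectation (Pi_pmf I dflt (\<lambda>_. P)) (\<lambda>X. centered P (X i) (X j) w) = 0"
proof -
  let ?M = "Pi_pmf I dflt (\<lambda>_. P)"
  have 1: "measure_pmf.expectation ?M (\<lambda>X. of_bool (fst (X i) = fst w) * of_bool (snd (X j) = snd w)) =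
     pmf (map_pmf fst P) (fst w) * pmf (map_pmf snd P) (snd w)"
  proof (subst expectation_Pi_pmf_mult[OF I, where A = "{i}" and B = "{j}"])
    show "measure_pmf.expectation ?M (\<lambda>X. of_bool (fst (X i) = fst w)) *
        measure_pmf.expectation ?M (\<lambda>X. of_bool (snd (X j) = snd w)) =
        pmf (map_pmf fst P) (fst w) * pmf (map_pmf snd P) (snd w)"
      using expectation_coord[OF I assms(1), of dflt P "\<lambda>u. of_bool (fst u = fst w)"]
        expectation_coord[OF I assms(2), of dflt P "\<lambda>u. of_bool (snd u = snd w)"]
        expectation_of_bool_eq[of P fst "fst w"] expectation_of_bool_eq[of P snd "snd w"]
      by (simp only:)
  qed (use assms in \<open>auto simp: dep_on_def intro: bdd_of_bool\<close>)
  have 2: "measure_pmf.expectation ?M (\<lambda>X. of_bool (X i = w)) = pmf P w"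
    using expectation_coord[OF I assms(1), of dflt P "\<lambda>u. of_bool (u = w)"]
      expectation_of_bool_eq[of P "\<lambda>u. u" w] by (simp add: pmf.map_ident)
  show ?thesis unfolding centered_def phiv_def gap_def
    using 1 2 by (simp add: bdd_integrable bdd_intros)
qed

text \<open>The coordinates \<open>i\<close> and \<open>j\<close> are independent of all that
  \<open>G\<close> reads, and the first factor has mean zero. The orthogonality relations of the
  U-statistic all reduce to this.\<close>

lemma expectation_centered_mult:
  assumes "i \<in> I" "j \<in> I" "i \<noteq> j" "dep_on G B" "i \<notin> B" "j \<notin> B" "bdd G"
  shows "measure_pmf.expectation (Pi_pmf I dflt (\<lambda>_. P)) (\<lambda>X. centered P (X i) (X j) w * G X) = 0"
  using assms
  by (subst expectation_Pi_pmf_mult[OF I _ dep_on_centered assms(4)])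
     (auto simp: expectation_centered bdd_centered)

end

section \<open>Averages over the orderings of four indices\<close>

definition quads :: "nat \<Rightarrow> (nat \<times> nat \<times> nat \<times> nat) set" where
  "quads s = {(i, j, k, l). i < j \<and> j < k \<and> k < l \<and> l < s}"

definition supp4 :: "nat \<times> nat \<times> nat \<times> nat \<Rightarrow> nat set" where
  "supp4 t = (case t of (i, j, k, l) \<Rightarrow> {i, j, k, l})"

text \<open>The symmetrisation in \<open>U_kernel\<close> as an operator on functions of four
  indices; 24 is 4!. Linearity, bounds and vanishing expectations can then be proved once for all
  parts of the kernel.\<close>

definition avg4 :: "nat \<times> nat \<times> nat \<times> nat \<Rightarrow> (nat \<Rightarrow> nat \<Rightarrow> nat \<Rightarrow> nat \<Rightarrow> real) \<Rightarrow> real" where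
  "avg4 t g = (case t of (i, j, k, l) \<Rightarrow>
     (\<Sum>\<pi> | \<pi> permutes {i, j, k, l}. g (\<pi> i) (\<pi> j) (\<pi> k) (\<pi> l)) / 24)"

text \<open>All that the estimates retain of a permutation: its values list the four entries of
  \<open>t\<close> in some order.\<close>

definition ord4 :: "nat \<times> nat \<times> nat \<times> nat \<Rightarrow> nat \<Rightarrow> nat \<Rightarrow> nat \<Rightarrow> nat \<Rightarrow> bool" where
  "ord4 t a b c e \<longleftrightarrow> distinct [a, b, c, e] \<and> {a, b, c, e} = supp4 t"

lemma finite_quads [simp]: "finite (quads s)"
  by (rule finite_subset[of _ "{..<s} \<times> {..<s} \<times> {..<s} \<times> {..<s}"]) (auto simp: quads_def)

lemma card_supp4: "t \<in> quads s \<Longrightarrow> card (supp4 t) = 4"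
  by (auto simp: quads_def supp4_def)

lemma supp4_subset: "t \<in> quads s \<Longrightarrow> supp4 t \<subseteq> {..<s}"
  by (auto simp: quads_def supp4_def)

lemma finite_supp4 [simp]: "finite (supp4 t)"
  by (cases t) (auto simp: supp4_def)

lemma ord4_permutes:
  assumes "(i, j, k, l) \<in> quads s" "\<pi> permutes {i, j, k, l}"
  shows "ord4 (i, j, k, l) (\<pi> i) (\<pi> j) (\<pi> k) (\<pi> l)"
proof -
  have "inj \<pi>" "\<pi> ` {i, j, k, l} = {i, j, k, l}"
    using assms(2) permutes_inj permutes_image by blast+
  then show ?thesis using assms(1) by (auto simp: ord4_def supp4_def quads_def inj_eq)
qed

lemma card_permutes_quads:
  assumes "(i, j, k, l) \<in> quads s"
  shows "card {\<pi>. \<pi> permutes {i, j, k, l}} = 24"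
  using assms card_permutations[of "{i, j, k, l}" 4] by (auto simp: quads_def fact_numeral)

lemma avg4_add: "avg4 t (\<lambda>a b c e. f a b c e + g a b c e) = avg4 t f + avg4 t g"
  by (cases t) (simp add: avg4_def sum.distrib add_divide_distrib)

lemma avg4_const: "t \<in> quads s \<Longrightarrow> avg4 t (\<lambda>a b c e. K) = K"
  by (cases t) (simp add: avg4_def card_permutes_quads)

lemma abs_avg4_le:
  assumes t: "t \<in> quads s" and K: "\<And>a b c e. ord4 t a b c e \<Longrightarrow> \<bar>g a b c e\<bar> \<le> K"
  shows "\<bar>avg4 t g\<bar> \<le> K"
proof -
  obtain i j k l where t_eq: "t = (i, j, k, l)" by (cases t)
  let ?S = "{\<pi>. \<pi> permutes {i, j, k, l}}"
  have "\<bar>\<Sum>\<pi>\<in>?S. g (\<pi> i) (\<pi> j) (\<pi> k) (\<pi> l)\<bar> \<le> (\<Sum>\<pi>\<in>?S. K)"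
    using t K ord4_permutes unfolding t_eq by (intro order_trans[OF sum_abs] sum_mono) blast
  then show ?thesis
    using card_permutes_quads t by (simp add: t_eq avg4_def)
qed

lemma dep_on_avg4:
  assumes t: "t \<in> quads s" and g: "\<And>a b c e. ord4 t a b c e \<Longrightarrow> dep_on (g a b c e) (supp4 t)"
  shows "dep_on (\<lambda>X. avg4 t (\<lambda>a b c e. g a b c e X)) (supp4 t)"
proof -
  obtain i j k l where t_eq: "t = (i, j, k, l)" by (cases t)
  have "g (\<pi> i) (\<pi> j) (\<pi> k) (\<pi> l) X = g (\<pi> i) (\<pi> j) (\<pi> k) (\<pi> l) Y"
    if "\<pi> permutes {i, j, k, l}" "\<forall>i\<in>supp4 t. X i = Y i" for \<pi> X Y
    using dep_onD[OF g] ord4_permutes[OF _ that(1)] t that(2) unfolding t_eq by blast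
  then show ?thesis by (auto simp: dep_on_def t_eq avg4_def intro!: sum.cong)
qed

lemma bdd_avg4:
  assumes "\<And>a b c e. bdd (g a b c e)" shows "bdd (\<lambda>X. avg4 t (\<lambda>a b c e. g a b c e X))"
  by (cases t) (auto simp: avg4_def intro!: bdd_divide bdd_sum assms)

lemma expectation_avg4_mult_0:
  assumes t: "t \<in> quads s" and bd: "\<And>a b c e. bdd (g a b c e)" "bdd G"
    and 0: "\<And>a b c e. ord4 t a b c e \<Longrightarrow> measure_pmf.expectation M (\<lambda>X. g a b c e X * G X) = 0"
  shows "measure_pmf.expectation M (\<lambda>X. avg4 t (\<lambda>a b c e. g a b c e X) * G X) = 0"
proof -
  obtain i j k l where t_eq: "t = (i, j, k, l)" by (cases t)
  let ?S = "{\<pi>. \<pi> permutes {i, j, k, l}}"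
  have "measure_pmf.expectation M (\<lambda>X. avg4 t (\<lambda>a b c e. g a b c e X) * G X) =
    measure_pmf.expectation M (\<lambda>X. (\<Sum>\<pi>\<in>?S. g (\<pi> i) (\<pi> j) (\<pi> k) (\<pi> l) X * G X)) / 24"
    by (simp add: t_eq avg4_def sum_distrib_right)
  also have "\<dots> = (\<Sum>\<pi>\<in>?S. measure_pmf.expectation M (\<lambda>X. g (\<pi> i) (\<pi> j) (\<pi> k) (\<pi> l) X * G X)) / 24"
    by (subst expectation_sum_bdd) (auto intro!: bdd_mult bd)
  also have "\<dots> = 0"
    using 0 ord4_permutes t by (simp add: t_eq)
  finally show ?thesis .
qed

section \<open>Counting quadruples with common indices\<close>

lemma bij_betw_supp4: "bij_betw supp4 (quads s) {K. K \<subseteq> {..<s} \<and> card K = 4}"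
proof (rule bij_betwI[where g = "\<lambda>K. let xs = sorted_list_of_set K in (xs ! 0, xs ! 1, xs ! 2, xs ! 3)"])
  show "supp4 \<in> quads s \<rightarrow> {K. K \<subseteq> {..<s} \<and> card K = 4}"
    using card_supp4 supp4_subset by auto
  have L: "\<exists>i j k l. sorted_list_of_set K = [i, j, k, l] \<and> i < j \<and> j < k \<and> k < l \<and> K = {i, j, k, l}"
    if "K \<subseteq> {..<s}" "card K = 4" for K
  proof -
    have fin: "finite K" using that finite_subset by auto
    have "\<exists>i j k l. xs = [i, j, k, l]" if "length xs = 4" for xs :: "nat list"
      using that by (auto simp: numeral_eq_Suc length_Suc_conv)
    moreover have "length (sorted_list_of_set K) = 4" using fin that by simp
    ultimately obtain i j k l where *: "sorted_list_of_set K = [i, j, k, l]" by blast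
    have "set (sorted_list_of_set K) = K" "sorted_wrt (<) (sorted_list_of_set K)"
      using fin by auto
    then show ?thesis using * by auto
  qed
  show "(\<lambda>K. let xs = sorted_list_of_set K in (xs ! 0, xs ! 1, xs ! 2, xs ! 3)) \<in>
      {K. K \<subseteq> {..<s} \<and> card K = 4} \<rightarrow> quads s"
  proof
    fix K assume "K \<in> {K. K \<subseteq> {..<s} \<and> card K = 4}"
    then have K: "K \<subseteq> {..<s}" "card K = 4" by simp_all
    from L[OF this] obtain i j k l where "sorted_list_of_set K = [i, j, k, l]" "i < j" "j < k" "k < l"
      and "K = {i, j, k, l}" by blast
    with K(1) show "(let xs = sorted_list_of_set K in (xs ! 0, xs ! 1, xs ! 2, xs ! 3)) \<in> quads s"
      by (simp add: quads_def)
  qed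
  show "(let xs = sorted_list_of_set (supp4 t) in (xs ! 0, xs ! 1, xs ! 2, xs ! 3)) = t" if "t \<in> quads s" for t
  proof -
    obtain i j k l where t: "t = (i, j, k, l)" by (cases t)
    with that have "sorted_list_of_set (supp4 t) = [i, j, k, l]"
      using sorted_list_of_set.idem_if_sorted_distinct[of "[i, j, k, l]"]
      by (simp add: quads_def supp4_def)
    then show ?thesis by (simp add: t)
  qed
  show "supp4 (let xs = sorted_list_of_set K in (xs ! 0, xs ! 1, xs ! 2, xs ! 3)) = K"
    if "K \<in> {K. K \<subseteq> {..<s} \<and> card K = 4}" for K
  proof -
    from that have "K \<subseteq> {..<s}" "card K = 4" by simp_all
    from L[OF this] obtain i j k l where "sorted_list_of_set K = [i, j, k, l]" "K = {i, j, k, l}"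
      by blast
    then show ?thesis by (simp add: supp4_def)
  qed
qed

lemma card_quads: "card (quads s) = s choose 4"
  using bij_betw_same_card[OF bij_betw_supp4] n_subsets[of "{..<s}" 4] by simp

lemma card_supersets_le:
  assumes "finite S" "e \<subseteq> S" "card e \<le> m"
  shows "card {K. e \<subseteq> K \<and> K \<subseteq> S \<and> card K = m} \<le> (card S - card e) choose (m - card e)"
proof -
  have fe: "finite e" using assms finite_subset by auto
  have "card {K. e \<subseteq> K \<and> K \<subseteq> S \<and> card K = m} \<le> card {K. K \<subseteq> S - e \<and> card K = m - card e}"
  proof (rule card_inj_on_le[where f = "\<lambda>K. K - e"])
    show "inj_on (\<lambda>K. K - e) {K. e \<subseteq> K \<and> K \<subseteq> S \<and> card K = m}"
      by (auto simp: inj_on_def)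
    show "(\<lambda>K. K - e) ` {K. e \<subseteq> K \<and> K \<subseteq> S \<and> card K = m} \<subseteq> {K. K \<subseteq> S - e \<and> card K = m - card e}"
      using fe by (auto simp: card_Diff_subset)
    show "finite {K. K \<subseteq> S - e \<and> card K = m - card e}"
      using assms by auto
  qed
  also have "\<dots> = card (S - e) choose (m - card e)"
    using assms by (intro n_subsets) auto
  finally show ?thesis using assms fe by (simp add: card_Diff_subset)
qed

text \<open>Union bound over the r-element sets \<open>e\<close> of common indices, each of which
  lies in at most (s - r choose 4 - r) four-element sets. It serves with r = 1 for the linear and r
  = 2 for the quadratic part.\<close>

lemma card_quads_overlap:
  assumes t: "t \<in> quads s" and r: "r \<le> 4"
  shows "card {t' \<in> quads s. r \<le> card (supp4 t \<inter> supp4 t')} \<le> (4 choose r) * ((s - r) choose (4 - r))"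
proof -
  let ?E = "{e. e \<subseteq> supp4 t \<and> card e = r}"
  have E: "finite ?E" "card ?E = 4 choose r"
    using card_supp4[OF t] n_subsets[of "supp4 t" r] by auto
  have "card {t' \<in> quads s. r \<le> card (supp4 t \<inter> supp4 t')} \<le>
      card (\<Union>e\<in>?E. {K. e \<subseteq> K \<and> K \<subseteq> {..<s} \<and> card K = 4})"
  proof (rule card_inj_on_le[where f = supp4])
    show "inj_on supp4 {t' \<in> quads s. r \<le> card (supp4 t \<inter> supp4 t')}"
      by (rule inj_on_subset[OF bij_betw_imp_inj_on[OF bij_betw_supp4[of s]]]) auto
    show "finite (\<Union>e\<in>?E. {K. e \<subseteq> K \<and> K \<subseteq> {..<s} \<and> card K = 4})"
      by (rule finite_subset[of _ "Pow {..<s}"]) auto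
    show "supp4 ` {t' \<in> quads s. r \<le> card (supp4 t \<inter> supp4 t')} \<subseteq>
        (\<Union>e\<in>?E. {K. e \<subseteq> K \<and> K \<subseteq> {..<s} \<and> card K = 4})"
    proof (intro image_subsetI)
      fix t' assume t': "t' \<in> {t' \<in> quads s. r \<le> card (supp4 t \<inter> supp4 t')}"
      then have "r \<le> card (supp4 t \<inter> supp4 t')" by simp
      then obtain e where "e \<subseteq> supp4 t \<inter> supp4 t'" "card e = r"
        by (rule obtain_subset_with_card_n)
      then show "supp4 t' \<in> (\<Union>e\<in>?E. {K. e \<subseteq> K \<and> K \<subseteq> {..<s} \<and> card K = 4})"
        using t' card_supp4[of t' s] supp4_subset[of t' s] by auto
    qed
  qed
  also have "\<dots> \<le> (\<Sum>e\<in>?E. card {K. e \<subseteq> K \<and> K \<subseteq> {..<s} \<and> card K = 4})"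
    by (rule card_UN_le[OF E(1)])
  also have "\<dots> \<le> (\<Sum>e\<in>?E. (s - r) choose (4 - r))"
  proof (rule sum_mono)
    fix e assume "e \<in> ?E"
    then show "card {K. e \<subseteq> K \<and> K \<subseteq> {..<s} \<and> card K = 4} \<le> (s - r) choose (4 - r)"
      using card_supersets_le[of "{..<s}" e 4] supp4_subset[OF t] r by auto
  qed
  finally show ?thesis by (simp add: E(2))
qed

subsection \<open>Mean and variance of the U-statistic\<close>

definition grid :: "nat \<Rightarrow> nat \<Rightarrow> (nat \<times> nat) set" where
  "grid l1 l2 = {1..l1} \<times> {1..l2}"

lemma finite_grid [simp]: "finite (grid l1 l2)"
  by (simp add: grid_def)

text \<open>Writing \<open>phiv\<close> as \<open>centered\<close> plus its mean \<open>gap\<close> in both factors splits the kernel of the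
  U-statistic into its mean, a part linear and a part quadratic in the centered vectors.\<close>

definition lin_kern :: "(nat \<times> nat) set \<Rightarrow> (nat \<times> nat) pmf \<Rightarrow> nat \<times> nat \<times> nat \<times> nat \<Rightarrow> (nat \<Rightarrow> nat \<times> nat) \<Rightarrow> real" where
  "lin_kern W P t X = avg4 t (\<lambda>a b c e.
     (\<Sum>w\<in>W. centered P (X a) (X b) w * gap P w) + (\<Sum>w\<in>W. centered P (X c) (X e) w * gap P w))"

definition quad_kern :: "(nat \<times> nat) set \<Rightarrow> (nat \<times> nat) pmf \<Rightarrow> nat \<times> nat \<times> nat \<times> nat \<Rightarrow> (nat \<Rightarrow> nat \<times> nat) \<Rightarrow> real" where
  "quad_kern W P t X = avg4 t (\<lambda>a b c e. \<Sum>w\<in>W. centered P (X a) (X b) w * centered P (X c) (X e) w)"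

lemma avg4_cong:
  assumes "t \<in> quads s" "\<And>a b c e. ord4 t a b c e \<Longrightarrow> f a b c e = g a b c e"
  shows "avg4 t f = avg4 t g"
proof -
  obtain i j k l where t_eq: "t = (i, j, k, l)" by (cases t)
  show ?thesis
    using assms ord4_permutes unfolding t_eq avg4_def by (auto intro!: sum.cong)
qed

lemma U_kernel_eq:
  assumes t: "(i, j, k, l) \<in> quads s"
  shows "U_kernel l1 l2 (map X [0..<s]) i j k l =
    dependence (grid l1 l2) P + lin_kern (grid l1 l2) P (i, j, k, l) X + quad_kern (grid l1 l2) P (i, j, k, l) X"
proof -
  let ?D = "map X [0..<s]"
  have "U_kernel l1 l2 ?D i j k l = avg4 (i, j, k, l) (\<lambda>a b c e.
      \<Sum>w\<in>grid l1 l2. phiv (?D ! a) (?D ! b) w * phiv (?D ! c) (?D ! e) w)"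
  proof -
    have "(\<Sum>x\<in>{1..l1}. \<Sum>y\<in>{1..l2}. phi ?D a b x y * phi ?D c e x y) =
        (\<Sum>w\<in>grid l1 l2. phiv (?D ! a) (?D ! b) w * phiv (?D ! c) (?D ! e) w)" for a b c e
      unfolding grid_def sum.cartesian_product by (intro sum.cong refl) (auto simp: phi_eq_phiv)
    moreover have "fact 4 = (24 :: real)" by (simp add: fact_numeral)
    ultimately show ?thesis unfolding U_kernel_def avg4_def by simp
  qed
  also have "\<dots> = avg4 (i, j, k, l) (\<lambda>a b c e.
      \<Sum>w\<in>grid l1 l2. phiv (X a) (X b) w * phiv (X c) (X e) w)"
  proof (rule avg4_cong[OF t])
    fix a b c e assume "ord4 (i, j, k, l) a b c e"
    \<comment> \<open>\<open>?D ! a\<close> equals \<open>X a\<close> only for positions below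
      \<open>s\<close>, hence the restriction to orderings of a quadruple in
      \<open>quads s\<close>.\<close>
    then have "{a, b, c, e} \<subseteq> {..<s}" using supp4_subset[OF t] by (simp add: ord4_def)
    then show "(\<Sum>w\<in>grid l1 l2. phiv (?D ! a) (?D ! b) w * phiv (?D ! c) (?D ! e) w) =
        (\<Sum>w\<in>grid l1 l2. phiv (X a) (X b) w * phiv (X c) (X e) w)" by simp
  qed
  also have "\<dots> = avg4 (i, j, k, l) (\<lambda>_ _ _ _. dependence (grid l1 l2) P) +
      lin_kern (grid l1 l2) P (i, j, k, l) X + quad_kern (grid l1 l2) P (i, j, k, l) X"
    unfolding lin_kern_def quad_kern_def avg4_add[symmetric] sum_phiv_phiv_eq[where P = P] ..
  finally show ?thesis by (simp add: avg4_const[OF t])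
qed

lemma U_stat_decomp:
  assumes "s \<ge> 4"
  shows "U_stat l1 l2 (map X [0..<s]) = dependence (grid l1 l2) P +
    ((\<Sum>t\<in>quads s. lin_kern (grid l1 l2) P t X) + (\<Sum>t\<in>quads s. quad_kern (grid l1 l2) P t X)) / real (s choose 4)"
proof -
  have "U_stat l1 l2 (map X [0..<s]) = (\<Sum>t\<in>quads s. dependence (grid l1 l2) P + lin_kern (grid l1 l2) P t X + quad_kern (grid l1 l2) P t X)
      / real (s choose 4)"
    unfolding U_stat_def quads_def[symmetric] length_map length_upt diff_zero
    by (intro arg_cong2[where f = "(/)"] sum.cong refl) (auto simp: U_kernel_eq[where P = P])
  also have "\<dots> = (real (s choose 4) * dependence (grid l1 l2) P + ((\<Sum>t\<in>quads s. lin_kern (grid l1 l2) P t X) + (\<Sum>t\<in>quads s. quad_kern (grid l1 l2) P t X))) / real (s choose 4)"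
    by (simp add: sum.distrib card_quads)
  finally show ?thesis using assms by (simp add: add_divide_distrib)
qed

context
  fixes s :: nat and W :: "(nat \<times> nat) set" and dflt :: "nat \<times> nat" and P :: "(nat \<times> nat) pmf"
    and M :: "(nat \<Rightarrow> nat \<times> nat) pmf"
  assumes W: "finite W"
  defines "M \<equiv> Pi_pmf {..<s} dflt (\<lambda>_. P)"
begin

lemma ord4_D:
  assumes "t \<in> quads s" "ord4 t a b c e"
  shows "{a, b, c, e} = supp4 t" "a < s" "b < s" "c < s" "e < s" "a \<noteq> b" "c \<noteq> e" "{a, b} \<inter> {c, e} = {}"
  using assms supp4_subset[OF assms(1)] unfolding ord4_def by auto

lemma abs_lin_kern_le: "t \<in> quads s \<Longrightarrow> \<bar>lin_kern W P t X\<bar> \<le> 2 * sqrt (8 * dependence W P)"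
  unfolding lin_kern_def
proof (rule abs_avg4_le, assumption)
  fix a b c e
  show "\<bar>(\<Sum>w\<in>W. centered P (X a) (X b) w * gap P w) + (\<Sum>w\<in>W. centered P (X c) (X e) w * gap P w)\<bar>
      \<le> 2 * sqrt (8 * dependence W P)"
    using abs_sum_centered_gap_le[OF W, of P "X a" "X b"] abs_sum_centered_gap_le[OF W, of P "X c" "X e"] by linarith
qed

lemma abs_quad_kern_le: "t \<in> quads s \<Longrightarrow> \<bar>quad_kern W P t X\<bar> \<le> 8"
  unfolding quad_kern_def by (rule abs_avg4_le, assumption) (rule abs_sum_centered_centered_le[OF W])

lemma bdd_lin_kern [bdd_intros]: "bdd (lin_kern W P t)"
  unfolding lin_kern_def by (intro bdd_avg4 bdd_intros)

lemma bdd_quad_kern [bdd_intros]: "bdd (quad_kern W P t)"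
  unfolding quad_kern_def by (intro bdd_avg4 bdd_intros)

lemma dep_on_lin_kern: "t \<in> quads s \<Longrightarrow> dep_on (lin_kern W P t) (supp4 t)"
  unfolding lin_kern_def
proof (rule dep_on_avg4, assumption)
  fix a b c e assume "t \<in> quads s" "ord4 t a b c e"
  from ord4_D(1)[OF this, symmetric]
  show "dep_on (\<lambda>X. (\<Sum>w\<in>W. centered P (X a) (X b) w * gap P w) + (\<Sum>w\<in>W. centered P (X c) (X e) w * gap P w)) (supp4 t)"
    by (auto simp: dep_on_def)
qed

lemma dep_on_quad_kern: "t \<in> quads s \<Longrightarrow> dep_on (quad_kern W P t) (supp4 t)"
  unfolding quad_kern_def
proof (rule dep_on_avg4, assumption)
  fix a b c e assume "t \<in> quads s" "ord4 t a b c e"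
  from ord4_D(1)[OF this, symmetric]
  show "dep_on (\<lambda>X. \<Sum>w\<in>W. centered P (X a) (X b) w * centered P (X c) (X e) w) (supp4 t)"
    by (auto simp: dep_on_def)
qed

lemma expectation_centered_mult_s:
  assumes "i < s" "j < s" "i \<noteq> j" "dep_on G B" "i \<notin> B" "j \<notin> B" "bdd G"
  shows "measure_pmf.expectation M (\<lambda>X. centered P (X i) (X j) w * G X) = 0"
  unfolding M_def using assms by (intro expectation_centered_mult) auto

text \<open>Both index pairs avoid \<open>B\<close>, so every term has mean zero. The choice
  \<open>B = {}\<close> gives the mean, the support of a disjoint quadruple gives
  orthogonality.\<close>

lemma expectation_lin_kern_mult:
  assumes t: "t \<in> quads s" and G: "dep_on G B" "supp4 t \<inter> B = {}" "bdd G"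
  shows "measure_pmf.expectation M (\<lambda>X. lin_kern W P t X * G X) = 0"
  unfolding lin_kern_def
proof (rule expectation_avg4_mult_0[OF t])
  fix a b c e assume o: "ord4 t a b c e"
  have nB: "a \<notin> B" "b \<notin> B" "c \<notin> B" "e \<notin> B"
    using ord4_D(1)[OF t o] G(2) by auto
  have "measure_pmf.expectation M (\<lambda>X. ((\<Sum>w\<in>W. centered P (X a) (X b) w * gap P w) + (\<Sum>w\<in>W. centered P (X c) (X e) w * gap P w)) * G X)
     = measure_pmf.expectation M (\<lambda>X. \<Sum>w\<in>W. gap P w * (centered P (X a) (X b) w * G X) + gap P w * (centered P (X c) (X e) w * G X))"
    by (simp add: sum_distrib_left sum_distrib_right sum.distrib algebra_simps)
  also have "\<dots> = (\<Sum>w\<in>W. measure_pmf.expectation M (\<lambda>X. gap P w * (centered P (X a) (X b) w * G X) + gap P w * (centered P (X c) (X e) w * G X)))"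
    by (intro expectation_sum_bdd bdd_add bdd_mult bdd_const bdd_centered G)
  also have "\<dots> = 0"
  proof (rule sum.neutral, rule ballI)
    fix w
    have "measure_pmf.expectation M (\<lambda>X. gap P w * (centered P (X a) (X b) w * G X) + gap P w * (centered P (X c) (X e) w * G X)) =
       measure_pmf.expectation M (\<lambda>X. gap P w * (centered P (X a) (X b) w * G X)) +
       measure_pmf.expectation M (\<lambda>X. gap P w * (centered P (X c) (X e) w * G X))"
      by (intro Bochner_Integration.integral_add bdd_integrable bdd_mult bdd_const bdd_centered G)
    also have "\<dots> = 0"
      using ord4_D[OF t o] nB G by (simp add: expectation_centered_mult_s)
    finally show "measure_pmf.expectation M (\<lambda>X. gap P w * (centered P (X a) (X b) w * G X) + gap P w * (centered P (X c) (X e) w * G X)) = 0" .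
  qed
  finally show "measure_pmf.expectation M (\<lambda>X. ((\<Sum>w\<in>W. centered P (X a) (X b) w * gap P w) + (\<Sum>w\<in>W. centered P (X c) (X e) w * gap P w)) * G X) = 0" .
qed (auto intro!: bdd_intros bdd_centered G)

text \<open>At most one index of \<open>t\<close> lies in \<open>B\<close>, so one of the two pairs of indices avoids \<open>B\<close>.\<close>
lemma expectation_quad_kern_mult:
  assumes t: "t \<in> quads s" and G: "dep_on G B" "card (supp4 t \<inter> B) \<le> 1" "bdd G"
  shows "measure_pmf.expectation M (\<lambda>X. quad_kern W P t X * G X) = 0"
  unfolding quad_kern_def
proof (rule expectation_avg4_mult_0[OF t])
  fix a b c e assume o: "ord4 t a b c e"
  note oD = ord4_D[OF t o]
  have *: "measure_pmf.expectation M (\<lambda>X. centered P (X i) (X j) w * (centered P (X k) (X l) w * G X)) = 0"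
    if "{i, j} \<inter> B = {}" "{i, j} \<inter> {k, l} = {}" "i \<noteq> j" "i < s" "j < s" for i j k l w
  proof (rule expectation_centered_mult_s[where B = "{k, l} \<union> B"])
    show "dep_on (\<lambda>X. centered P (X k) (X l) w * G X) ({k, l} \<union> B)"
      using G(1) by (intro dep_on_mult dep_on_mono[OF dep_on_centered] dep_on_mono[OF G(1)]) auto
  qed (use that in \<open>auto intro!: bdd_mult bdd_centered G\<close>)
  have "{a, b} \<inter> B = {} \<or> {c, e} \<inter> B = {}"
  proof (rule ccontr)
    assume "\<not> ?thesis"
    then obtain x y where "x \<in> {a, b} \<inter> B" "y \<in> {c, e} \<inter> B" by auto
    then have "{x, y} \<subseteq> supp4 t \<inter> B" "x \<noteq> y" using oD by auto
    then have "2 \<le> card (supp4 t \<inter> B)"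
      using card_mono[of "supp4 t \<inter> B" "{x, y}"] by simp
    then show False using G(2) by simp
  qed
  then have 0: "measure_pmf.expectation M (\<lambda>X. centered P (X a) (X b) w * centered P (X c) (X e) w * G X) = 0" for w
  proof
    assume "{a, b} \<inter> B = {}"
    then show ?thesis using *[of a b c e w] oD by (simp add: mult_ac)
  next
    assume "{c, e} \<inter> B = {}"
    then show ?thesis using *[of c e a b w] oD by (simp add: mult_ac Int_commute)
  qed
  show "measure_pmf.expectation M (\<lambda>X. (\<Sum>w\<in>W. centered P (X a) (X b) w * centered P (X c) (X e) w) * G X) = 0"
    unfolding sum_distrib_right
    by (subst expectation_sum_bdd) (auto intro!: bdd_mult bdd_centered G simp: 0)
qed (auto intro!: bdd_intros bdd_centered G)

text \<open>Quadruples without a common index are orthogonal, and at most 4 (s - 1 choose 3)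
  quadruples meet a given one. The factor 32 is (2 sqrt 8)^2 from
  \<open>abs_lin_kern_le\<close>.\<close>

lemma second_moment_lin_kern:
  "measure_pmf.expectation M (\<lambda>X. (\<Sum>t\<in>quads s. lin_kern W P t X)\<^sup>2) \<le>
     real (s choose 4) * (4 * real ((s - 1) choose 3)) * (32 * dependence W P)"
proof -
  have "measure_pmf.expectation M (\<lambda>X. (\<Sum>t\<in>quads s. lin_kern W P t X)\<^sup>2) \<le>
      real (card (quads s)) * (4 * real ((s - 1) choose 3)) * (2 * sqrt (8 * dependence W P))\<^sup>2"
  proof (rule second_moment_sum_le[where R = "\<lambda>t t'. 1 \<le> card (supp4 t \<inter> supp4 t')"])
    fix t assume "t \<in> quads s"
    from of_nat_mono[OF card_quads_overlap[OF this, of 1], where 'a = real]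
    show "real (card {t' \<in> quads s. 1 \<le> card (supp4 t \<inter> supp4 t')}) \<le> 4 * real ((s - 1) choose 3)"
      by simp
  next
    fix t t' assume "t \<in> quads s" "t' \<in> quads s" "\<not> 1 \<le> card (supp4 t \<inter> supp4 t')"
    moreover from this have "supp4 t \<inter> supp4 t' = {}" by (simp add: Suc_le_eq card_gt_0_iff)
    ultimately show "measure_pmf.expectation M (\<lambda>X. lin_kern W P t X * lin_kern W P t' X) = 0"
      by (intro expectation_lin_kern_mult[OF _ dep_on_lin_kern] bdd_lin_kern) auto
  qed (auto intro: abs_lin_kern_le)
  then show ?thesis by (simp add: card_quads power_mult_distrib dependence_nonneg)
qed

text \<open>The quadratic part is degenerate: a single common index produces no correlation, so only
  quadruples with two common indices count. This saves a factor of order s over the linear part and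
  makes up for the missing factor \<open>dependence\<close>.\<close>

lemma second_moment_quad_kern:
  "measure_pmf.expectation M (\<lambda>X. (\<Sum>t\<in>quads s. quad_kern W P t X)\<^sup>2) \<le>
     real (s choose 4) * (6 * real ((s - 2) choose 2)) * 64"
proof -
  have "measure_pmf.expectation M (\<lambda>X. (\<Sum>t\<in>quads s. quad_kern W P t X)\<^sup>2) \<le>
      real (card (quads s)) * (6 * real ((s - 2) choose 2)) * 8\<^sup>2"
  proof (rule second_moment_sum_le[where R = "\<lambda>t t'. 2 \<le> card (supp4 t \<inter> supp4 t')"])
    fix t assume "t \<in> quads s"
    from of_nat_mono[OF card_quads_overlap[OF this, of 2], where 'a = real]
    show "real (card {t' \<in> quads s. 2 \<le> card (supp4 t \<inter> supp4 t')}) \<le> 6 * real ((s - 2) choose 2)"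
      by (simp add: choose_two)
  next
    fix t t' assume "t \<in> quads s" "t' \<in> quads s" "\<not> 2 \<le> card (supp4 t \<inter> supp4 t')"
    then show "measure_pmf.expectation M (\<lambda>X. quad_kern W P t X * quad_kern W P t' X) = 0"
      by (intro expectation_quad_kern_mult[OF _ dep_on_quad_kern] bdd_quad_kern) auto
  qed (auto intro: abs_quad_kern_le)
  then show ?thesis by (simp add: card_quads)
qed

end

lemma expectation_U_stat:
  assumes s: "s \<ge> 4"
  shows "measure_pmf.expectation (Pi_pmf {..<s} dflt (\<lambda>_. P)) (\<lambda>X. U_stat l1 l2 (map X [0..<s])) =
    dependence (grid l1 l2) P"
proof -
  let ?M = "Pi_pmf {..<s} dflt (\<lambda>_. P)" and ?W = "grid l1 l2"
  have 1: "measure_pmf.expectation ?M (lin_kern ?W P t) = 0" if "t \<in> quads s" for t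
    using expectation_lin_kern_mult[OF finite_grid that, of "\<lambda>_. 1" "{}"]
    by (simp add: dep_on_def bdd_const)
  have 2: "measure_pmf.expectation ?M (quad_kern ?W P t) = 0" if "t \<in> quads s" for t
    using expectation_quad_kern_mult[OF finite_grid that, of "\<lambda>_. 1" "{}"]
    by (simp add: dep_on_def bdd_const)
  show ?thesis
    unfolding U_stat_decomp[OF s, where P = P]
    by (simp add: bdd_integrable bdd_sum bdd_lin_kern bdd_quad_kern expectation_sum_bdd 1 2)
qed

text \<open>The variance of the linear part of U is of order D / s and that of the quadratic part of
  order 1 / s^2; multiplication by s^2 leaves s D + 1.\<close>

lemma variance_U_stat_le:
  assumes s: "s \<ge> 4"
  shows "measure_pmf.expectation (Pi_pmf {..<s} dflt (\<lambda>_. P))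
      (\<lambda>X. (real s * (U_stat l1 l2 (map X [0..<s]) - dependence (grid l1 l2) P))\<^sup>2) \<le>
    12288 * (real s * dependence (grid l1 l2) P + 1)"
proof -
  let ?M = "Pi_pmf {..<s} dflt (\<lambda>_. P)" and ?W = "grid l1 l2"
  let ?A = "\<lambda>X. \<Sum>t\<in>quads s. lin_kern ?W P t X" and ?B = "\<lambda>X. \<Sum>t\<in>quads s. quad_kern ?W P t X"
  define C where "C = real (s choose 4)"
  define D where "D = dependence ?W P"
  have C: "C > 0" using s by (simp add: C_def)
  have D: "D \<ge> 0" by (simp add: D_def dependence_nonneg)
  have arith: "4 - 1 = (3::nat)" "3 - 1 = (2::nat)" "s - 1 - 1 = s - 2" by simp_all
  \<comment> \<open>The absorption identity for binomial coefficients expresses both overlap counts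
    through \<open>C\<close>.\<close>
  have "4 * (s choose 4) = s * ((s - 1) choose 3)" "3 * ((s - 1) choose 3) = (s - 1) * ((s - 2) choose 2)"
    using times_binomial_minus1_eq[of 4 s] times_binomial_minus1_eq[of 3 "s - 1"] unfolding arith
    by simp_all
  from this[THEN arg_cong[where f = real]]
  have c3: "4 * C = real s * real ((s - 1) choose 3)"
    and c2: "3 * real ((s - 1) choose 3) = (real s - 1) * real ((s - 2) choose 2)"
    unfolding C_def of_nat_mult using s by (simp_all add: of_nat_diff)
  have "measure_pmf.expectation ?M (\<lambda>X. (real s * (U_stat l1 l2 (map X [0..<s]) - D))\<^sup>2) \<le>
    measure_pmf.expectation ?M (\<lambda>X. 2 * (real s / C)\<^sup>2 * (?A X)\<^sup>2 + 2 * (real s / C)\<^sup>2 * (?B X)\<^sup>2)"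
  proof (rule integral_mono)
    fix X
    have "(real s * (U_stat l1 l2 (map X [0..<s]) - D))\<^sup>2 = (real s / C)\<^sup>2 * (?A X + ?B X)\<^sup>2"
      unfolding U_stat_decomp[OF s, where P = P] D_def C_def by (simp add: power_mult_distrib power_divide)
    also have "\<dots> \<le> (real s / C)\<^sup>2 * (2 * (?A X)\<^sup>2 + 2 * (?B X)\<^sup>2)"
      using sum_squares_bound[of "?A X" "?B X"] by (intro mult_left_mono) (auto simp: power2_sum)
    finally show "(real s * (U_stat l1 l2 (map X [0..<s]) - D))\<^sup>2 \<le>
       2 * (real s / C)\<^sup>2 * (?A X)\<^sup>2 + 2 * (real s / C)\<^sup>2 * (?B X)\<^sup>2" by (simp add: algebra_simps)
  qed (unfold U_stat_decomp[OF s, where P = P], (intro bdd_integrable bdd_intros finite_grid)+)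
  also have "\<dots> = 2 * (real s / C)\<^sup>2 * measure_pmf.expectation ?M (\<lambda>X. (?A X)\<^sup>2) +
      2 * (real s / C)\<^sup>2 * measure_pmf.expectation ?M (\<lambda>X. (?B X)\<^sup>2)"
    by (subst Bochner_Integration.integral_add)
       (auto intro!: bdd_integrable bdd_mult bdd_const bdd_power bdd_sum bdd_lin_kern bdd_quad_kern)
  also have "\<dots> \<le> 2 * (real s / C)\<^sup>2 * (C * (4 * real ((s - 1) choose 3)) * (32 * D)) +
      2 * (real s / C)\<^sup>2 * (C * (6 * real ((s - 2) choose 2)) * 64)"
    unfolding C_def D_def
    by (intro add_mono mult_left_mono second_moment_lin_kern second_moment_quad_kern) auto
  also have "\<dots> = 1024 * real s * D + 768 * (real s)\<^sup>2 * real ((s - 2) choose 2) / C"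
  proof -
    have "real ((s - 1) choose 3) = 4 * C / real s" using c3 s by (simp add: field_simps)
    then show ?thesis using C s by (simp add: field_simps power2_eq_square)
  qed
  also have "768 * (real s)\<^sup>2 * real ((s - 2) choose 2) / C = 9216 * (real s / (real s - 1))"
  proof -
    have "real ((s - 2) choose 2) = 12 * C / (real s * (real s - 1))"
    proof -
      have "12 * C = real s * (3 * real ((s - 1) choose 3))" using c3 by simp
      also have "\<dots> = real s * (real s - 1) * real ((s - 2) choose 2)" unfolding c2 by simp
      finally show ?thesis using s by (simp add: field_simps)
    qed
    then show ?thesis using C s by (simp add: power2_eq_square)
  qed
  \<comment> \<open>For s at least 4 the quotient s / (s - 1) is largest at s = 4; 9216 * 4 / 3 =
    12288 is the constant of the lemma.\<close>
  also have "9216 * (real s / (real s - 1)) \<le> 9216 * (4 / 3)"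
    using s by (intro mult_left_mono) (auto simp: field_simps)
  finally have "measure_pmf.expectation ?M (\<lambda>X. (real s * (U_stat l1 l2 (map X [0..<s]) - D))\<^sup>2) \<le>
    1024 * real s * D + 9216 * (4 / 3)" by simp
  moreover have "0 \<le> real s * D" using D by simp
  ultimately show ?thesis unfolding D_def by argo
qed

subsection \<open>The statistic given the bin labels\<close>

lemma second_moment_sum_orthogonal:
  fixes Y :: "'t \<Rightarrow> 'a \<Rightarrow> real"
  assumes T: "finite T" and bd: "\<And>t. t \<in> T \<Longrightarrow> bdd (Y t)"
    and orth: "\<And>t t'. t \<in> T \<Longrightarrow> t' \<in> T \<Longrightarrow> t \<noteq> t' \<Longrightarrow>
      measure_pmf.expectation M (\<lambda>x. Y t x * Y t' x) = 0"
  shows "measure_pmf.expectation M (\<lambda>x. (\<Sum>t\<in>T. Y t x)\<^sup>2) =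
    (\<Sum>t\<in>T. measure_pmf.expectation M (\<lambda>x. (Y t x)\<^sup>2))"
proof -
  have "measure_pmf.expectation M (\<lambda>x. (\<Sum>t\<in>T. Y t x)\<^sup>2) =
     measure_pmf.expectation M (\<lambda>x. \<Sum>t\<in>T. \<Sum>t'\<in>T. Y t x * Y t' x)"
    by (simp add: power2_eq_square sum_product)
  also have "\<dots> = (\<Sum>t\<in>T. \<Sum>t'\<in>T. measure_pmf.expectation M (\<lambda>x. Y t x * Y t' x))"
    by (simp add: expectation_sum_bdd bd bdd_mult bdd_sum)
  also have "\<dots> = (\<Sum>t\<in>T. \<Sum>t'\<in>T. if t' = t then measure_pmf.expectation M (\<lambda>x. (Y t x)\<^sup>2) else 0)"
    by (intro sum.cong refl) (auto simp: orth power2_eq_square)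
  finally show ?thesis using T by simp
qed

text \<open>Chebyshev's inequality for an event on which \<open>f\<close> is large; \<open>f\<close>
  will be a statistic minus its mean.\<close>

lemma expectation_of_bool_le:
  assumes "bdd f" "a > 0" "\<And>x. R x \<Longrightarrow> a \<le> \<bar>f x\<bar>"
    and V: "measure_pmf.expectation M (\<lambda>x. (f x)\<^sup>2) \<le> V"
  shows "measure_pmf.expectation M (\<lambda>x. of_bool (R x)) \<le> V / a\<^sup>2"
proof -
  have "measure_pmf.expectation M (\<lambda>x. of_bool (R x)) \<le> measure_pmf.expectation M (\<lambda>x. (f x)\<^sup>2 / a\<^sup>2)"
  proof (rule integral_mono)
    fix x show "of_bool (R x) \<le> (f x)\<^sup>2 / a\<^sup>2"
      using assms(2) power_mono[OF assms(3), of x 2] by (cases "R x") (auto simp: field_simps)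
  qed (auto intro!: bdd_integrable bdd_of_bool bdd_divide bdd_power assms)
  also have "\<dots> \<le> V / a\<^sup>2" using V assms(2) by (simp add: divide_right_mono)
  finally show ?thesis .
qed

definition idx :: "(nat \<Rightarrow> nat) \<Rightarrow> nat \<Rightarrow> nat \<Rightarrow> nat list" where
  "idx b N m = filter (\<lambda>i. b i = m) [1..<N + 1]"

text \<open>Labels and pairs are separate arguments, so that conditioning on the labels means fixing
  \<open>b\<close>. The pairs are then independent but not identically distributed.\<close>

definition T_given :: "nat \<Rightarrow> nat \<Rightarrow> nat \<Rightarrow> nat \<Rightarrow> (nat \<Rightarrow> nat) \<Rightarrow> (nat \<Rightarrow> nat \<times> nat) \<Rightarrow> real" where
  "T_given l1 l2 d N b X = (\<Sum>m\<in>{1..d}. of_bool (length (idx b N m) \<ge> 4) * real (length (idx b N m)) *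
     U_stat l1 l2 (map X (idx b N m)))"

text \<open>The expectation of \<open>T_given\<close> for independent pairs with laws
  \<open>Pm (b i)\<close>.\<close>

definition cond_mean :: "(nat \<times> nat) set \<Rightarrow> (nat \<Rightarrow> (nat \<times> nat) pmf) \<Rightarrow> nat \<Rightarrow> nat \<Rightarrow> (nat \<Rightarrow> nat) \<Rightarrow> real" where
  "cond_mean W Pm d N b = (\<Sum>m\<in>{1..d}. of_bool (length (idx b N m) \<ge> 4) * real (length (idx b N m)) * dependence W (Pm m))"

lemma set_idx: "set (idx b N m) = {i \<in> {1..N}. b i = m}"
  by (auto simp: idx_def)

lemma distinct_idx: "distinct (idx b N m)"
  by (simp add: idx_def)

lemma cond_mean_nonneg: "0 \<le> cond_mean W Pm d N b"
  unfolding cond_mean_def by (intro sum_nonneg mult_nonneg_nonneg dependence_nonneg) auto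

lemma sum_length_idx_le: "(\<Sum>m\<in>{1..d}. length (idx b N m)) \<le> N"
proof -
  have "(\<Sum>m\<in>{1..d}. length (idx b N m)) = (\<Sum>m\<in>{1..d}. card {i \<in> {1..N}. b i = m})"
    by (simp add: distinct_card[OF distinct_idx, symmetric] set_idx)
  also have "\<dots> = card (\<Union>m\<in>{1..d}. {i \<in> {1..N}. b i = m})"
    by (intro card_UN_disjoint[symmetric]) auto
  also have "\<dots> \<le> card {1..N}"
    by (intro card_mono) auto
  finally show ?thesis by simp
qed

lemma bdd_U_stat: "bdd (\<lambda>X. U_stat l1 l2 (map X js))"
proof -
  have phi: "bdd (\<lambda>X. phi (map X js) i j x y)" for i j x y
    by (rule bddI[of _ 1]) (auto simp: phi_def)
  show ?thesis
    unfolding U_stat_def length_map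
  proof (intro bdd_divide bdd_sum)
    fix t :: "nat \<times> nat \<times> nat \<times> nat"
    obtain i j k l where t: "t = (i, j, k, l)" by (cases t)
    show "bdd (\<lambda>X. case t of (i, j, k, l) \<Rightarrow> U_kernel l1 l2 (map X js) i j k l)"
      unfolding U_kernel_def t prod.case by (intro bdd_mult bdd_const bdd_sum phi)
  qed
qed

lemma T_given_cong: "(\<And>i. i \<in> {1..N} \<Longrightarrow> X i = Y i) \<Longrightarrow> T_given l1 l2 d N b X = T_given l1 l2 d N b Y"
proof -
  assume *: "\<And>i. i \<in> {1..N} \<Longrightarrow> X i = Y i"
  have "map X (idx b N m) = map Y (idx b N m)" for m
    using * by (auto simp: set_idx)
  then show ?thesis unfolding T_given_def by (simp only:)
qed

context
  fixes n N d l1 l2 :: nat and b :: "nat \<Rightarrow> nat" and Pm :: "nat \<Rightarrow> (nat \<times> nat) pmf"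
    and dflt :: "nat \<times> nat" and M :: "(nat \<Rightarrow> nat \<times> nat) pmf"
  assumes N: "N \<le> n"
  defines "M \<equiv> Pi_pmf {1..n} dflt (\<lambda>i. Pm (b i))"
begin

text \<open>The coordinates with label \<open>m\<close> are i.i.d. from \<open>Pm m\<close>.
  Renumbering them by their position in \<open>idx b N m\<close> leads to the product law for which
  mean and variance of the U-statistic are known.\<close>

lemma expectation_idx:
  "measure_pmf.expectation M (\<lambda>X. F (map X (idx b N m)) :: real) =
    measure_pmf.expectation (Pi_pmf {..<length (idx b N m)} dflt (\<lambda>_. Pm m))
      (\<lambda>X. F (map X [0..<length (idx b N m)]))"
proof -
  define js where "js = idx b N m"
  define S where "S = set js"
  \<comment> \<open>The default 0 matters: observations are numbered from 1, so no index outside the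
    range is mapped into \<open>S\<close>, as \<open>Pi_pmf_bij_betw\<close> demands.\<close>
  define h where "h i = (if i < length js then js ! i else 0)" for i
  have S: "S \<subseteq> {1..n}" using N by (auto simp: S_def js_def set_idx)
  have "bij_betw ((!) js) {..<length js} S"
    using distinct_idx[of b N m] by (intro bij_betw_nth) (auto simp: S_def js_def)
  then have h: "bij_betw h {..<length js} S"
    by (subst bij_betw_cong[where g = "(!) js"]) (auto simp: h_def)
  have "Pi_pmf {..<length js} dflt (\<lambda>_. Pm m) = map_pmf (\<lambda>g. g \<circ> h) (Pi_pmf S dflt (\<lambda>_. Pm m))"
    by (rule Pi_pmf_bij_betw) (use h S in \<open>auto simp: h_def\<close>)
  also have "Pi_pmf S dflt (\<lambda>_. Pm m) = Pi_pmf S dflt (\<lambda>i. Pm (b i))"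
    by (rule Pi_pmf_cong) (auto simp: S_def js_def set_idx)
  also have "\<dots> = map_pmf (\<lambda>f x. if x \<in> S then f x else dflt) M"
    unfolding M_def by (rule Pi_pmf_subset) (use S in auto)
  finally have "measure_pmf.expectation (Pi_pmf {..<length js} dflt (\<lambda>_. Pm m)) (\<lambda>X. F (map X [0..<length js])) =
     measure_pmf.expectation M (\<lambda>X. F (map ((\<lambda>x. if x \<in> S then X x else dflt) \<circ> h) [0..<length js]))"
    by (simp add: comp_def)
  moreover have "map ((\<lambda>x. if x \<in> S then X x else dflt) \<circ> h) [0..<length js] = map X js" for X
    by (rule nth_equalityI) (auto simp: h_def S_def)
  ultimately show ?thesis by (simp add: js_def del: map_map)
qed

definition dev :: "nat \<Rightarrow> (nat \<Rightarrow> nat \<times> nat) \<Rightarrow> real" where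
  "dev m X = of_bool (length (idx b N m) \<ge> 4) *
     (real (length (idx b N m)) * (U_stat l1 l2 (map X (idx b N m)) - dependence (grid l1 l2) (Pm m)))"

lemma bdd_dev: "bdd (dev m)"
  unfolding dev_def by (intro bdd_mult bdd_diff bdd_const bdd_U_stat)

lemma dep_on_dev: "dep_on (dev m) {i \<in> {1..N}. b i = m}"
proof -
  have "map X (idx b N m) = map Y (idx b N m)" if "\<forall>i\<in>{i \<in> {1..N}. b i = m}. X i = Y i" for X Y :: "nat \<Rightarrow> nat \<times> nat"
    using that by (auto simp: set_idx)
  then show ?thesis unfolding dep_on_def dev_def by metis
qed

lemma expectation_dev: "measure_pmf.expectation M (dev m) = 0"
proof (cases "length (idx b N m) \<ge> 4")
  case True
  have "measure_pmf.expectation M (\<lambda>X. U_stat l1 l2 (map X (idx b N m))) = dependence (grid l1 l2) (Pm m)"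
    using expectation_idx[of "U_stat l1 l2" m] expectation_U_stat[OF True] by simp
  then show ?thesis
    unfolding dev_def by (simp add: bdd_integrable bdd_U_stat)
qed (simp add: dev_def[abs_def])

lemma second_moment_dev:
  "measure_pmf.expectation M (\<lambda>X. (dev m X)\<^sup>2) \<le>
    12288 * (of_bool (length (idx b N m) \<ge> 4) * real (length (idx b N m)) * dependence (grid l1 l2) (Pm m) + 1)"
proof (cases "length (idx b N m) \<ge> 4")
  case True
  have "measure_pmf.expectation M (\<lambda>X. (real (length (idx b N m)) *
      (U_stat l1 l2 (map X (idx b N m)) - dependence (grid l1 l2) (Pm m)))\<^sup>2) \<le>
      12288 * (real (length (idx b N m)) * dependence (grid l1 l2) (Pm m) + 1)"
    unfolding expectation_idx[of "\<lambda>D. (real (length (idx b N m)) * (U_stat l1 l2 D - dependence (grid l1 l2) (Pm m)))\<^sup>2"]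
    by (rule variance_U_stat_le[OF True])
  then show ?thesis using True unfolding dev_def by simp
qed (simp add: dev_def)

lemma second_moment_T_given:
  "measure_pmf.expectation M (\<lambda>X. (T_given l1 l2 d N b X - cond_mean (grid l1 l2) Pm d N b)\<^sup>2) \<le>
    12288 * (cond_mean (grid l1 l2) Pm d N b + real d)"
proof -
  have "T_given l1 l2 d N b X - cond_mean (grid l1 l2) Pm d N b = (\<Sum>m\<in>{1..d}. dev m X)" for X
    unfolding T_given_def cond_mean_def dev_def sum_subtractf[symmetric] by (intro sum.cong refl) (simp add: algebra_simps)
  then have "measure_pmf.expectation M (\<lambda>X. (T_given l1 l2 d N b X - cond_mean (grid l1 l2) Pm d N b)\<^sup>2) =
     measure_pmf.expectation M (\<lambda>X. (\<Sum>m\<in>{1..d}. dev m X)\<^sup>2)" by simp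
  also have "\<dots> = (\<Sum>m\<in>{1..d}. measure_pmf.expectation M (\<lambda>X. (dev m X)\<^sup>2))"
  proof (rule second_moment_sum_orthogonal)
    fix m m' :: nat assume "m \<noteq> m'"
    then have "{i \<in> {1..N}. b i = m} \<inter> {i \<in> {1..N}. b i = m'} = {}" by auto
    then have "measure_pmf.expectation M (\<lambda>X. dev m X * dev m' X) =
        measure_pmf.expectation M (dev m) * measure_pmf.expectation M (dev m')"
      unfolding M_def using N
      by (intro expectation_Pi_pmf_mult[OF _ _ dep_on_dev dep_on_dev] bdd_dev) auto
    then show "measure_pmf.expectation M (\<lambda>X. dev m X * dev m' X) = 0"
      by (simp add: expectation_dev)
  qed (auto intro: bdd_dev)
  also have "\<dots> \<le> (\<Sum>m\<in>{1..d}. 12288 * (of_bool (length (idx b N m) \<ge> 4) * real (length (idx b N m)) * dependence (grid l1 l2) (Pm m) + 1))"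
    by (intro sum_mono second_moment_dev)
  also have "\<dots> = 12288 * (cond_mean (grid l1 l2) Pm d N b + real d)"
    unfolding cond_mean_def sum_distrib_left[symmetric] sum.distrib by simp
  finally show ?thesis .
qed

lemma bdd_T_given: "bdd (T_given l1 l2 d N b)"
  unfolding T_given_def by (intro bdd_sum bdd_mult bdd_const bdd_U_stat)

lemma T_given_upper_tail:
  assumes "cond_mean (grid l1 l2) Pm d N b < \<tau>"
  shows "measure_pmf.expectation M (\<lambda>X. of_bool (\<tau> \<le> T_given l1 l2 d N b X)) \<le>
    12288 * (cond_mean (grid l1 l2) Pm d N b + real d) / (\<tau> - cond_mean (grid l1 l2) Pm d N b)\<^sup>2"
  using assms
  by (intro expectation_of_bool_le[OF _ _ _ second_moment_T_given] bdd_diff bdd_T_given bdd_const) auto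

lemma T_given_lower_tail:
  assumes "\<tau> < cond_mean (grid l1 l2) Pm d N b"
  shows "measure_pmf.expectation M (\<lambda>X. of_bool (T_given l1 l2 d N b X < \<tau>)) \<le>
    12288 * (cond_mean (grid l1 l2) Pm d N b + real d) / (cond_mean (grid l1 l2) Pm d N b - \<tau>)\<^sup>2"
  using assms
  by (intro expectation_of_bool_le[OF _ _ _ second_moment_T_given] bdd_diff bdd_T_given bdd_const) auto

end

subsection \<open>Error bounds for binned data\<close>

text \<open>The law P_m of the overview. It is unspecified for labels of probability zero, which is
  why later lemmas ask that \<open>m\<close> lie in the support of the labels.\<close>

definition cell_pmf :: "((nat \<times> nat) \<times> nat) pmf \<Rightarrow> nat \<Rightarrow> (nat \<times> nat) pmf" where
  "cell_pmf r m = map_pmf fst (cond_pmf r {w. snd w = m})"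

definition T_joint :: "nat \<Rightarrow> nat \<Rightarrow> nat \<Rightarrow> nat \<Rightarrow> (nat \<Rightarrow> (nat \<times> nat) \<times> nat) \<Rightarrow> real" where
  "T_joint l1 l2 d N W = T_given l1 l2 d N (\<lambda>i. snd (W i)) (\<lambda>i. fst (W i))"

lemma disintegration_snd:
  "r = bind_pmf (map_pmf snd r) (\<lambda>m. bind_pmf (cell_pmf r m) (\<lambda>u. return_pmf (u, m)))"
proof -
  have "bind_pmf (map_pmf snd r) (\<lambda>m. bind_pmf (cell_pmf r m) (\<lambda>u. return_pmf (u, m))) =
      bind_pmf (map_pmf snd r) (\<lambda>m. cond_pmf r {w. snd w = m})"
  proof (rule bind_pmf_cong[OF refl])
    fix m assume "m \<in> set_pmf (map_pmf snd r)"
    then have ne: "set_pmf r \<inter> {w. snd w = m} \<noteq> {}" by auto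
    have "bind_pmf (cell_pmf r m) (\<lambda>u. return_pmf (u, m)) = map_pmf (\<lambda>w. (fst w, m)) (cond_pmf r {w. snd w = m})"
      by (simp add: cell_pmf_def map_pmf_def[symmetric] map_pmf_comp)
    also have "\<dots> = map_pmf id (cond_pmf r {w. snd w = m})"
      using set_cond_pmf[OF ne] by (intro map_pmf_cong) auto
    finally show "bind_pmf (cell_pmf r m) (\<lambda>u. return_pmf (u, m)) = cond_pmf r {w. snd w = m}"
      by simp
  qed
  also have "\<dots> = r"
  proof (rule bind_cond_pmf_cancel)
    fix m w assume "m \<in> set_pmf (map_pmf snd r)" "w \<in> set_pmf r" "snd w = m"
    then have "{x. snd w = x} = {m}" by auto
    moreover have "{y. snd y = m} = (snd :: (nat \<times> nat) \<times> nat \<Rightarrow> nat) -` {m}" by auto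
    ultimately show "measure_pmf.prob r {y. snd y = m} = measure_pmf.prob (map_pmf snd r) {x. snd w = x}"
      by (simp only: measure_map_pmf)
  qed auto
  finally show ?thesis ..
qed

text \<open>Two-stage sampling in every coordinate: first the label, then the pair from the
  conditional law for that label. The inner expectation is the one studied for fixed labels.\<close>

lemma expectation_joint:
  assumes I: "finite I" and F: "bdd F"
  shows "measure_pmf.expectation (Pi_pmf I dW (\<lambda>_. r)) F =
    measure_pmf.expectation (Pi_pmf I dm (\<lambda>_. map_pmf snd r)) (\<lambda>b.
      measure_pmf.expectation (Pi_pmf I dX (\<lambda>i. cell_pmf r (b i)))
        (\<lambda>X. F (\<lambda>i. if i \<in> I then (X i, b i) else dW)))"
proof -
  have "Pi_pmf I dW (\<lambda>_. r) =
     Pi_pmf I dW (\<lambda>_. bind_pmf (map_pmf snd r) (\<lambda>m. bind_pmf (cell_pmf r m) (\<lambda>u. return_pmf (u, m))))"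
    using disintegration_snd[of r] by simp
  also have "\<dots> = bind_pmf (Pi_pmf I dm (\<lambda>_. map_pmf snd r)) (\<lambda>b.
      bind_pmf (Pi_pmf I dX (\<lambda>i. cell_pmf r (b i))) (\<lambda>X.
        return_pmf (\<lambda>i. if i \<in> I then (X i, b i) else dW)))"
    by (subst Pi_pmf_bind[OF I, where d' = dm], subst Pi_pmf_bind[OF I, where d' = dX])
       (simp add: I)
  finally show ?thesis
    by (simp add: expectation_bind_pmf_bdd[OF F])
qed

lemma T_given_cong_labels:
  assumes "\<And>i. i \<in> {1..N} \<Longrightarrow> b i = b' i" "\<And>i. i \<in> {1..N} \<Longrightarrow> X i = X' i"
  shows "T_given l1 l2 d N b X = T_given l1 l2 d N b' X'"
proof -
  have "idx b N m = idx b' N m" for m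
    unfolding idx_def using assms(1) by (intro filter_cong) auto
  then have "T_given l1 l2 d N b X = T_given l1 l2 d N b' X" unfolding T_given_def by (simp only:)
  then show ?thesis using T_given_cong[of N X X'] assms(2) by simp
qed

lemma T_joint_cong:
  "(\<And>i. i \<in> {1..N} \<Longrightarrow> W i = W' i) \<Longrightarrow> T_joint l1 l2 d N W = T_joint l1 l2 d N W'"
  unfolding T_joint_def by (rule T_given_cong_labels) auto

lemma expectation_T_joint:
  assumes N: "N \<le> n"
  shows "measure_pmf.expectation (Pi_pmf {1..n} dW (\<lambda>_. r)) (\<lambda>W. of_bool (R (T_joint l1 l2 d N W)) :: real) =
    measure_pmf.expectation (Pi_pmf {1..n} 0 (\<lambda>_. map_pmf snd r)) (\<lambda>b.
      measure_pmf.expectation (Pi_pmf {1..n} (0, 0) (\<lambda>i. cell_pmf r (b i)))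
        (\<lambda>X. of_bool (R (T_given l1 l2 d N b X))))"
proof -
  have "T_joint l1 l2 d N (\<lambda>i. if i \<in> {1..n} then (X i, b i) else dW) = T_given l1 l2 d N b X" for b X
    unfolding T_joint_def using N by (intro T_given_cong_labels) auto
  then show ?thesis by (subst expectation_joint[OF _ bdd_of_bool]) simp_all
qed

lemma expectation_le_const:
  assumes "\<And>x. x \<in> set_pmf M \<Longrightarrow> f x \<le> (c::real)" "bdd f"
  shows "measure_pmf.expectation M f \<le> c"
  using assms by (intro measure_pmf.integral_le_const bdd_integrable) (auto simp: AE_measure_pmf_iff)

lemma expectation_of_bool_le_1: "measure_pmf.expectation M (\<lambda>x. of_bool (R x) :: real) \<le> 1"
  by (rule expectation_le_const) (auto intro: bdd_of_bool)

lemma bdd_expectation_of_bool: "bdd (\<lambda>b. measure_pmf.expectation (M b) (\<lambda>x. of_bool (R b x) :: real))"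
  by (rule bddI[of _ 1]) (simp add: expectation_of_bool_le_1)

lemma type1_error_le:
  assumes N: "N \<le> n" and \<delta>: "0 \<le> \<delta>" "real n * \<delta> < \<tau>"
    and D: "\<And>m. m \<in> {1..d} \<Longrightarrow> m \<in> snd ` set_pmf r \<Longrightarrow> dependence (grid l1 l2) (cell_pmf r m) \<le> \<delta>"
  shows "measure_pmf.expectation (Pi_pmf {1..n} dW (\<lambda>_. r)) (\<lambda>W. of_bool (\<tau> \<le> T_joint l1 l2 d N W)) \<le>
    12288 * (real n * \<delta> + real d) / (\<tau> - real n * \<delta>)\<^sup>2"
  unfolding expectation_T_joint[OF N]
proof (rule expectation_le_const)
  fix b assume "b \<in> set_pmf (Pi_pmf {1..n} 0 (\<lambda>_. map_pmf snd r))"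
  then have b: "b i \<in> snd ` set_pmf r" if "i \<in> {1..n}" for i
    using that by (auto simp: set_Pi_pmf PiE_dflt_def)
  let ?M = "cond_mean (grid l1 l2) (cell_pmf r) d N b"
  have "?M \<le> (\<Sum>m\<in>{1..d}. real (length (idx b N m)) * \<delta>)"
    unfolding cond_mean_def
  proof (rule sum_mono)
    fix m assume m: "m \<in> {1..d}"
    show "of_bool (4 \<le> length (idx b N m)) * real (length (idx b N m)) * dependence (grid l1 l2) (cell_pmf r m)
        \<le> real (length (idx b N m)) * \<delta>"
    proof (cases "4 \<le> length (idx b N m)")
      case True
      \<comment> \<open>A bin that contains an observation has a label of positive probability, so
        \<open>D\<close> applies to it; bins with fewer than four observations contribute 0.\<close>
      then obtain i where "i \<in> set (idx b N m)" by (cases "idx b N m") auto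
      then have "m \<in> snd ` set_pmf r" using b[of i] N by (auto simp: set_idx)
      then show ?thesis using D[OF m] True by (auto intro!: mult_left_mono)
    qed (use \<delta> in auto)
  qed
  also have "\<dots> = real (\<Sum>m\<in>{1..d}. length (idx b N m)) * \<delta>"
    by (simp add: sum_distrib_right)
  also have "\<dots> \<le> real n * \<delta>"
    using sum_length_idx_le[of b N d] N \<delta> by (intro mult_right_mono of_nat_mono) auto
  finally have M: "?M \<le> real n * \<delta>" .
  have "measure_pmf.expectation (Pi_pmf {1..n} (0, 0) (\<lambda>i. cell_pmf r (b i)))
      (\<lambda>X. of_bool (\<tau> \<le> T_given l1 l2 d N b X)) \<le> 12288 * (?M + real d) / (\<tau> - ?M)\<^sup>2"
    using M \<delta> by (intro T_given_upper_tail[OF N]) auto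
  \<comment> \<open>The bound increases with the conditional mean as long as that stays below
    \<tau>.\<close>
  also have "\<dots> \<le> 12288 * (real n * \<delta> + real d) / (\<tau> - real n * \<delta>)\<^sup>2"
    using M \<delta> cond_mean_nonneg[of "grid l1 l2" "cell_pmf r" d N b]
    by (intro frac_le power_mono) auto
  finally show "measure_pmf.expectation (Pi_pmf {1..n} (0, 0) (\<lambda>i. cell_pmf r (b i)))
      (\<lambda>X. of_bool (\<tau> \<le> T_given l1 l2 d N b X)) \<le> 12288 * (real n * \<delta> + real d) / (\<tau> - real n * \<delta>)\<^sup>2" .
qed (rule bdd_expectation_of_bool)

text \<open>From 0 \<le> v \<le> 2 follows v^2 \<le> 2 v, so each variance is at most twice the mean
  S. Chebyshev at a quarter of the total mean then gives 2 * 16 = 32.\<close>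

lemma iid_sum_lower_tail:
  fixes v :: "'b \<Rightarrow> real"
  assumes I: "finite I" "J \<subseteq> I" "J \<noteq> {}" and v: "\<And>x. 0 \<le> v x" "\<And>x. v x \<le> 2"
    and S: "S = measure_pmf.expectation P v" "S > 0"
  shows "measure_pmf.expectation (Pi_pmf I dflt (\<lambda>_. P))
     (\<lambda>b. of_bool ((\<Sum>i\<in>J. v (b i)) < 3 / 4 * (real (card J) * S))) \<le> 32 / (real (card J) * S)"
proof -
  let ?M = "Pi_pmf I dflt (\<lambda>_. P)"
  have finJ: "finite J" using I finite_subset by auto
  have c: "real (card J) > 0" using I finJ by (simp add: card_gt_0_iff)
  have bv: "bdd v" using v by (intro bddI[of _ 2]) auto
  have bv': "bdd (\<lambda>b. v (b i))" for i :: 'a by (rule bdd_comp[OF bv])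
  have E: "measure_pmf.expectation ?M (\<lambda>b. v (b i) - S) = 0" if "i \<in> J" for i
    using that I expectation_coord[OF I(1), of i dflt P v] S
    by (subst Bochner_Integration.integral_diff) (auto intro!: bdd_integrable bv')
  have Esq: "measure_pmf.expectation ?M (\<lambda>b. (v (b i) - S)\<^sup>2) \<le> 2 * S" if "i \<in> J" for i
  proof -
    have "measure_pmf.expectation ?M (\<lambda>b. (v (b i) - S)\<^sup>2) = measure_pmf.expectation P (\<lambda>x. (v x - S)\<^sup>2)"
      using that I by (intro expectation_coord[of I i dflt P "\<lambda>x. (v x - S)\<^sup>2"]) auto
    also have "\<dots> \<le> measure_pmf.expectation P (\<lambda>x. 2 * v x - 2 * S * v x + S\<^sup>2)"
    proof (rule integral_mono)
      fix x have "v x * v x \<le> 2 * v x" using v[of x] by (intro mult_right_mono) auto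
      then show "(v x - S)\<^sup>2 \<le> 2 * v x - 2 * S * v x + S\<^sup>2" by (simp add: power2_eq_square algebra_simps)
    qed (intro bdd_integrable bdd_power bdd_diff bdd_add bdd_mult bv bdd_const)+
    also have "\<dots> = 2 * S - 2 * S * S + S\<^sup>2"
      by (simp add: bdd_integrable bv S(1))
    also have "\<dots> \<le> 2 * S" by (simp add: power2_eq_square)
    finally show ?thesis .
  qed
  have "measure_pmf.expectation ?M (\<lambda>b. (\<Sum>i\<in>J. v (b i) - S)\<^sup>2) =
      (\<Sum>i\<in>J. measure_pmf.expectation ?M (\<lambda>b. (v (b i) - S)\<^sup>2))"
  proof (rule second_moment_sum_orthogonal[OF finJ])
    fix i j assume ij: "i \<in> J" "j \<in> J" "i \<noteq> j"
    have "measure_pmf.expectation ?M (\<lambda>b. (v (b i) - S) * (v (b j) - S)) =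
        measure_pmf.expectation ?M (\<lambda>b. v (b i) - S) * measure_pmf.expectation ?M (\<lambda>b. v (b j) - S)"
      using ij I by (intro expectation_Pi_pmf_mult[where A = "{i}" and B = "{j}"] bdd_diff bv' bdd_const)
        (auto simp: dep_on_def)
    then show "measure_pmf.expectation ?M (\<lambda>b. (v (b i) - S) * (v (b j) - S)) = 0"
      using E ij by simp
  qed (intro bdd_diff bv' bdd_const)
  also have "\<dots> \<le> (\<Sum>i\<in>J. 2 * S)" by (intro sum_mono Esq)
  finally have V: "measure_pmf.expectation ?M (\<lambda>b. (\<Sum>i\<in>J. v (b i) - S)\<^sup>2) \<le> 2 * (real (card J) * S)" by simp
  have "measure_pmf.expectation ?M (\<lambda>b. of_bool ((\<Sum>i\<in>J. v (b i)) < 3 / 4 * (real (card J) * S))) \<le>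
      2 * (real (card J) * S) / (real (card J) * S / 4)\<^sup>2"
  proof (rule expectation_of_bool_le[OF _ _ _ V])
    fix b assume "(\<Sum>i\<in>J. v (b i)) < 3 / 4 * (real (card J) * S)"
    then show "real (card J) * S / 4 \<le> \<bar>\<Sum>i\<in>J. v (b i) - S\<bar>"
      unfolding sum_subtractf sum_constant by argo
  qed (use c S(2) in \<open>auto intro!: bdd_sum bdd_diff bv' bdd_const\<close>)
  also have "\<dots> = 32 / (real (card J) * S)"
    using c S(2) by (simp add: power2_eq_square field_simps)
  finally show ?thesis .
qed

text \<open>Grouped by label, the sum over the observations is the sum over \<open>G\<close> of
  sigma_m D_m; the correction 3 is then applied bin by bin. The left side is thereby a sum of i.i.d.
  terms once the labels are random.\<close>

lemma cond_mean_ge: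
  assumes G: "G \<subseteq> {1..d}"
  shows "(\<Sum>i\<in>{1..N}. dependence W (Pm (b i)) * of_bool (b i \<in> G)) - 3 * (\<Sum>m\<in>G. dependence W (Pm m)) \<le> cond_mean W Pm d N b"
proof -
  have fin: "finite G" using G finite_subset by auto
  have "(\<Sum>i\<in>{1..N}. dependence W (Pm (b i)) * of_bool (b i \<in> G)) =
      (\<Sum>i\<in>{1..N}. \<Sum>m\<in>G. if b i = m then dependence W (Pm m) else 0)"
    using fin by (intro sum.cong) (auto simp: sum.delta)
  also have "\<dots> = (\<Sum>m\<in>G. \<Sum>i\<in>{1..N}. if b i = m then dependence W (Pm m) else 0)"
    by (rule sum.swap)
  also have "\<dots> = (\<Sum>m\<in>G. real (length (idx b N m)) * dependence W (Pm m))"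
  proof (rule sum.cong[OF refl])
    fix m
    have "length (idx b N m) = card {i \<in> {1..N}. b i = m}"
      by (simp only: distinct_card[OF distinct_idx, symmetric] set_idx)
    then show "(\<Sum>i\<in>{1..N}. if b i = m then dependence W (Pm m) else 0) = real (length (idx b N m)) * dependence W (Pm m)"
      by (simp add: sum.If_cases Int_def)
  qed
  finally have "(\<Sum>i\<in>{1..N}. dependence W (Pm (b i)) * of_bool (b i \<in> G)) - 3 * (\<Sum>m\<in>G. dependence W (Pm m)) =
      (\<Sum>m\<in>G. (real (length (idx b N m)) - 3) * dependence W (Pm m))"
    by (simp add: sum_distrib_left sum_subtractf[symmetric] algebra_simps)
  also have "\<dots> \<le> (\<Sum>m\<in>G. of_bool (length (idx b N m) \<ge> 4) * real (length (idx b N m)) * dependence W (Pm m))"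
    by (intro sum_mono mult_right_mono dependence_nonneg) auto
  also have "\<dots> \<le> cond_mean W Pm d N b"
    unfolding cond_mean_def using G by (intro sum_mono2 mult_nonneg_nonneg dependence_nonneg) auto
  finally show ?thesis .
qed

text \<open>There are two ways to miss: the labels may give too small a conditional mean, which
  \<open>iid_sum_lower_tail\<close> controls, or T may fall far below its conditional mean, which
  Chebyshev controls.\<close>

lemma type2_error_le:
  fixes r :: "((nat \<times> nat) \<times> nat) pmf" and N n d l1 l2 :: nat and G :: "nat set"
  defines "S \<equiv> (\<Sum>m\<in>G. pmf (map_pmf snd r) m * dependence (grid l1 l2) (cell_pmf r m))"
  assumes N: "N \<le> n" "0 < N" and G: "G \<subseteq> {1..d}" "\<And>m. m \<in> G \<Longrightarrow> 6 \<le> real N * pmf (map_pmf snd r) m"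
    and S: "0 < S" and \<tau>: "8 * \<tau> \<le> real N * S"
  shows "measure_pmf.expectation (Pi_pmf {1..n} dW (\<lambda>_. r)) (\<lambda>W. of_bool (T_joint l1 l2 d N W < \<tau>)) \<le>
    200000 / (real N * S) + 800000 * real d / (real N * S)\<^sup>2"
proof -
  define D where "D m = dependence (grid l1 l2) (cell_pmf r m)" for m
  define v where "v m = D m * of_bool (m \<in> G)" for m
  define x where "x = real N * S / 4"
  define B where "B = 49152 * (1 / x + real d / x\<^sup>2)"
  let ?Q = "Pi_pmf {1..n} 0 (\<lambda>_. map_pmf snd r)"
  let ?Y = "\<lambda>b. \<Sum>i\<in>{1..N}. v (b i)"
  have fin: "finite G" using G finite_subset by auto
  have x: "0 < x" using N S by (simp add: x_def)
  have D: "0 \<le> D m" "D m \<le> 2" for m by (simp_all add: D_def dependence_nonneg dependence_le)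
  have v: "0 \<le> v m" "v m \<le> 2" for m using D[of m] by (auto simp: v_def)
  have "v m = (\<Sum>g\<in>G. D g * of_bool (m = g))" for m
    using fin by (simp add: v_def of_bool_def if_distrib sum.delta cong: if_cong)
  then have "measure_pmf.expectation (map_pmf snd r) v =
      measure_pmf.expectation (map_pmf snd r) (\<lambda>m. \<Sum>g\<in>G. D g * of_bool (m = g))"
    by presburger
  also have "\<dots> = (\<Sum>g\<in>G. measure_pmf.expectation (map_pmf snd r) (\<lambda>m. D g * of_bool (m = g)))"
    by (intro expectation_sum_bdd bdd_mult bdd_const bdd_of_bool)
  also have "\<dots> = S"
    using expectation_of_bool_eq[of "map_pmf snd r" "\<lambda>m. m"]
    by (simp add: S_def D_def pmf.map_ident mult.commute)
  finally have Sv: "S = measure_pmf.expectation (map_pmf snd r) v" ..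
  \<comment> \<open>For a bad label vector the indicator makes the bound trivial; for all others
    \<open>B\<close> suffices.\<close>
  have inner: "measure_pmf.expectation (Pi_pmf {1..n} (0, 0) (\<lambda>i. cell_pmf r (b i)))
      (\<lambda>X. of_bool (T_given l1 l2 d N b X < \<tau>)) \<le> of_bool (?Y b < 3 / 4 * (real N * S)) + B" for b
  proof (cases "?Y b < 3 / 4 * (real N * S)")
    case True
    then show ?thesis
      using expectation_of_bool_le_1 x by (auto simp: B_def intro!: order_trans[OF expectation_of_bool_le_1])
  next
    case False
    let ?M = "cond_mean (grid l1 l2) (cell_pmf r) d N b"
    \<comment> \<open>With 6 expected observations per bin the loss 3 * (sum of D) is at most N S /
      2, which leaves 3/4 - 1/2 = 1/4 of N S; this is \<open>x\<close>.\<close>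
    have "6 * (\<Sum>m\<in>G. D m) \<le> (\<Sum>m\<in>G. (real N * pmf (map_pmf snd r) m) * D m)"
      unfolding sum_distrib_left by (intro sum_mono mult_right_mono G D)
    also have "\<dots> = real N * S"
      by (simp add: S_def D_def sum_distrib_left mult.assoc)
    finally have "3 * (\<Sum>m\<in>G. D m) \<le> real N * S / 2" by simp
    moreover have "?Y b - 3 * (\<Sum>m\<in>G. D m) \<le> ?M"
      using cond_mean_ge[OF G(1), of "grid l1 l2" "cell_pmf r" b N] by (simp add: v_def D_def)
    ultimately have M: "x \<le> ?M" using False by (simp add: x_def)
    have \<tau>x: "2 * \<tau> \<le> x" using \<tau> by (simp add: x_def)
    have "measure_pmf.expectation (Pi_pmf {1..n} (0, 0) (\<lambda>i. cell_pmf r (b i)))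
        (\<lambda>X. of_bool (T_given l1 l2 d N b X < \<tau>)) \<le> 12288 * (?M + real d) / (?M - \<tau>)\<^sup>2"
      using M \<tau>x x by (intro T_given_lower_tail[OF N(1)]) auto
    \<comment> \<open>\<tau> is at most x / 2, hence at most half of the conditional mean.\<close>
    also have "\<dots> \<le> 12288 * (?M + real d) / (?M / 2)\<^sup>2"
      using M \<tau>x x by (intro divide_left_mono power_mono mult_pos_pos mult_nonneg_nonneg) auto
    also have "\<dots> = 49152 * (1 / ?M + real d / ?M\<^sup>2)"
      using M x by (simp add: power2_eq_square field_simps)
    also have "\<dots> \<le> B"
      unfolding B_def using M x by (intro mult_left_mono add_mono divide_left_mono power_mono mult_pos_pos) auto
    finally show ?thesis using False by simp
  qed
  have "measure_pmf.expectation (Pi_pmf {1..n} dW (\<lambda>_. r)) (\<lambda>W. of_bool (T_joint l1 l2 d N W < \<tau>)) \<le>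
      measure_pmf.expectation ?Q (\<lambda>b. of_bool (?Y b < 3 / 4 * (real N * S)) + B)"
    unfolding expectation_T_joint[OF N(1), where R = "\<lambda>t. t < \<tau>"]
    by (intro integral_mono inner bdd_integrable bdd_add bdd_of_bool bdd_const bdd_expectation_of_bool)
  also have "\<dots> = measure_pmf.expectation ?Q (\<lambda>b. of_bool (?Y b < 3 / 4 * (real N * S))) + B"
    by (simp add: bdd_integrable bdd_of_bool)
  also have "\<dots> \<le> 32 / (real N * S) + B"
    using iid_sum_lower_tail[OF _ _ _ v Sv S, of "{1..n}" "{1..N}" 0] N by simp
  \<comment> \<open>The exact constants are 4 * 49152 + 32 and 16 * 49152; both are rounded
    up.\<close>
  also have "\<dots> \<le> 200000 / (real N * S) + 800000 * real d / (real N * S)\<^sup>2"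
  proof -
    have "B = 196608 / (real N * S) + 786432 * real d / (real N * S)\<^sup>2"
      unfolding B_def x_def by (simp add: power2_eq_square field_simps)
    then have "32 / (real N * S) + B = 196640 / (real N * S) + 786432 * real d / (real N * S)\<^sup>2"
      by (simp add: add_divide_distrib[symmetric])
    also have "\<dots> \<le> 200000 / (real N * S) + 800000 * real d / (real N * S)\<^sup>2"
      using N S by (intro add_mono divide_right_mono mult_right_mono) auto
    finally show ?thesis .
  qed
  finally show ?thesis .
qed

subsection \<open>Poisson sample size and reduction to binned data\<close>

text \<open>Chernoff's method: C t^k dominates the indicator of \<open>A\<close>, and the Poisson
  generating function at t is exp (rate (t - 1)).\<close>

lemma poisson_prob_le:
  assumes "rate > 0" "t \<ge> 0" "C \<ge> 0" and le: "\<And>k. k \<in> A \<Longrightarrow> 1 \<le> C * t ^ k"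
  shows "measure_pmf.prob (poisson_pmf rate) A \<le> C * exp (rate * (t - 1))"
proof -
  have "(\<lambda>k. (rate * t) ^ k / fact k) sums exp (rate * t)"
    using exp_converges[of "rate * t"] by (simp add: field_simps)
  from sums_mult[OF this, of "C * exp (- rate)"]
  have s: "(\<lambda>k. (rate ^ k / fact k * exp (- rate)) * (C * t ^ k)) sums (C * exp (rate * (t - 1)))"
    by (simp add: power_mult_distrib field_simps exp_diff exp_minus)
  have "emeasure (measure_pmf (poisson_pmf rate)) A = (\<integral>\<^sup>+k. indicator A k \<partial>measure_pmf (poisson_pmf rate))"
    by simp
  also have "\<dots> \<le> (\<integral>\<^sup>+k. ennreal (C * t ^ k) \<partial>measure_pmf (poisson_pmf rate))"
    using le by (intro nn_integral_mono) (auto simp: indicator_def)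
  also have "\<dots> = (\<Sum>k. ennreal ((rate ^ k / fact k * exp (- rate)) * (C * t ^ k)))"
    using assms by (simp add: nn_integral_measure_pmf nn_integral_count_space_nat ennreal_mult'[symmetric])
  also have "\<dots> = ennreal (C * exp (rate * (t - 1)))"
    using assms s by (intro suminf_ennreal_eq) auto
  finally show ?thesis
    using assms by (simp add: measure_pmf.emeasure_eq_measure)
qed

text \<open>Here t = 2 and C = 2^(-n). The exponent is n (1/2 - ln 2), and ln 2 exceeds 5/8.\<close>

lemma poisson_upper_tail:
  assumes "n \<ge> 1"
  shows "measure_pmf.prob (poisson_pmf (real n / 2)) {N. n < N} \<le> exp (- real n / 8)"
proof -
  have "measure_pmf.prob (poisson_pmf (real n / 2)) {N. n < N} \<le> (1 / 2) ^ n * exp (real n / 2 * (2 - 1))"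
  proof (rule poisson_prob_le)
    fix k assume "k \<in> {N. n < N}"
    then have "(2::real) ^ n \<le> 2 ^ k" by (intro power_increasing) auto
    then show "1 \<le> (1 / 2) ^ n * (2::real) ^ k" by (simp add: power_divide)
  qed (use assms in auto)
  also have "(1 / 2 :: real) ^ n = exp (- real n * ln 2)"
    by (simp add: exp_minus exp_of_nat_mult power_one_over inverse_eq_divide)
  also have "exp (- real n * ln 2) * exp (real n / 2 * (2 - 1)) = exp (real n * (1 / 2 - ln 2))"
    by (simp add: exp_add[symmetric] algebra_simps)
  also have "\<dots> \<le> exp (- real n / 8)"
    using mult_left_mono[of "1 / 2 - ln 2" "- (1 / 8)" "real n"] ln2_ge_two_thirds by simp
  finally show ?thesis .
qed

text \<open>Here t = 1/2 and C = 2^(n/4). The exponent is (n/4) (ln 2 - 1), and ln 2 is below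
  3/4.\<close>

lemma poisson_lower_tail:
  assumes "n \<ge> 1"
  shows "measure_pmf.prob (poisson_pmf (real n / 2)) {N. 4 * N < n} \<le> exp (- real n / 16)"
proof -
  have "measure_pmf.prob (poisson_pmf (real n / 2)) {N. 4 * N < n} \<le> exp (real n / 4 * ln 2) * exp (real n / 2 * (1 / 2 - 1))"
  proof (rule poisson_prob_le)
    fix k assume "k \<in> {N. 4 * N < n}"
    then have "4 * real k \<le> real n" by simp
    then have "0 \<le> (real n / 4 - real k) * ln 2" by simp
    then have "1 \<le> exp ((real n / 4 - real k) * ln 2)" by simp
    also have "\<dots> = exp (real n / 4 * ln 2) * (1 / 2) ^ k"
      by (simp add: left_diff_distrib exp_diff exp_of_nat_mult power_one_over)
    finally show "1 \<le> exp (real n / 4 * ln 2) * (1 / 2) ^ k" .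
  qed (use assms in auto)
  also have "\<dots> = exp (real n / 4 * (ln 2 - 1))"
    by (simp add: exp_add[symmetric] algebra_simps)
  also have "\<dots> \<le> exp (- real n / 16)"
    using mult_left_mono[of "ln 2 - 1" "- (1 / 4)" "real n / 4"] ln2_le_25_over_36 by simp
  finally show ?thesis .
qed

text \<open>The points of mass zero are countably many and so form a null set. Hence almost every
  point is an atom, which is the defining condition of a pmf.\<close>

lemma countable_pmf_exists:
  fixes M :: "'c :: countable measure"
  assumes "prob_space M" "sets M = UNIV"
  shows "\<exists>r. measure_pmf r = M"
proof -
  interpret prob_space M by fact
  have "AE x in M. \<forall>y. measure M {y} = 0 \<longrightarrow> x \<noteq> y"
    unfolding AE_all_countable
  proof
    fix y
    show "AE x in M. measure M {y} = 0 \<longrightarrow> x \<noteq> y"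
    proof (cases "measure M {y} = 0")
      case True
      then have "{y} \<in> null_sets M" using assms(2) by (auto simp: null_sets_def emeasure_eq_measure)
      from AE_not_in[OF this] show ?thesis by eventually_elim auto
    qed simp
  qed
  then have "AE x in M. measure M {x} \<noteq> 0" by eventually_elim auto
  then show ?thesis
    using assms Abs_pmf_inverse[of M] by blast
qed

section \<open>Coding a sample by countably many labels\<close>

context
  fixes p :: "'t measure" and g :: "'t \<Rightarrow> 'c :: countable" and r :: "'c pmf" and I :: "nat set" and dflt :: 'c
  assumes p: "prob_space p" and g: "g \<in> measurable p (count_space UNIV)"
    and r: "measure_pmf r = distr p (count_space UNIV) g" and I: "finite I"
begin

text \<open>The space of all functions is uncountable, but filling the coordinates outside
  \<open>I\<close> with \<open>dflt\<close> confines the coded vectors to the countable set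
  \<open>C\<close>. The two laws are then compared at single points, whose preimages are
  boxes.\<close>

lemma measurable_label_vector:
  "(\<lambda>\<omega> i. if i \<in> I then g (\<omega> i) else dflt) \<in> measurable (\<Pi>\<^sub>M i\<in>I. p) (count_space UNIV)"
  and distr_label_vector:
  "distr (\<Pi>\<^sub>M i\<in>I. p) (count_space UNIV) (\<lambda>\<omega> i. if i \<in> I then g (\<omega> i) else dflt) =
    measure_pmf (Pi_pmf I dflt (\<lambda>_. r))"
proof -
  interpret prob_space p by fact
  interpret P: product_sigma_finite "\<lambda>_. p" by standard
  interpret PP: prob_space "\<Pi>\<^sub>M i\<in>I. p" by (intro prob_space_PiM p)
  let ?G = "\<lambda>\<omega> i. if i \<in> I then g (\<omega> i) else dflt"
  define C where "C = PiE_dflt I dflt (\<lambda>_. UNIV :: 'c set)"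
  have C: "countable C"
    unfolding C_def dflt_image_PiE[symmetric] using I by (intro countable_image countable_PiE) auto
  have pre: "?G -` {a} \<inter> space (\<Pi>\<^sub>M i\<in>I. p) = Pi\<^sub>E I (\<lambda>i. g -` {a i} \<inter> space p)" if "a \<in> C" for a
    using that by (force simp: C_def PiE_dflt_def space_PiM PiE_def Pi_def extensional_def fun_eq_iff)
  have G: "?G \<in> measurable (\<Pi>\<^sub>M i\<in>I. p) (count_space C)"
    unfolding measurable_count_space_eq_countable[OF C]
  proof (intro conjI ballI)
    show "?G \<in> space (\<Pi>\<^sub>M i\<in>I. p) \<rightarrow> C" by (auto simp: C_def PiE_dflt_def)
    fix a assume "a \<in> C"
    then show "?G -` {a} \<inter> space (\<Pi>\<^sub>M i\<in>I. p) \<in> sets (\<Pi>\<^sub>M i\<in>I. p)"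
      unfolding pre[OF \<open>a \<in> C\<close>] using I by (intro sets_PiM_I_finite measurable_sets[OF g]) auto
  qed
  show G': "?G \<in> measurable (\<Pi>\<^sub>M i\<in>I. p) (count_space UNIV)"
    using measurable_compose[OF G, of "\<lambda>x. x" "count_space UNIV"] by simp
  show "distr (\<Pi>\<^sub>M i\<in>I. p) (count_space UNIV) ?G = measure_pmf (Pi_pmf I dflt (\<lambda>_. r))"
  proof (rule measure_eqI_countable_AE[OF _ _ _ _ C])
    show "AE x in distr (\<Pi>\<^sub>M i\<in>I. p) (count_space UNIV) ?G. x \<in> C"
      by (subst AE_distr_iff[OF G']) (auto simp: C_def PiE_dflt_def)
    show "AE x in measure_pmf (Pi_pmf I dflt (\<lambda>_. r)). x \<in> C"
      using I by (auto simp: AE_measure_pmf_iff set_Pi_pmf C_def PiE_dflt_def)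
    fix a assume a: "a \<in> C"
    have "emeasure (distr (\<Pi>\<^sub>M i\<in>I. p) (count_space UNIV) ?G) {a} = (\<Prod>i\<in>I. emeasure p (g -` {a i} \<inter> space p))"
      using I by (simp add: emeasure_distr[OF G'] pre[OF a] P.emeasure_PiM measurable_sets[OF g])
    also have "\<dots> = (\<Prod>i\<in>I. ennreal (pmf r (a i)))"
      by (simp add: emeasure_pmf_single[symmetric] r emeasure_distr[OF g])
    also have "\<dots> = emeasure (Pi_pmf I dflt (\<lambda>_. r)) {a}"
      using a I by (simp add: emeasure_pmf_single pmf_Pi C_def PiE_dflt_def prod_ennreal)
    finally show "emeasure (distr (\<Pi>\<^sub>M i\<in>I. p) (count_space UNIV) ?G) {a} = emeasure (Pi_pmf I dflt (\<lambda>_. r)) {a}" .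
  qed auto
qed

lemma nn_integral_label_vector:
  fixes P :: "nat pmf"
  assumes f: "\<And>N \<omega>. f N \<omega> = F N (\<lambda>i. if i \<in> I then g (\<omega> i) else dflt)"
  shows "(\<integral>\<^sup>+(N, \<omega>). ennreal (f N \<omega>) \<partial>(measure_pmf P \<Otimes>\<^sub>M (\<Pi>\<^sub>M i\<in>I. p))) =
    (\<integral>\<^sup>+N. \<integral>\<^sup>+W. ennreal (F N W) \<partial>measure_pmf (Pi_pmf I dflt (\<lambda>_. r)) \<partial>measure_pmf P)"
proof -
  interpret PP: prob_space "\<Pi>\<^sub>M i\<in>I. p" by (intro prob_space_PiM p)
  note G = measurable_label_vector
  have m: "(\<lambda>\<omega>. ennreal (f N \<omega>)) \<in> borel_measurable (\<Pi>\<^sub>M i\<in>I. p)" for N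
    unfolding f by (rule measurable_compose[OF G]) simp
  have "(\<lambda>(N, \<omega>). ennreal (f N \<omega>)) \<in> borel_measurable (count_space UNIV \<Otimes>\<^sub>M (\<Pi>\<^sub>M i\<in>I. p))"
    by (rule measurable_pair_measure_countable1) (simp_all add: m)
  then have "(\<lambda>(N, \<omega>). ennreal (f N \<omega>)) \<in> borel_measurable (measure_pmf P \<Otimes>\<^sub>M (\<Pi>\<^sub>M i\<in>I. p))"
    by (simp cong: measurable_cong_sets sets_pair_measure_cong)
  from PP.nn_integral_fst[OF this]
  have "(\<integral>\<^sup>+(N, \<omega>). ennreal (f N \<omega>) \<partial>(measure_pmf P \<Otimes>\<^sub>M (\<Pi>\<^sub>M i\<in>I. p))) =
      (\<integral>\<^sup>+N. \<integral>\<^sup>+\<omega>. ennreal (f N \<omega>) \<partial>(\<Pi>\<^sub>M i\<in>I. p) \<partial>measure_pmf P)" by simp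
  also have "\<dots> = (\<integral>\<^sup>+N. \<integral>\<^sup>+W. ennreal (F N W) \<partial>measure_pmf (Pi_pmf I dflt (\<lambda>_. r)) \<partial>measure_pmf P)"
    unfolding distr_label_vector[symmetric] f by (subst nn_integral_distr[OF G]) auto
  finally show ?thesis .
qed

end

text \<open>\<open>min d\<close> puts the end point 1 into the last bin, in agreement with
  \<open>bin\<close>; the value 0, not the number of a bin, marks points outside the unit
  interval.\<close>

definition bin_index :: "nat \<Rightarrow> real \<Rightarrow> nat" where
  "bin_index d z = (if z \<in> {0..1} then min d (nat \<lfloor>real d * z\<rfloor> + 1) else 0)"

lemma bin_iff_bin_index:
  assumes m: "m \<in> {1..d}"
  shows "z \<in> bin d m \<longleftrightarrow> bin_index d z = m"
proof (cases "z \<in> {0..1}")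
  case True
  define f where "f = \<lfloor>real d * z\<rfloor>"
  have d: "real d > 0" using m by simp
  have "real d * z \<le> real d * 1" using True d by (intro mult_left_mono) auto
  then have "real d * z < real d + 1" by simp
  then have f0: "0 \<le> f" "f \<le> int d" using True d by (auto simp: f_def floor_le_iff)
  have lo: "(real m - 1) / real d \<le> z \<longleftrightarrow> int m - 1 \<le> f"
  proof -
    have "(real m - 1) / real d \<le> z \<longleftrightarrow> real_of_int (int m - 1) \<le> real d * z"
      using d by (simp add: divide_le_eq mult.commute)
    then show ?thesis unfolding f_def le_floor_iff .
  qed
  have hi: "z < real m / real d \<longleftrightarrow> f < int m"
  proof -
    have "z < real m / real d \<longleftrightarrow> real d * z < real_of_int (int m)"
      using d by (simp add: less_divide_eq mult.commute)
    then show ?thesis unfolding f_def floor_less_iff .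
  qed
  have bin_index: "bin_index d z = min d (nat f + 1)" using True by (simp add: bin_index_def f_def)
  show ?thesis
  proof (cases "m = d")
    case True
    then show ?thesis using \<open>z \<in> {0..1}\<close> lo f0 unfolding bin_index by (auto simp: bin_def)
  next
    case False
    then show ?thesis using \<open>z \<in> {0..1}\<close> lo hi f0 m unfolding bin_index by (auto simp: bin_def)
  qed
next
  case False
  have "z \<notin> bin d m"
  proof
    assume "z \<in> bin d m"
    then have "(real m - 1) / real d \<le> z" "z \<le> 1"
      using m by (auto simp: bin_def split: if_splits intro: order.trans[OF less_imp_le])
    moreover have "0 \<le> (real m - 1) / real d" using m by simp
    ultimately show False using False by auto
  qed
  then show ?thesis using False m by (auto simp: bin_index_def)
qed

lemma bin_index_le: "bin_index d z \<le> d"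
  by (simp add: bin_index_def)

lemma bin_index_pos: "d \<ge> 1 \<Longrightarrow> z \<in> {0..1} \<Longrightarrow> 1 \<le> bin_index d z"
  by (simp add: bin_index_def)

lemma bin_index_dist:
  assumes m: "m \<in> {1..d}" and "bin_index d z = m" "bin_index d z' = m"
  shows "\<bar>z - z'\<bar> \<le> 1 / real d" "z \<in> {0..1}" "z' \<in> {0..1}"
proof -
  have "z \<in> bin d m" "z' \<in> bin d m" using assms bin_iff_bin_index[OF m] by auto
  then have "(real m - 1) / real d \<le> z" "z \<le> real m / real d" "(real m - 1) / real d \<le> z'" "z' \<le> real m / real d"
    using m by (auto simp: bin_def split: if_splits)
  moreover have "real m / real d = (real m - 1) / real d + 1 / real d" by (simp add: add_divide_distrib[symmetric])
  ultimately show "\<bar>z - z'\<bar> \<le> 1 / real d" by linarith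
  show "z \<in> {0..1}" "z' \<in> {0..1}" using assms by (auto simp: bin_index_def split: if_splits)
qed

lemma measurable_bin_index [measurable]: "bin_index d \<in> borel \<rightarrow>\<^sub>M count_space UNIV"
  unfolding bin_index_def by measurable

definition cell_of :: "nat \<Rightarrow> nat \<times> nat \<times> real \<Rightarrow> (nat \<times> nat) \<times> nat" where
  "cell_of d t = (case t of (x, y, z) \<Rightarrow> ((x, y), bin_index d z))"

lemma T_stat_eq:
  assumes N: "N \<le> n"
  shows "T_stat l1 l2 d N \<omega> = T_joint l1 l2 d N (\<lambda>i. if i \<in> {1..n} then cell_of d (\<omega> i) else dW)"
proof -
  have *: "bin_data d N \<omega> m = map (\<lambda>i. fst (cell_of d (\<omega> i))) (idx (\<lambda>i. snd (cell_of d (\<omega> i))) N m)"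
    if m: "m \<in> {1..d}" for m
  proof -
    \<comment> \<open>This is what the list comprehension in \<open>bin_data\<close> unfolds to,
      stated for an arbitrary list \<open>js\<close> so that induction applies.\<close>
    have "concat (map (\<lambda>t. case t of (x, y, z) \<Rightarrow> if z \<in> bin d m then [(x, y)] else []) (map \<omega> js)) =
        map (\<lambda>i. fst (cell_of d (\<omega> i))) (filter (\<lambda>i. snd (cell_of d (\<omega> i)) = m) js)" for js
      by (induction js) (auto simp: cell_of_def bin_iff_bin_index[OF m] split: prod.splits)
    then show ?thesis by (simp add: bin_data_def idx_def)
  qed
  have "T_stat l1 l2 d N \<omega> = T_joint l1 l2 d N (\<lambda>i. cell_of d (\<omega> i))"
    unfolding T_stat_def T_joint_def T_given_def Let_def by (intro sum.cong refl) (simp only: * length_map)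
  also have "\<dots> = T_joint l1 l2 d N (\<lambda>i. if i \<in> {1..n} then cell_of d (\<omega> i) else dW)"
    using N by (intro T_joint_cong) auto
  finally show ?thesis .
qed

subsection \<open>Measures with a given conditional kernel\<close>

definition rect :: "(nat \<times> nat) set \<Rightarrow> real set \<Rightarrow> (nat \<times> nat \<times> real) set" where
  "rect A B = {(x, y, z). (x, y) \<in> A \<and> z \<in> B}"

lemma sets_rect [measurable]:
  assumes "B \<in> sets borel" shows "rect A B \<in> sets triple_space"
proof -
  have "rect A B = (\<Union>u\<in>A. {fst u} \<times> ({snd u} \<times> B))" by (auto simp: rect_def)
  also have "\<dots> \<in> sets triple_space"
    unfolding triple_space_def using assms
    by (intro sets.countable_UN' pair_measureI) (auto intro!: pair_measureI)
  finally show ?thesis .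
qed

lemma measurable_triple_snd_snd [measurable]: "(\<lambda>(x, y, z). z) \<in> triple_space \<rightarrow>\<^sub>M borel"
  unfolding triple_space_def by measurable

definition swap_triple :: "real \<times> nat \<times> nat \<Rightarrow> nat \<times> nat \<times> real" where
  "swap_triple w = (fst (snd w), snd (snd w), fst w)"

lemma measurable_swap_triple: "swap_triple \<in> borel \<Otimes>\<^sub>M count_space UNIV \<rightarrow>\<^sub>M triple_space"
  unfolding swap_triple_def triple_space_def
  by (intro measurable_Pair measurable_compose[OF measurable_snd] measurable_fst) auto

text \<open>A dominating measure shared by all distributions with the same law \<open>pZ\<close> of
  Z: the product of \<open>pZ\<close> with counting measure, reordered to (x, y, z).\<close>

definition base_measure :: "real measure \<Rightarrow> (nat \<times> nat \<times> real) measure" where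
  "base_measure pZ = distr (pZ \<Otimes>\<^sub>M count_space UNIV) triple_space swap_triple"

text \<open>Given by a density, so that \<open>l1_dist_density\<close> reduces the distance of two
  such measures over one \<open>pZ\<close> to a comparison of their kernels.\<close>

definition joint :: "real measure \<Rightarrow> (real \<Rightarrow> (nat \<times> nat) pmf) \<Rightarrow> (nat \<times> nat \<times> real) measure" where
  "joint pZ k = density (base_measure pZ) (\<lambda>(x, y, z). ennreal (pmf (k z) (x, y)))"

lemma sets_base_measure [simp]: "sets (base_measure pZ) = sets triple_space"
  by (simp add: base_measure_def)

lemma sets_joint [simp]: "sets (joint pZ k) = sets triple_space"
  by (simp add: joint_def)

lemma space_triple_space [simp]: "space triple_space = UNIV"
  by (simp add: triple_space_def space_pair_measure)

lemma measurable_triple: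
  assumes "\<And>u. h u \<in> borel \<rightarrow>\<^sub>M M"
  shows "(\<lambda>(x, y, z). h (x, y) z) \<in> triple_space \<rightarrow>\<^sub>M M"
  unfolding triple_space_def
  by (rule measurable_pair_measure_countable1, simp, simp, rule measurable_pair_measure_countable1)
     (simp_all add: assms)

lemma nn_integral_base_measure:
  assumes pZ: "sets pZ = sets borel" and h: "\<And>u. h u \<in> borel_measurable borel"
  shows "(\<integral>\<^sup>+t. (case t of (x, y, z) \<Rightarrow> h (x, y) z) \<partial>base_measure pZ) =
    (\<integral>\<^sup>+z. \<integral>\<^sup>+u. h u z \<partial>count_space UNIV \<partial>pZ)"
proof -
  interpret C: sigma_finite_measure "count_space (UNIV :: (nat \<times> nat) set)"
    by (rule sigma_finite_measure_count_space_countable) simp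
  note m = measurable_triple[of h borel, OF h]
  have s: "swap_triple \<in> pZ \<Otimes>\<^sub>M count_space UNIV \<rightarrow>\<^sub>M triple_space"
    using measurable_swap_triple measurable_cong_sets[OF sets_pair_measure_cong[OF pZ refl] refl] by blast
  have "(\<integral>\<^sup>+t. (case t of (x, y, z) \<Rightarrow> h (x, y) z) \<partial>base_measure pZ) =
     (\<integral>\<^sup>+w. h (snd w) (fst w) \<partial>(pZ \<Otimes>\<^sub>M count_space UNIV))"
    unfolding base_measure_def by (subst nn_integral_distr[OF s]) (use m in \<open>simp_all add: swap_triple_def\<close>)
  also have "\<dots> = (\<integral>\<^sup>+z. \<integral>\<^sup>+u. h u z \<partial>count_space UNIV \<partial>pZ)"
    using measurable_compose[OF s m] by (subst C.nn_integral_fst[symmetric]) (simp_all add: swap_triple_def)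
  finally show ?thesis .
qed

definition measurable_kernel :: "(real \<Rightarrow> (nat \<times> nat) pmf) \<Rightarrow> bool" where
  "measurable_kernel k \<longleftrightarrow> (\<lambda>z. measure_pmf (k z)) \<in> borel \<rightarrow>\<^sub>M prob_algebra (count_space UNIV)"

lemma measurable_kernel_emeasure: "measurable_kernel k \<Longrightarrow> (\<lambda>z. emeasure (measure_pmf (k z)) A) \<in> borel_measurable borel"
  unfolding measurable_kernel_def
  by (rule measurable_compose[OF measurable_prob_algebraD measurable_emeasure_subprob_algebra]) auto

lemma measurable_kernel_prob: "measurable_kernel k \<Longrightarrow> (\<lambda>z. measure_pmf.prob (k z) A) \<in> borel_measurable borel"
  unfolding measure_def using borel_measurable_enn2real[OF measurable_kernel_emeasure] by simp

lemma measurable_kernel_pmf: "measurable_kernel k \<Longrightarrow> (\<lambda>z. pmf (k z) u) \<in> borel_measurable borel"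
  using measurable_kernel_prob[of k "{u}"] by (simp add: pmf.rep_eq)

lemma measurable_kernel_simple:
  assumes "f \<in> borel \<rightarrow>\<^sub>M count_space UNIV"
  shows "measurable_kernel (\<lambda>z. h (f z))"
  unfolding measurable_kernel_def
  by (rule measurable_compose[OF assms]) (auto simp: space_prob_algebra measure_pmf.prob_space_axioms)

lemma cond_XY_iff:
  "cond_XY p k \<longleftrightarrow> measurable_kernel k \<and> (\<forall>A. \<forall>B\<in>sets borel. emeasure p (rect A B) =
     (\<integral>\<^sup>+z\<in>B. emeasure (measure_pmf (k z)) A \<partial>distr_Z p))"
  by (simp add: cond_XY_def measurable_kernel_def rect_def)

lemma emeasure_joint_rect:
  assumes pZ: "sets pZ = sets borel" and k: "measurable_kernel k" and B: "B \<in> sets borel"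
  shows "emeasure (joint pZ k) (rect A B) = (\<integral>\<^sup>+z\<in>B. emeasure (measure_pmf (k z)) A \<partial>pZ)"
proof -
  have m: "(\<lambda>z. ennreal (pmf (k z) u)) \<in> borel_measurable borel" for u
    using measurable_kernel_pmf[OF k] by simp
  have "emeasure (joint pZ k) (rect A B) =
     (\<integral>\<^sup>+t. (case t of (x, y, z) \<Rightarrow> ennreal (pmf (k z) (x, y)) * (indicator A (x, y) * indicator B z)) \<partial>base_measure pZ)"
    unfolding joint_def
  proof (subst emeasure_density)
    show "(\<lambda>(x, y, z). ennreal (pmf (k z) (x, y))) \<in> borel_measurable (base_measure pZ)"
      using measurable_triple[of "\<lambda>u z. ennreal (pmf (k z) u)" borel, OF m]
      by (simp cong: measurable_cong_sets)
  qed (use B in \<open>auto simp: rect_def[symmetric] sets_rect intro!: nn_integral_cong split: split_indicator\<close>, auto simp: rect_def)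
  also have "\<dots> = (\<integral>\<^sup>+z. \<integral>\<^sup>+u. ennreal (pmf (k z) u) * (indicator A u * indicator B z) \<partial>count_space UNIV \<partial>pZ)"
    using m B by (intro nn_integral_base_measure[OF pZ, of "\<lambda>u z. ennreal (pmf (k z) u) * (indicator A u * indicator B z)"]) simp
  also have "\<dots> = (\<integral>\<^sup>+z\<in>B. emeasure (measure_pmf (k z)) A \<partial>pZ)"
  proof (rule nn_integral_cong)
    fix z
    have "(\<integral>\<^sup>+u. ennreal (pmf (k z) u) * (indicator A u * indicator B z) \<partial>count_space UNIV) =
        (\<integral>\<^sup>+u. indicator A u * indicator B z \<partial>measure_pmf (k z))"
      by (simp add: nn_integral_measure_pmf)
    then show "(\<integral>\<^sup>+u. ennreal (pmf (k z) u) * (indicator A u * indicator B z) \<partial>count_space UNIV) =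
        emeasure (measure_pmf (k z)) A * indicator B z"
      by (simp add: nn_integral_multc)
  qed
  finally show ?thesis .
qed

text \<open>Rectangles over single points \<open>(x, y)\<close> determine a measure because \<open>(x, y)\<close> is discrete.\<close>
lemma triple_measure_eqI:
  assumes "sets p = sets triple_space" "sets q = sets triple_space"
    and eq: "\<And>u B. B \<in> sets borel \<Longrightarrow> emeasure p (rect {u} B) = emeasure q (rect {u} B)"
  shows "p = q"
proof (rule measure_eqI)
  show "sets p = sets q" using assms by simp
  fix S assume "S \<in> sets p"
  then have S: "S \<in> sets triple_space" using assms by simp
  define X where "X u = rect {u} {z. (fst u, snd u, z) \<in> S}" for u
  have B: "{z. (fst u, snd u, z) \<in> S} \<in> sets borel" for u
  proof -
    have "(\<lambda>z. (fst u, snd u, z)) \<in> borel \<rightarrow>\<^sub>M triple_space" unfolding triple_space_def by measurable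
    from measurable_sets[OF this S] show ?thesis by (simp add: vimage_def)
  qed
  have SX: "S = (\<Union>u. X u)" by (auto simp: X_def rect_def)
  have d: "disjoint_family X" by (auto simp: disjoint_family_on_def X_def rect_def)
  have SX': "X u \<in> sets triple_space" for u unfolding X_def by (rule sets_rect[OF B])
  have "emeasure p (\<Union>u. X u) = (\<integral>\<^sup>+u. emeasure p (X u) \<partial>count_space UNIV)"
    using assms SX' d by (intro emeasure_UN_countable) auto
  also have "\<dots> = (\<integral>\<^sup>+u. emeasure q (X u) \<partial>count_space UNIV)"
    unfolding X_def by (simp add: eq[OF B])
  also have "\<dots> = emeasure q (\<Union>u. X u)"
    using assms SX' d by (intro emeasure_UN_countable[symmetric]) auto
  finally show "emeasure p S = emeasure q S" using SX by simp
qed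

text \<open>The rectangles over single points determine \<open>p\<close>. Thereby \<open>p\<close>
  has an explicit density with respect to \<open>base_measure\<close>.\<close>

lemma cond_XY_eq_joint:
  assumes "sets p = sets triple_space" "cond_XY p k"
  shows "p = joint (distr_Z p) k"
  using assms
  by (intro triple_measure_eqI) (auto simp: cond_XY_iff emeasure_joint_rect distr_Z_def)

lemma rect_UNIV: "rect UNIV B = (\<lambda>(x, y, z). z) -` B"
  by (auto simp: rect_def)

lemma joint_props:
  assumes pZ: "sets pZ = sets borel" "prob_space pZ" and k: "measurable_kernel k"
  shows "prob_space (joint pZ k)" "distr_Z (joint pZ k) = pZ" "cond_XY (joint pZ k) k"
proof -
  interpret prob_space pZ by fact
  have U: "emeasure (joint pZ k) (rect UNIV B) = emeasure pZ B" if "B \<in> sets borel" for B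
    using that pZ k by (simp add: emeasure_joint_rect)
  have sp: "space (joint pZ k) = UNIV"
    by (metis sets_eq_imp_space_eq sets_joint space_triple_space)
  have spZ: "space pZ = UNIV" using sets_eq_imp_space_eq[OF pZ(1)] by simp
  have "emeasure (joint pZ k) UNIV = 1"
    using U[of UNIV] emeasure_space_1 by (simp add: spZ rect_def case_prod_unfold)
  then show "prob_space (joint pZ k)" by (intro prob_spaceI) (simp add: sp)
  have "(\<lambda>(x, y, z). z) \<in> joint pZ k \<rightarrow>\<^sub>M borel"
    using measurable_triple_snd_snd by (simp cong: measurable_cong_sets)
  then show dZ: "distr_Z (joint pZ k) = pZ"
    unfolding distr_Z_def
    by (intro measure_eqI) (auto simp: emeasure_distr sp pZ rect_UNIV[symmetric] U)
  show "cond_XY (joint pZ k) k"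
    unfolding cond_XY_iff dZ using k emeasure_joint_rect[OF pZ(1) k] by simp
qed

text \<open>For each of the countably many pairs u the two kernels have equal integrals over all
  Borel sets. The lemma carries support and independence, which the classes state for versions of
  their own, over to the smooth version.\<close>

lemma cond_XY_AE_unique:
  assumes p: "prob_space p" "sets p = sets triple_space" and k: "cond_XY p k" and k': "cond_XY p k'"
  shows "AE z in distr_Z p. k z = k' z"
proof -
  have mZ: "(\<lambda>(x, y, z). z) \<in> p \<rightarrow>\<^sub>M borel"
    using measurable_triple_snd_snd p by (simp cong: measurable_cong_sets)
  interpret Z: prob_space "distr_Z p"
    unfolding distr_Z_def by (rule prob_space.prob_space_distr[OF p(1) mZ])
  have "AE z in distr_Z p. \<forall>u. pmf (k z) u = pmf (k' z) u"
    unfolding AE_all_countable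
  proof
    fix u
    have m: "(\<lambda>z. emeasure (measure_pmf (k z)) {u}) \<in> borel_measurable (distr_Z p)"
      "(\<lambda>z. emeasure (measure_pmf (k' z)) {u}) \<in> borel_measurable (distr_Z p)"
      using k k' measurable_kernel_emeasure by (auto simp: cond_XY_iff distr_Z_def)
    have "AE z in distr_Z p. emeasure (measure_pmf (k z)) {u} = emeasure (measure_pmf (k' z)) {u}"
    proof (rule Z.density_unique[OF m])
      show "density (distr_Z p) (\<lambda>z. emeasure (measure_pmf (k z)) {u}) = density (distr_Z p) (\<lambda>z. emeasure (measure_pmf (k' z)) {u})"
      proof (rule measure_eqI)
        fix B assume "B \<in> sets (density (distr_Z p) (\<lambda>z. emeasure (measure_pmf (k z)) {u}))"
        then have B: "B \<in> sets borel" by (simp add: distr_Z_def)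
        then show "emeasure (density (distr_Z p) (\<lambda>z. emeasure (measure_pmf (k z)) {u})) B =
            emeasure (density (distr_Z p) (\<lambda>z. emeasure (measure_pmf (k' z)) {u})) B"
          using k k' m by (simp add: emeasure_density cond_XY_iff) (simp add: distr_Z_def emeasure_density)
      qed simp
    qed
    then show "AE z in distr_Z p. pmf (k z) u = pmf (k' z) u"
      by eventually_elim (simp add: emeasure_pmf_single)
  qed
  then show ?thesis by eventually_elim (blast intro: pmf_eqI)
qed

subsection \<open>Conditional distributions within a bin\<close>

lemma (in prob_space) integrable_bounded:
  fixes f :: "'a \<Rightarrow> real"
  assumes "f \<in> borel_measurable M" "AE x in M. \<bar>f x\<bar> \<le> c"
  shows "integrable M f"
  using assms by (intro integrable_const_bound[of _ c]) auto

text \<open>The covariance is invariant under the shifts by \<open>a0\<close> and \<open>b0\<close>.\<close>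
lemma (in prob_space) sum_abs_covariance_le:
  fixes a :: "'i \<Rightarrow> 'a \<Rightarrow> real" and b :: "'j \<Rightarrow> 'a \<Rightarrow> real"
  assumes fin: "finite A" "finite B"
    and meas: "\<And>x. a x \<in> borel_measurable M" "\<And>y. b y \<in> borel_measurable M"
    and a: "AE z in M. (\<Sum>x\<in>A. \<bar>a x z - a0 x\<bar>) \<le> h" and b: "AE z in M. (\<Sum>y\<in>B. \<bar>b y z - b0 y\<bar>) \<le> h"
    and h: "0 \<le> h"
  shows "(\<Sum>(x, y)\<in>A \<times> B. \<bar>(\<integral>z. a x z * b y z \<partial>M) - (\<integral>z. a x z \<partial>M) * (\<integral>z. b y z \<partial>M)\<bar>) \<le> 2 * h\<^sup>2"
proof -
  define \<alpha> where "\<alpha> x z = a x z - a0 x" for x z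
  define \<beta> where "\<beta> y z = b y z - b0 y" for y z
  have [measurable]: "\<alpha> x \<in> borel_measurable M" "\<beta> y \<in> borel_measurable M" for x y
    using meas by (auto simp: \<alpha>_def[abs_def] \<beta>_def[abs_def])
  have \<alpha>: "AE z in M. \<bar>\<alpha> x z\<bar> \<le> h" if "x \<in> A" for x
    using a
  proof eventually_elim
    case (elim z)
    have "\<bar>a x z - a0 x\<bar> \<le> (\<Sum>x\<in>A. \<bar>a x z - a0 x\<bar>)"
      using that fin by (intro member_le_sum[of x A "\<lambda>x. \<bar>a x z - a0 x\<bar>"]) auto
    then show ?case using elim by (simp add: \<alpha>_def)
  qed
  have \<beta>: "AE z in M. \<bar>\<beta> y z\<bar> \<le> h" if "y \<in> B" for y
    using b
  proof eventually_elim
    case (elim z)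
    have "\<bar>b y z - b0 y\<bar> \<le> (\<Sum>y\<in>B. \<bar>b y z - b0 y\<bar>)"
      using that fin by (intro member_le_sum[of y B "\<lambda>y. \<bar>b y z - b0 y\<bar>"]) auto
    then show ?case using elim by (simp add: \<beta>_def)
  qed
  have I\<alpha>: "integrable M (\<alpha> x)" "integrable M (\<lambda>z. \<bar>\<alpha> x z\<bar>)" if "x \<in> A" for x
    using \<alpha>[OF that] by (auto intro!: integrable_bounded[of _ h])
  have I\<beta>: "integrable M (\<beta> y)" "integrable M (\<lambda>z. \<bar>\<beta> y z\<bar>)" if "y \<in> B" for y
    using \<beta>[OF that] by (auto intro!: integrable_bounded[of _ h])
  have I\<alpha>\<beta>: "integrable M (\<lambda>z. \<alpha> x z * \<beta> y z)" "integrable M (\<lambda>z. \<bar>\<alpha> x z\<bar> * \<bar>\<beta> y z\<bar>)"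
    if "x \<in> A" "y \<in> B" for x y
  proof -
    have ae: "AE z in M. \<bar>\<alpha> x z * \<beta> y z\<bar> \<le> h * h" "AE z in M. \<bar>\<bar>\<alpha> x z\<bar> * \<bar>\<beta> y z\<bar>\<bar> \<le> h * h"
      using \<alpha>[OF that(1)] \<beta>[OF that(2)] by (eventually_elim, simp add: abs_mult mult_mono')+
    show "integrable M (\<lambda>z. \<alpha> x z * \<beta> y z)" "integrable M (\<lambda>z. \<bar>\<alpha> x z\<bar> * \<bar>\<beta> y z\<bar>)"
      using integrable_bounded[OF _ ae(1)] integrable_bounded[OF _ ae(2)] by simp_all
  qed
  have cov: "\<bar>(\<integral>z. a x z * b y z \<partial>M) - (\<integral>z. a x z \<partial>M) * (\<integral>z. b y z \<partial>M)\<bar> \<le>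
      (\<integral>z. \<bar>\<alpha> x z\<bar> * \<bar>\<beta> y z\<bar> \<partial>M) + (\<integral>z. \<bar>\<alpha> x z\<bar> \<partial>M) * (\<integral>z. \<bar>\<beta> y z\<bar> \<partial>M)"
    if xy: "x \<in> A" "y \<in> B" for x y
  proof -
    note ints = I\<alpha>[OF xy(1)] I\<beta>[OF xy(2)] I\<alpha>\<beta>[OF xy]
    have "(\<integral>z. a x z \<partial>M) = (\<integral>z. \<alpha> x z + a0 x \<partial>M)" "(\<integral>z. b y z \<partial>M) = (\<integral>z. \<beta> y z + b0 y \<partial>M)"
      "(\<integral>z. a x z * b y z \<partial>M) = (\<integral>z. \<alpha> x z * \<beta> y z + b0 y * \<alpha> x z + a0 x * \<beta> y z + a0 x * b0 y \<partial>M)"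
      by (simp_all add: \<alpha>_def \<beta>_def algebra_simps)
    then have "(\<integral>z. a x z * b y z \<partial>M) - (\<integral>z. a x z \<partial>M) * (\<integral>z. b y z \<partial>M) =
        (\<integral>z. \<alpha> x z * \<beta> y z \<partial>M) - (\<integral>z. \<alpha> x z \<partial>M) * (\<integral>z. \<beta> y z \<partial>M)"
      using ints by (simp add: prob_space algebra_simps)
    also have "\<bar>\<dots>\<bar> \<le> \<bar>\<integral>z. \<alpha> x z * \<beta> y z \<partial>M\<bar> + \<bar>(\<integral>z. \<alpha> x z \<partial>M) * (\<integral>z. \<beta> y z \<partial>M)\<bar>"
      by (rule abs_triangle_ineq4)
    also have "\<dots> \<le> (\<integral>z. \<bar>\<alpha> x z\<bar> * \<bar>\<beta> y z\<bar> \<partial>M) + (\<integral>z. \<bar>\<alpha> x z\<bar> \<partial>M) * (\<integral>z. \<bar>\<beta> y z\<bar> \<partial>M)"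
      unfolding abs_mult
      using integral_abs_bound[of M "\<lambda>z. \<alpha> x z * \<beta> y z"] integral_abs_bound[of M "\<alpha> x"] integral_abs_bound[of M "\<beta> y"]
      by (intro add_mono mult_mono) (auto simp: abs_mult)
    finally show ?thesis .
  qed
  have "(\<Sum>(x, y)\<in>A \<times> B. \<bar>(\<integral>z. a x z * b y z \<partial>M) - (\<integral>z. a x z \<partial>M) * (\<integral>z. b y z \<partial>M)\<bar>) \<le>
      (\<Sum>x\<in>A. \<Sum>y\<in>B. (\<integral>z. \<bar>\<alpha> x z\<bar> * \<bar>\<beta> y z\<bar> \<partial>M) + (\<integral>z. \<bar>\<alpha> x z\<bar> \<partial>M) * (\<integral>z. \<bar>\<beta> y z\<bar> \<partial>M))"
    unfolding sum.cartesian_product[symmetric] by (intro sum_mono cov)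
  \<comment> \<open>The sums move inside the integrals, so that the l1 bounds \<open>h\<close> apply
    to whole sums. Termwise bounds would bring in the sizes of \<open>A\<close> and
    \<open>B\<close>.\<close>
  also have "\<dots> = (\<integral>z. (\<Sum>x\<in>A. \<bar>\<alpha> x z\<bar>) * (\<Sum>y\<in>B. \<bar>\<beta> y z\<bar>) \<partial>M) +
      (\<integral>z. (\<Sum>x\<in>A. \<bar>\<alpha> x z\<bar>) \<partial>M) * (\<integral>z. (\<Sum>y\<in>B. \<bar>\<beta> y z\<bar>) \<partial>M)"
    unfolding sum_product sum.distrib
    by (simp add: Bochner_Integration.integral_sum I\<alpha> I\<beta> I\<alpha>\<beta> Bochner_Integration.integrable_sum sum_product)
  also have "\<dots> \<le> h * h + h * h"
  proof (intro add_mono mult_mono)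
    have ae: "AE z in M. (\<Sum>x\<in>A. \<bar>\<alpha> x z\<bar>) * (\<Sum>y\<in>B. \<bar>\<beta> y z\<bar>) \<le> h * h"
      using a b by eventually_elim (use h in \<open>auto simp: \<alpha>_def \<beta>_def intro!: mult_mono sum_nonneg\<close>)
    show "(\<integral>z. (\<Sum>x\<in>A. \<bar>\<alpha> x z\<bar>) * (\<Sum>y\<in>B. \<bar>\<beta> y z\<bar>) \<partial>M) \<le> h * h"
      by (intro integral_le_const ae) (auto simp: sum_product intro!: Bochner_Integration.integrable_sum I\<alpha>\<beta>)
    show "(\<integral>z. (\<Sum>x\<in>A. \<bar>\<alpha> x z\<bar>) \<partial>M) \<le> h"
    proof (rule integral_le_const)
      show "integrable M (\<lambda>z. \<Sum>x\<in>A. \<bar>\<alpha> x z\<bar>)" by (intro Bochner_Integration.integrable_sum I\<alpha>)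
      show "AE z in M. (\<Sum>x\<in>A. \<bar>\<alpha> x z\<bar>) \<le> h" using a by (simp add: \<alpha>_def)
    qed
    show "(\<integral>z. (\<Sum>y\<in>B. \<bar>\<beta> y z\<bar>) \<partial>M) \<le> h"
    proof (rule integral_le_const)
      show "integrable M (\<lambda>z. \<Sum>y\<in>B. \<bar>\<beta> y z\<bar>)" by (intro Bochner_Integration.integrable_sum I\<beta>)
      show "AE z in M. (\<Sum>y\<in>B. \<bar>\<beta> y z\<bar>) \<le> h" using b by (simp add: \<beta>_def)
    qed
  qed (auto intro!: h Bochner_Integration.integral_nonneg sum_nonneg)
  finally show ?thesis by (simp add: power2_eq_square)
qed

lemma dependence_le_sum_abs: "finite W \<Longrightarrow> dependence W P \<le> (\<Sum>w\<in>W. \<bar>gap P w\<bar>)\<^sup>2"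
proof -
  assume W: "finite W"
  have "dependence W P \<le> (\<Sum>w\<in>W. \<bar>gap P w\<bar> * (\<Sum>w\<in>W. \<bar>gap P w\<bar>))"
    unfolding dependence_def
  proof (rule sum_mono)
    fix w assume "w \<in> W"
    then have "\<bar>gap P w\<bar> * \<bar>gap P w\<bar> \<le> \<bar>gap P w\<bar> * (\<Sum>w\<in>W. \<bar>gap P w\<bar>)"
      using W by (intro mult_left_mono member_le_sum) auto
    then show "(gap P w)\<^sup>2 \<le> \<bar>gap P w\<bar> * (\<Sum>w\<in>W. \<bar>gap P w\<bar>)" by (simp add: power2_eq_square)
  qed
  then show ?thesis by (simp add: sum_distrib_right[symmetric] power2_eq_square)
qed

section \<open>The discretised observation and the law within a bin\<close>

lemma measurable_cell_of: "cell_of d \<in> triple_space \<rightarrow>\<^sub>M count_space UNIV"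
proof -
  have "(\<lambda>z. (u, bin_index d z)) \<in> borel \<rightarrow>\<^sub>M count_space UNIV" for u :: "nat \<times> nat"
    by (rule measurable_compose[OF measurable_bin_index]) simp
  from measurable_triple[of "\<lambda>u z. (u, bin_index d z)", OF this] show ?thesis
    by (simp add: cell_of_def[abs_def])
qed

text \<open>The setting shared by both error bounds: \<open>r\<close> is the law of an observation
  with Z replaced by its bin label, and \<open>k\<close> will be the smooth version of the
  kernel.\<close>

locale cells =
  fixes p :: "(nat \<times> nat \<times> real) measure" and d :: nat and r :: "((nat \<times> nat) \<times> nat) pmf"
    and k :: "real \<Rightarrow> (nat \<times> nat) pmf"
  assumes p: "prob_space p" "sets p = sets triple_space" and d: "1 \<le> d"
    and r: "measure_pmf r = distr p (count_space UNIV) (cell_of d)"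
    and k: "cond_XY p k" and p01: "AE z in distr_Z p. z \<in> {0..1}"
begin

abbreviation "pZ \<equiv> distr_Z p"

abbreviation "mu m \<equiv> uniform_measure (distr_Z p) (bin_index d -` {m})"

lemma cell_of_measurable_p: "cell_of d \<in> p \<rightarrow>\<^sub>M count_space UNIV"
  using measurable_cell_of measurable_cong_sets[OF p(2) refl] by blast

lemma Z_measurable_p: "(\<lambda>(x, y, z). z) \<in> p \<rightarrow>\<^sub>M borel"
  using measurable_triple_snd_snd measurable_cong_sets[OF p(2) refl] by blast

lemma sets_pZ [simp]: "sets pZ = sets borel" and space_pZ [simp]: "space pZ = UNIV"
  by (simp_all add: distr_Z_def)

lemma prob_space_pZ: "prob_space pZ"
  unfolding distr_Z_def by (rule prob_space.prob_space_distr[OF p(1) Z_measurable_p])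

lemma space_p: "space p = UNIV"
  using sets_eq_imp_space_eq[OF p(2)] by simp

lemma bin_index_sets [measurable]: "bin_index d -` {m} \<in> sets borel"
  using measurable_sets[OF measurable_bin_index, of "{m}"] by simp

lemma measurable_bin_index_pZ: "bin_index d \<in> pZ \<rightarrow>\<^sub>M count_space UNIV"
  using measurable_bin_index measurable_cong_sets[OF sets_pZ refl] by blast

lemma labels_distr: "measure_pmf (map_pmf snd r) = distr pZ (count_space UNIV) (bin_index d)"
proof -
  have "measure_pmf (map_pmf snd r) = distr (measure_pmf r) (count_space UNIV) snd"
    by (simp add: map_pmf_rep_eq)
  also have "\<dots> = distr p (count_space UNIV) (snd \<circ> cell_of d)"
    unfolding r by (rule distr_distr[OF _ cell_of_measurable_p]) simp
  also have "snd \<circ> cell_of d = bin_index d \<circ> (\<lambda>(x, y, z). z)"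
    by (auto simp: cell_of_def)
  also have "distr p (count_space UNIV) (bin_index d \<circ> (\<lambda>(x, y, z). z)) = distr pZ (count_space UNIV) (bin_index d)"
    unfolding distr_Z_def by (rule distr_distr[symmetric, OF measurable_bin_index Z_measurable_p])
  finally show ?thesis .
qed

lemma emeasure_pZ_bin_index: "emeasure pZ (bin_index d -` {m}) = ennreal (pmf (map_pmf snd r) m)"
  by (simp add: emeasure_pmf_single[symmetric] labels_distr emeasure_distr[OF measurable_bin_index_pZ])

lemma emeasure_r: "emeasure r (A \<times> {m}) = (\<integral>\<^sup>+z. emeasure (measure_pmf (k z)) A * indicator (bin_index d -` {m}) z \<partial>pZ)"
proof -
  have "cell_of d -` (A \<times> {m}) \<inter> space p = rect A (bin_index d -` {m})"
    by (auto simp: cell_of_def rect_def space_p)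
  then show ?thesis
    using k bin_index_sets[of m] by (simp add: r emeasure_distr[OF cell_of_measurable_p] cond_XY_iff)
qed

lemma AE_pZ_bin_index: "AE z in pZ. bin_index d z \<in> {1..d} \<and> bin_index d z \<in> snd ` set_pmf r"
proof -
  have "AE m in measure_pmf (map_pmf snd r). m \<in> snd ` set_pmf r"
    by (simp add: AE_measure_pmf_iff)
  then have "AE z in pZ. bin_index d z \<in> snd ` set_pmf r"
    unfolding labels_distr by (rule AE_distrD[OF measurable_bin_index_pZ])
  with p01 show ?thesis
    by eventually_elim (use bin_index_le bin_index_pos[OF d] in auto)
qed

lemma set_labels: "snd ` set_pmf r \<subseteq> {1..d}"
proof -
  have "AE m in measure_pmf (map_pmf snd r). m \<in> {1..d}"
    unfolding labels_distr using AE_pZ_bin_index by (subst AE_distr_iff[OF measurable_bin_index_pZ]) auto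
  then have "\<forall>m\<in>set_pmf (map_pmf snd r). m \<in> {1..d}" by (simp only: AE_measure_pmf_iff)
  then show ?thesis unfolding set_map_pmf by blast
qed

context
  fixes m :: nat
  assumes m: "m \<in> snd ` set_pmf r"
begin

lemma pmf_label_pos: "pmf (map_pmf snd r) m > 0"
  using m by (simp add: pmf_positive)

lemma prob_space_mu: "prob_space (mu m)"
  using pmf_label_pos emeasure_pZ_bin_index[of m] by (intro prob_space_uniform_measure) (auto simp: ennreal_eq_0_iff)

lemma AE_mu: "AE z in mu m. bin_index d z = m"
  using bin_index_sets[of m] by (intro AE_uniform_measureI) auto

lemma AE_mu_I: "AE z in pZ. R z \<Longrightarrow> AE z in mu m. R z"
  using bin_index_sets[of m] by (intro AE_uniform_measureI) auto

text \<open>Numerator and denominator of the conditional probability are integrals over the bin, and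
  their quotient is an average over the law \<open>mu m\<close> of Z given the bin. The estimates
  for \<open>cell_pmf\<close> rest on this mixture formula.\<close>

lemma prob_cell_pmf: "measure_pmf.prob (cell_pmf r m) A = (\<integral>z. measure_pmf.prob (k z) A \<partial>mu m)"
proof -
  have ne: "set_pmf r \<inter> {w. snd w = m} \<noteq> {}" using m by auto
  have S: "{w. snd w = m} \<inter> fst -` A = A \<times> {m}" "{w. snd w = m} = snd -` {m}" by auto
  have km: "(\<lambda>z. emeasure (measure_pmf (k z)) A) \<in> borel_measurable pZ"
    "(\<lambda>z. measure_pmf.prob (k z) A) \<in> borel_measurable (mu m)"
    using k measurable_kernel_emeasure measurable_kernel_prob unfolding cond_XY_iff
    by (auto cong: measurable_cong_sets)
  have "emeasure (cell_pmf r m) A = emeasure r ({w. snd w = m} \<inter> fst -` A) / emeasure r {w. snd w = m}"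
    unfolding cell_pmf_def by (simp add: cond_pmf.rep_eq[OF ne])
  also have "emeasure r {w. snd w = m} = emeasure pZ (bin_index d -` {m})"
    unfolding S(2) emeasure_pZ_bin_index by (simp add: pmf.rep_eq measure_pmf.emeasure_eq_measure)
  also have "emeasure r ({w. snd w = m} \<inter> fst -` A) / emeasure pZ (bin_index d -` {m}) =
      (\<integral>\<^sup>+z. emeasure (measure_pmf (k z)) A \<partial>mu m)"
    unfolding S(1) emeasure_r using km(1) bin_index_sets[of m] by (subst nn_integral_uniform_measure) auto
  finally have "emeasure (cell_pmf r m) A = (\<integral>\<^sup>+z. ennreal (measure_pmf.prob (k z) A) \<partial>mu m)"
    by (simp add: measure_pmf.emeasure_eq_measure)
  then show ?thesis
    using km(2) by (simp add: integral_eq_nn_integral measure_def)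
qed

lemma pmf_cell_pmf: "pmf (cell_pmf r m) u = (\<integral>z. pmf (k z) u \<partial>mu m)"
  using prob_cell_pmf[of "{u}"] by (simp add: pmf.rep_eq)

lemma pmf_map_cell_pmf: "pmf (map_pmf f (cell_pmf r m)) x = (\<integral>z. pmf (map_pmf f (k z)) x \<partial>mu m)"
  using prob_cell_pmf[of "f -` {x}"] by (simp add: pmf.rep_eq)

lemma mu_measurable_pmf: "(\<lambda>z. pmf (map_pmf f (k z)) x) \<in> borel_measurable (mu m)"
  using k measurable_kernel_prob[of k "f -` {x}"] unfolding cond_XY_iff
  by (simp add: pmf.rep_eq cong: measurable_cong_sets)

text \<open>Provides the reference point of the bin from which deviations of the kernel are
  measured.\<close>

lemma ex_z: obtains z0 where "bin_index d z0 = m"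
proof -
  interpret prob_space "mu m" by (rule prob_space_mu)
  have "\<exists>z. bin_index d z = m"
  proof (rule ccontr)
    assume "\<not> ?thesis"
    with AE_mu have "AE z in mu m. False" by auto
    then show False by simp
  qed
  then show ?thesis using that by blast
qed

text \<open>Joint probabilities factor under the mixture integral, so the entries of
  \<open>gap\<close> are covariances of the two conditional marginals under \<open>mu m\<close>.
  Their l1 norm is at most 2 h^2, and its square is 4 h^4.\<close>

lemma dependence_cell_le_null:
  assumes ind: "AE z in pZ. k z = pair_pmf (map_pmf fst (k z)) (map_pmf snd (k z))"
    and h: "0 \<le> h"
    and smooth: "\<And>z z' W l. z \<in> {0..1} \<Longrightarrow> z' \<in> {0..1} \<Longrightarrow> \<bar>z - z'\<bar> \<le> 1 / real d \<Longrightarrow> W \<in> {fst, snd} \<Longrightarrow>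
      (\<Sum>x\<in>{1..l}. \<bar>pmf (map_pmf W (k z)) x - pmf (map_pmf W (k z')) x\<bar>) \<le> h"
  shows "dependence (grid l1 l2) (cell_pmf r m) \<le> 4 * h ^ 4"
proof -
  interpret M: prob_space "mu m" by (rule prob_space_mu)
  obtain z0 where z0: "bin_index d z0 = m" by (rule ex_z)
  have md: "m \<in> {1..d}" using m set_labels by auto
  have near: "AE z in mu m. (\<Sum>x\<in>{1..l}. \<bar>pmf (map_pmf W (k z)) x - pmf (map_pmf W (k z0)) x\<bar>) \<le> h"
    if "W \<in> {fst, snd}" for W :: "nat \<times> nat \<Rightarrow> nat" and l
    using AE_mu
  proof eventually_elim
    case (elim z)
    then show ?case using bin_index_dist[OF md elim z0] that by (intro smooth) auto
  qed
  have gap: "gap (cell_pmf r m) (x, y) =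
     (\<integral>z. pmf (map_pmf fst (k z)) x * pmf (map_pmf snd (k z)) y \<partial>mu m) -
     (\<integral>z. pmf (map_pmf fst (k z)) x \<partial>mu m) * (\<integral>z. pmf (map_pmf snd (k z)) y \<partial>mu m)" for x y
  proof -
    have "pmf (cell_pmf r m) (x, y) = (\<integral>z. pmf (map_pmf fst (k z)) x * pmf (map_pmf snd (k z)) y \<partial>mu m)"
      unfolding pmf_cell_pmf
    proof (rule integral_cong_AE)
      show "AE z in mu m. pmf (k z) (x, y) = pmf (map_pmf fst (k z)) x * pmf (map_pmf snd (k z)) y"
        using AE_mu_I[OF ind] by eventually_elim (metis pmf_pair)
      show "(\<lambda>z. pmf (k z) (x, y)) \<in> borel_measurable (mu m)"
        using mu_measurable_pmf[of "\<lambda>u. u" "(x, y)"] by (simp add: pmf.map_ident)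
      show "(\<lambda>z. pmf (map_pmf fst (k z)) x * pmf (map_pmf snd (k z)) y) \<in> borel_measurable (mu m)"
        by (intro borel_measurable_times mu_measurable_pmf)
    qed
    then show ?thesis by (simp add: gap_def pmf_map_cell_pmf)
  qed
  have "(\<Sum>w\<in>grid l1 l2. \<bar>gap (cell_pmf r m) w\<bar>) \<le> 2 * h\<^sup>2"
  proof -
    have "(\<Sum>w\<in>grid l1 l2. \<bar>gap (cell_pmf r m) w\<bar>) = (\<Sum>(x, y)\<in>{1..l1} \<times> {1..l2}.
       \<bar>(\<integral>z. pmf (map_pmf fst (k z)) x * pmf (map_pmf snd (k z)) y \<partial>mu m) -
        (\<integral>z. pmf (map_pmf fst (k z)) x \<partial>mu m) * (\<integral>z. pmf (map_pmf snd (k z)) y \<partial>mu m)\<bar>)"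
      unfolding grid_def by (intro sum.cong refl) (auto simp: gap)
    also have "\<dots> \<le> 2 * h\<^sup>2"
      by (rule M.sum_abs_covariance_le[OF _ _ mu_measurable_pmf mu_measurable_pmf near near h]) auto
    finally show ?thesis .
  qed
  then have "(\<Sum>w\<in>grid l1 l2. \<bar>gap (cell_pmf r m) w\<bar>)\<^sup>2 \<le> (2 * h\<^sup>2)\<^sup>2"
    by (intro power_mono sum_nonneg) auto
  with dependence_le_sum_abs[of "grid l1 l2" "cell_pmf r m"] show ?thesis
    by (simp add: power_mult_distrib flip: power_mult)
qed

end

end

text \<open>With respect to counting measure the distance is the sum over all points. Finite partial
  sums are the right quantity below, since at an exceptional z the kernel may charge points outside
  the grid.\<close>

lemma sum_abs_diff_le_l1_dist:
  fixes P Q :: "'c pmf"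
  assumes "finite W"
  shows "(\<Sum>u\<in>W. \<bar>pmf P u - pmf Q u\<bar>) \<le> l1_dist P Q"
proof -
  have "l1_dist P Q = (\<integral>u. \<bar>pmf P u - pmf Q u\<bar> \<partial>count_space UNIV)"
    by (rule l1_dist_density) (auto simp: measure_pmf_eq_density[symmetric] intro: measure_pmf.finite_measure)
  moreover have "(\<integral>u. \<bar>pmf P u - pmf Q u\<bar> * indicator W u \<partial>count_space UNIV) \<le>
      (\<integral>u. \<bar>pmf P u - pmf Q u\<bar> \<partial>count_space UNIV)"
    by (rule integral_mono_AE')
       (auto intro!: integrable_abs Bochner_Integration.integrable_diff integrable_pmf simp: indicator_def)
  moreover have "(\<integral>u. \<bar>pmf P u - pmf Q u\<bar> * indicator W u \<partial>count_space UNIV) = (\<Sum>u\<in>W. \<bar>pmf P u - pmf Q u\<bar>)"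
  proof -
    have "(\<integral>u. \<bar>pmf P u - pmf Q u\<bar> * indicator W u \<partial>count_space UNIV) =
       (\<Sum>u | u \<in> UNIV \<and> \<bar>pmf P u - pmf Q u\<bar> * indicator W u \<noteq> 0. \<bar>pmf P u - pmf Q u\<bar> * indicator W u)"
      using assms by (intro lebesgue_integral_count_space_finite_support) (auto intro: finite_subset[of _ W] split: split_indicator)
    also have "\<dots> = (\<Sum>u\<in>W. \<bar>pmf P u - pmf Q u\<bar> * indicator W u)"
      using assms by (intro sum.mono_neutral_left) (auto split: split_indicator)
    finally show ?thesis by simp
  qed
  ultimately show ?thesis by simp
qed

lemma sum_abs_diff_pmf_le_2:
  assumes "finite W" shows "(\<Sum>u\<in>W. \<bar>pmf P u - pmf Q u\<bar>) \<le> 2"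
proof -
  have "(\<Sum>u\<in>W. \<bar>pmf P u - pmf Q u\<bar>) \<le> (\<Sum>u\<in>W. pmf P u + pmf Q u)"
    by (intro sum_mono) (auto simp: abs_le_iff)
  also have "\<dots> \<le> 1 + 1"
    unfolding sum.distrib by (intro add_mono sum_pmf_le_1 assms)
  finally show ?thesis by simp
qed

text \<open>With f = dP/dQ, the variance of |f - 1| under Q is nonnegative, so the squared mean of
  |f - 1| is at most its second moment.\<close>

lemma l1_dist_le_sqrt_chi2_dist:
  assumes P: "prob_space P" and Q: "prob_space Q" and sets: "sets P = sets Q"
    and c: "0 \<le> c" and chi: "chi2_dist P Q \<le> ennreal c"
  shows "l1_dist P Q \<le> sqrt c"
proof -
  interpret P: prob_space P by fact
  interpret Q: prob_space Q by fact
  \<comment> \<open>Otherwise the chi-square distance would be infinite by definition.\<close>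
  have ac: "absolutely_continuous Q P"
    using chi by (auto simp: chi2_dist_def top_unique split: if_splits)
  define f where "f w = enn2real (RN_deriv Q P w)" for w
  have [measurable]: "f \<in> borel_measurable Q" by (simp add: f_def[abs_def])
  have "AE w in Q. RN_deriv Q P w = ennreal (f w)"
    using Q.RN_deriv_finite[OF P.sigma_finite_measure_axioms ac sets]
    by eventually_elim (simp add: f_def less_top)
  then have "density Q (\<lambda>w. ennreal (f w)) = density Q (RN_deriv Q P)"
    by (intro density_cong) auto
  also have "\<dots> = P" by (rule Q.density_RN_deriv[OF ac sets])
  finally have Pf: "P = density Q (\<lambda>w. ennreal (f w))" ..
  have l1: "l1_dist P Q = (\<integral>w. \<bar>f w - 1\<bar> \<partial>Q)"
    using Pf by (intro l1_dist_density[where g = "\<lambda>_. 1"])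
      (auto simp: f_def density_1 P.finite_measure_axioms Q.finite_measure_axioms)
  have nn: "(\<integral>\<^sup>+w. ennreal ((f w - 1)\<^sup>2) \<partial>Q) \<le> ennreal c"
    using chi ac by (simp add: chi2_dist_def f_def)
  have int2: "integrable Q (\<lambda>w. (f w - 1)\<^sup>2)"
    using nn by (intro integrableI_bounded) (auto simp: less_top[symmetric] top_unique intro: le_less_trans)
  have int1: "integrable Q (\<lambda>w. \<bar>f w - 1\<bar>)"
  proof (rule Bochner_Integration.integrable_bound[of Q "\<lambda>w. 1 + (f w - 1)\<^sup>2"])
    \<comment> \<open>From (x - 1/2)^2 \<ge> 0; it deduces integrability of |f - 1| from that of its
      square.\<close>
    have "x \<le> 1 + x\<^sup>2" for x :: real using sum_squares_bound[of x "1 / 2"] zero_le_power2[of "x - 1 / 2"]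
      by (simp add: power2_eq_square algebra_simps)
    from this[of "\<bar>f w - 1\<bar>" for w]
    show "AE w in Q. norm \<bar>f w - 1\<bar> \<le> norm (1 + (f w - 1)\<^sup>2)"
      by (auto intro!: AE_I2)
  qed (auto intro!: int2)
  define m where "m = (\<integral>w. \<bar>f w - 1\<bar> \<partial>Q)"
  have "0 \<le> (\<integral>w. (\<bar>f w - 1\<bar> - m)\<^sup>2 \<partial>Q)" by simp
  also have "\<dots> = (\<integral>w. (f w - 1)\<^sup>2 - 2 * m * \<bar>f w - 1\<bar> + m\<^sup>2 \<partial>Q)"
    by (simp add: power2_diff algebra_simps)
  also have "\<dots> = (\<integral>w. (f w - 1)\<^sup>2 \<partial>Q) - m\<^sup>2"
    using int1 int2 by (simp add: m_def[symmetric] Q.prob_space power2_eq_square)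
  also have "(\<integral>w. (f w - 1)\<^sup>2 \<partial>Q) \<le> c"
    using nn c by (simp add: integral_eq_nn_integral enn2real_leI)
  finally have "m\<^sup>2 \<le> c" by simp
  then have "\<bar>m\<bar> \<le> sqrt c" using real_sqrt_le_mono[of "m\<^sup>2" c] by simp
  then show ?thesis by (simp add: l1 m_def[symmetric])
qed

section \<open>The piecewise independent competitor in the null class\<close>

context cells begin

lemma set_cell_pmf:
  assumes m: "m \<in> snd ` set_pmf r" and supp: "AE z in pZ. set_pmf (k z) \<subseteq> G"
  shows "set_pmf (cell_pmf r m) \<subseteq> G"
proof -
  have "measure_pmf.prob (cell_pmf r m) (- G) = (\<integral>z. measure_pmf.prob (k z) (- G) \<partial>mu m)"
    by (rule prob_cell_pmf[OF m])
  also have "\<dots> = 0"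
  proof (rule integral_eq_zero_AE)
    show "AE z in mu m. measure_pmf.prob (k z) (- G) = 0"
      using AE_mu_I[OF m supp] by eventually_elim (auto simp: measure_pmf_zero_iff)
  qed
  finally show ?thesis by (auto simp: measure_pmf_zero_iff)
qed

text \<open>\<open>cell_pmf r m\<close> averages \<open>k z'\<close> over points z' of the same bin,
  so by the triangle inequality it is as close to \<open>k z\<close> as these are.\<close>

lemma sum_abs_cell_diff_le:
  assumes m: "m \<in> snd ` set_pmf r" and z: "bin_index d z = m"
    and W: "finite W" and smooth: "\<And>z z'. z \<in> {0..1} \<Longrightarrow> z' \<in> {0..1} \<Longrightarrow> \<bar>z - z'\<bar> \<le> 1 / real d \<Longrightarrow>
      (\<Sum>u\<in>W. \<bar>pmf (k z) u - pmf (k z') u\<bar>) \<le> h"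
  shows "(\<Sum>u\<in>W. \<bar>pmf (k z) u - pmf (cell_pmf r m) u\<bar>) \<le> h"
proof -
  interpret M: prob_space "mu m" by (rule prob_space_mu[OF m])
  have md: "m \<in> {1..d}" using m set_labels by auto
  have [measurable]: "(\<lambda>z. pmf (k z) u) \<in> borel_measurable (mu m)" for u
    using mu_measurable_pmf[OF m, of "\<lambda>u. u" u] by (simp add: pmf.map_ident)
  have int: "integrable (mu m) (\<lambda>z. pmf (k z) u)" for u
    by (rule M.integrable_bounded[of _ 1]) (auto simp: pmf_le_1)
  have int': "integrable (mu m) (\<lambda>z'. \<bar>pmf (k z) u - pmf (k z') u\<bar>)" for u
    using int by auto
  have "(\<Sum>u\<in>W. \<bar>pmf (k z) u - pmf (cell_pmf r m) u\<bar>) \<le>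
      (\<Sum>u\<in>W. \<integral>z'. \<bar>pmf (k z) u - pmf (k z') u\<bar> \<partial>mu m)"
  proof (rule sum_mono)
    fix u
    have "pmf (k z) u - pmf (cell_pmf r m) u = (\<integral>z'. pmf (k z) u - pmf (k z') u \<partial>mu m)"
      using int M.prob_space by (simp add: pmf_cell_pmf[OF m])
    then show "\<bar>pmf (k z) u - pmf (cell_pmf r m) u\<bar> \<le> (\<integral>z'. \<bar>pmf (k z) u - pmf (k z') u\<bar> \<partial>mu m)"
      using integral_abs_bound by metis
  qed
  also have "\<dots> = (\<integral>z'. (\<Sum>u\<in>W. \<bar>pmf (k z) u - pmf (k z') u\<bar>) \<partial>mu m)"
    by (rule Bochner_Integration.integral_sum[symmetric]) (rule int')
  also have "\<dots> \<le> h"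
  proof (rule M.integral_le_const)
    show "AE z' in mu m. (\<Sum>u\<in>W. \<bar>pmf (k z) u - pmf (k z') u\<bar>) \<le> h"
      using AE_mu[OF m]
    proof eventually_elim
      case (elim z')
      then show ?case using bin_index_dist[OF md z elim] by (intro smooth) auto
    qed
  qed (intro Bochner_Integration.integrable_sum int')
  finally show ?thesis .
qed

definition ind_pmf :: "nat \<Rightarrow> (nat \<times> nat) pmf" where
  "ind_pmf m = pair_pmf (map_pmf fst (cell_pmf r m)) (map_pmf snd (cell_pmf r m))"

text \<open>The infimum in the separation condition ranges over all of \<open>P0\<close>, so this
  competitor may jump between bins. Keeping the law of Z reduces its distance from \<open>p\<close>
  to a distance of kernels.\<close>

definition ind_measure :: "(nat \<times> nat \<times> real) measure" where
  "ind_measure = joint pZ (\<lambda>z. ind_pmf (bin_index d z))"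

lemma measurable_kernel_ind: "measurable_kernel (\<lambda>z. ind_pmf (bin_index d z))"
  by (rule measurable_kernel_simple[OF measurable_bin_index])

lemma set_ind_pmf:
  assumes "m \<in> snd ` set_pmf r" "AE z in pZ. set_pmf (k z) \<subseteq> grid l1 l2"
  shows "set_pmf (ind_pmf m) \<subseteq> grid l1 l2"
  using set_cell_pmf[OF assms] by (auto simp: ind_pmf_def grid_def)

lemma ind_measure_in_P0:
  assumes ac: "absolutely_continuous lborel pZ" and supp: "AE z in pZ. set_pmf (k z) \<subseteq> grid l1 l2"
  shows "ind_measure \<in> P0 l1 l2"
proof -
  note J = joint_props[OF sets_pZ prob_space_pZ measurable_kernel_ind, folded ind_measure_def]
  have "AE z in pZ. set_pmf (ind_pmf (bin_index d z)) \<subseteq> {1..l1} \<times> {1..l2}"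
    using AE_pZ_bin_index by eventually_elim (use set_ind_pmf[OF _ supp] in \<open>auto simp: grid_def\<close>)
  then have "ind_measure \<in> E0 l1 l2"
    using J(1,3) ac p01 unfolding E0_def mem_Collect_eq J(2)
    by (intro conjI exI[of _ "\<lambda>z. ind_pmf (bin_index d z)"]) (simp_all add: ind_measure_def)
  moreover have "ind_pmf m = pair_pmf (map_pmf fst (ind_pmf m)) (map_pmf snd (ind_pmf m))" for m
    by (simp add: ind_pmf_def map_fst_pair_pmf map_snd_pair_pmf)
  ultimately show ?thesis
    using J(3) unfolding P0_def by (auto intro!: exI[of _ "\<lambda>z. ind_pmf (bin_index d z)"])
qed

text \<open>On bin m the kernel is within \<open>h\<close> of \<open>cell_pmf r m\<close>, which
  differs from \<open>ind_pmf m\<close> exactly by \<open>gap\<close>. Integration over z weights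
  the bins by their probabilities.\<close>

lemma l1_dist_ind_measure_le:
  assumes supp: "AE z in pZ. set_pmf (k z) \<subseteq> grid l1 l2" and h: "0 \<le> h"
    and smooth: "\<And>z z'. z \<in> {0..1} \<Longrightarrow> z' \<in> {0..1} \<Longrightarrow> \<bar>z - z'\<bar> \<le> 1 / real d \<Longrightarrow>
      (\<Sum>u\<in>grid l1 l2. \<bar>pmf (k z) u - pmf (k z') u\<bar>) \<le> h"
  shows "l1_dist p ind_measure \<le>
    h + (\<Sum>m\<in>{1..d}. pmf (map_pmf snd r) m * (\<Sum>w\<in>grid l1 l2. \<bar>gap (cell_pmf r m) w\<bar>))"
proof -
  define a where "a m = (\<Sum>w\<in>grid l1 l2. \<bar>gap (cell_pmf r m) w\<bar>)" for m
  define R where "R = h + (\<Sum>m\<in>{1..d}. pmf (map_pmf snd r) m * a m)"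
  define f where "f = (\<lambda>(x, y, z). pmf (k z) (x, y))"
  define g where "g = (\<lambda>(x, y, z). pmf (ind_pmf (bin_index d z)) (x, y))"
  let ?\<nu> = "base_measure pZ"
  have a: "0 \<le> a m" "a m \<le> 2" for m unfolding a_def by (auto intro: sum_nonneg sum_abs_gap_le)
  have k': "measurable_kernel k" using k by (simp add: cond_XY_iff)
  note mk = measurable_kernel_pmf[OF k'] and mi = measurable_kernel_pmf[OF measurable_kernel_ind]
  have meas: "f \<in> borel_measurable ?\<nu>" "g \<in> borel_measurable ?\<nu>"
    unfolding f_def g_def
    using measurable_triple[of "\<lambda>u z. pmf (k z) u" borel, OF mk] measurable_triple[of "\<lambda>u z. pmf (ind_pmf (bin_index d z)) u" borel, OF mi]
      measurable_cong_sets[OF sets_base_measure[of pZ] refl] by auto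
  have pf: "p = density ?\<nu> (\<lambda>t. ennreal (f t))"
    using cond_XY_eq_joint[OF p(2) k] by (simp add: joint_def f_def case_prod_unfold)
  have qg: "ind_measure = density ?\<nu> (\<lambda>t. ennreal (g t))"
    by (simp add: ind_measure_def joint_def g_def case_prod_unfold)
  have "l1_dist p ind_measure = (\<integral>t. \<bar>f t - g t\<bar> \<partial>?\<nu>)"
    by (rule l1_dist_density[OF meas _ _ pf qg])
       (use joint_props(1)[OF sets_pZ prob_space_pZ measurable_kernel_ind] p(1) in
         \<open>auto simp: f_def g_def ind_measure_def prob_space.finite_measure split: prod.splits\<close>)
  also have "\<dots> = enn2real (\<integral>\<^sup>+t. ennreal \<bar>f t - g t\<bar> \<partial>?\<nu>)"
    using meas by (intro integral_eq_nn_integral) auto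
  finally have l1: "l1_dist p ind_measure = enn2real (\<integral>\<^sup>+t. ennreal \<bar>f t - g t\<bar> \<partial>?\<nu>)" .
  have "(\<integral>\<^sup>+t. ennreal \<bar>f t - g t\<bar> \<partial>?\<nu>) =
      (\<integral>\<^sup>+t. (case t of (x, y, z) \<Rightarrow> ennreal \<bar>pmf (k z) (x, y) - pmf (ind_pmf (bin_index d z)) (x, y)\<bar>) \<partial>?\<nu>)"
    by (simp add: f_def g_def case_prod_unfold)
  also have "\<dots> = (\<integral>\<^sup>+z. \<integral>\<^sup>+u. ennreal \<bar>pmf (k z) u - pmf (ind_pmf (bin_index d z)) u\<bar> \<partial>count_space UNIV \<partial>pZ)"
    using mk mi by (intro nn_integral_base_measure[OF sets_pZ, of "\<lambda>u z. ennreal \<bar>pmf (k z) u - pmf (ind_pmf (bin_index d z)) u\<bar>"]) simp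
  also have "\<dots> \<le> (\<integral>\<^sup>+z. ennreal (h + a (bin_index d z)) \<partial>pZ)"
  proof (rule nn_integral_mono_AE)
    show "AE z in pZ. (\<integral>\<^sup>+u. ennreal \<bar>pmf (k z) u - pmf (ind_pmf (bin_index d z)) u\<bar> \<partial>count_space UNIV) \<le> ennreal (h + a (bin_index d z))"
      using AE_pZ_bin_index supp
    proof eventually_elim
      case (elim z)
      then have lz: "bin_index d z \<in> snd ` set_pmf r" by simp
      \<comment> \<open>For almost every z both kernels live on the grid, which turns the integral
        over all pairs into a finite sum.\<close>
      have out: "\<bar>pmf (k z) u - pmf (ind_pmf (bin_index d z)) u\<bar> = 0" if "u \<notin> grid l1 l2" for u
      proof -
        have "u \<notin> set_pmf (k z)" "u \<notin> set_pmf (ind_pmf (bin_index d z))"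
          using that elim(2) set_ind_pmf[OF lz supp] by blast+
        then have "pmf (k z) u = 0" "pmf (ind_pmf (bin_index d z)) u = 0"
          by (simp_all add: pmf_eq_0_set_pmf)
        then show ?thesis by simp
      qed
      have "(\<integral>\<^sup>+u. ennreal \<bar>pmf (k z) u - pmf (ind_pmf (bin_index d z)) u\<bar> \<partial>count_space UNIV) =
          (\<Sum>u\<in>grid l1 l2. ennreal \<bar>pmf (k z) u - pmf (ind_pmf (bin_index d z)) u\<bar>)"
        using out by (intro nn_integral_count_space') auto
      also have "\<dots> = ennreal (\<Sum>u\<in>grid l1 l2. \<bar>pmf (k z) u - pmf (ind_pmf (bin_index d z)) u\<bar>)"
        by simp
      also have "\<dots> \<le> ennreal (h + a (bin_index d z))"
      proof (rule ennreal_leI)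
        have "(\<Sum>u\<in>grid l1 l2. \<bar>pmf (k z) u - pmf (ind_pmf (bin_index d z)) u\<bar>) \<le>
            (\<Sum>u\<in>grid l1 l2. \<bar>pmf (k z) u - pmf (cell_pmf r (bin_index d z)) u\<bar> + \<bar>gap (cell_pmf r (bin_index d z)) u\<bar>)"
        proof (rule sum_mono)
          fix u
          have "pmf (ind_pmf (bin_index d z)) u = pmf (cell_pmf r (bin_index d z)) u - gap (cell_pmf r (bin_index d z)) u"
            using pmf_pair[of _ _ "fst u" "snd u"] by (simp add: ind_pmf_def gap_def)
          then show "\<bar>pmf (k z) u - pmf (ind_pmf (bin_index d z)) u\<bar> \<le>
              \<bar>pmf (k z) u - pmf (cell_pmf r (bin_index d z)) u\<bar> + \<bar>gap (cell_pmf r (bin_index d z)) u\<bar>" by linarith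
        qed
        also have "\<dots> \<le> h + a (bin_index d z)"
          unfolding sum.distrib a_def
          by (intro add_mono order_refl sum_abs_cell_diff_le[OF lz refl finite_grid] smooth)
        finally show "(\<Sum>u\<in>grid l1 l2. \<bar>pmf (k z) u - pmf (ind_pmf (bin_index d z)) u\<bar>) \<le> h + a (bin_index d z)" .
      qed
      finally show ?case .
    qed
  qed
  also have "\<dots> = (\<integral>\<^sup>+m. ennreal (h + a m) \<partial>measure_pmf (map_pmf snd r))"
    unfolding labels_distr by (rule nn_integral_distr[OF measurable_bin_index_pZ, symmetric]) simp
  also have "\<dots> = ennreal (measure_pmf.expectation (map_pmf snd r) (\<lambda>m. h + a m))"
    using a h by (intro nn_integral_eq_integral measure_pmf.integrable_const_bound[of _ "h + 2"]) auto
  also have "measure_pmf.expectation (map_pmf snd r) (\<lambda>m. h + a m) = h + measure_pmf.expectation (map_pmf snd r) a"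
  proof -
    have "bdd a" using a by (intro bddI[of a 2]) auto
    then have "integrable (measure_pmf (map_pmf snd r)) a" by (rule bdd_integrable)
    then show ?thesis by (subst Bochner_Integration.integral_add) simp_all
  qed
  also have "measure_pmf.expectation (map_pmf snd r) a = (\<Sum>m\<in>{1..d}. pmf (map_pmf snd r) m * a m)"
    using set_labels by (subst integral_measure_pmf[of "{1..d}"]) auto
  finally have "(\<integral>\<^sup>+t. ennreal \<bar>f t - g t\<bar> \<partial>?\<nu>) \<le> ennreal R" by (simp add: R_def)
  moreover have "0 \<le> R" unfolding R_def using h a by (auto intro!: add_nonneg_nonneg sum_nonneg)
  ultimately have "l1_dist p ind_measure \<le> R" unfolding l1 by (intro enn2real_leI)
  then show ?thesis by (simp add: R_def a_def)
qed

end

subsection \<open>Type I and type II errors\<close>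

lemma l1_dist_nonneg: "0 \<le> l1_dist P Q"
  by (simp add: l1_dist_def Let_def)

text \<open>The support condition of \<open>E0\<close> concerns some version of the kernel; almost
  sure uniqueness transfers it to the given \<open>k\<close>.\<close>

lemma cells_exists:
  assumes p: "p \<in> E0 l1 l2" and k: "cond_XY p k" and d: "1 \<le> d"
  obtains r where "cells p d r k" "AE z in distr_Z p. set_pmf (k z) \<subseteq> grid l1 l2"
proof -
  obtain k0 where k0: "cond_XY p k0" "AE z in distr_Z p. set_pmf (k0 z) \<subseteq> {1..l1} \<times> {1..l2}"
    and ps: "prob_space p" "sets p = sets triple_space" "AE z in distr_Z p. z \<in> {0..1}"
    using p by (auto simp: E0_def)
  interpret prob_space p by fact
  have "cell_of d \<in> p \<rightarrow>\<^sub>M count_space UNIV"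
    using measurable_cell_of measurable_cong_sets[OF ps(2) refl] by blast
  then have "prob_space (distr p (count_space UNIV) (cell_of d))" by (rule prob_space_distr)
  then obtain r where "measure_pmf r = distr p (count_space UNIV) (cell_of d)"
    using countable_pmf_exists[of "distr p (count_space UNIV) (cell_of d)"] by auto
  then have "cells p d r k" using ps k d by (simp add: cells_def)
  moreover have "AE z in distr_Z p. set_pmf (k z) \<subseteq> grid l1 l2"
    using cond_XY_AE_unique[OF ps(1,2) k k0(1)] k0(2) by eventually_elim (simp add: grid_def)
  ultimately show ?thesis using that by blast
qed

section \<open>Averaging over the Poisson sample size\<close>

context cells begin

lemma expect_label_vector:
  assumes "\<And>N \<omega>. f N \<omega> = F N (\<lambda>i. if i \<in> {1..n} then cell_of d (\<omega> i) else ((0, 0), 0))"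
  shows "expect n p f = (\<integral>\<^sup>+N. \<integral>\<^sup>+W. ennreal (F N W) \<partial>measure_pmf (Pi_pmf {1..n} ((0, 0), 0) (\<lambda>_. r))
     \<partial>measure_pmf (poisson_pmf (real n / 2)))"
  unfolding expect_def sample_law_def
  by (rule nn_integral_label_vector[OF p(1) cell_of_measurable_p r]) (simp, rule assms)

lemma nn_integral_of_bool:
  "(\<integral>\<^sup>+x. ennreal (of_bool (R x)) \<partial>measure_pmf M) = ennreal (measure_pmf.expectation M (\<lambda>x. of_bool (R x)))"
  by (intro nn_integral_eq_integral bdd_integrable bdd_of_bool) auto

lemma expect_psi_le:
  assumes c: "0 \<le> c" and N: "\<And>N. N \<le> n \<Longrightarrow>
    measure_pmf.expectation (Pi_pmf {1..n} ((0, 0), 0) (\<lambda>_. r)) (\<lambda>W. of_bool (\<tau> \<le> T_joint l1 l2 d N W)) \<le> c"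
  shows "expect n p (psi l1 l2 d \<tau> n) \<le> ennreal c"
proof -
  let ?F = "\<lambda>N W. if N > n then 0 else of_bool (\<tau> \<le> T_joint l1 l2 d N W) :: real"
  have "expect n p (psi l1 l2 d \<tau> n) = (\<integral>\<^sup>+N. \<integral>\<^sup>+W. ennreal (?F N W) \<partial>measure_pmf (Pi_pmf {1..n} ((0, 0), 0) (\<lambda>_. r))
     \<partial>measure_pmf (poisson_pmf (real n / 2)))"
    by (rule expect_label_vector) (simp add: psi_def T_stat_eq[of _ n, where dW = "((0, 0), 0)"])
  also have "\<dots> \<le> (\<integral>\<^sup>+N. ennreal c \<partial>measure_pmf (poisson_pmf (real n / 2)))"
  proof (rule nn_integral_mono)
    fix N
    show "(\<integral>\<^sup>+W. ennreal (?F N W) \<partial>measure_pmf (Pi_pmf {1..n} ((0, 0), 0) (\<lambda>_. r))) \<le> ennreal c"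
      using N[of N] c by (cases "N > n") (auto simp: nn_integral_of_bool intro!: ennreal_leI)
  qed
  finally show ?thesis by simp
qed

text \<open>The test accepts when N exceeds n, which costs exp(-n/8) as in the theorem. Sample sizes
  below n/4 are given up too; their cost exp(-n/16) is later absorbed into 1/10.\<close>

lemma expect_one_minus_psi_le:
  assumes n: "1 \<le> n" and c: "0 \<le> c" and N: "\<And>N. N \<le> n \<Longrightarrow> n \<le> 4 * N \<Longrightarrow>
    measure_pmf.expectation (Pi_pmf {1..n} ((0, 0), 0) (\<lambda>_. r)) (\<lambda>W. of_bool (T_joint l1 l2 d N W < \<tau>)) \<le> c"
  shows "expect n p (\<lambda>N \<omega>. 1 - psi l1 l2 d \<tau> n N \<omega>) \<le> ennreal (c + exp (- real n / 16) + exp (- real n / 8))"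
proof -
  let ?P = "poisson_pmf (real n / 2)"
  let ?F = "\<lambda>N W. if N > n then 1 else of_bool (T_joint l1 l2 d N W < \<tau>) :: real"
  have "expect n p (\<lambda>N \<omega>. 1 - psi l1 l2 d \<tau> n N \<omega>) =
     (\<integral>\<^sup>+N. \<integral>\<^sup>+W. ennreal (?F N W) \<partial>measure_pmf (Pi_pmf {1..n} ((0, 0), 0) (\<lambda>_. r)) \<partial>measure_pmf ?P)"
    by (rule expect_label_vector) (auto simp: psi_def T_stat_eq[of _ n, where dW = "((0, 0), 0)"])
  also have "\<dots> \<le> (\<integral>\<^sup>+N. ennreal c + (indicator {N. 4 * N < n} N + indicator {N. n < N} N) \<partial>measure_pmf ?P)"
  proof (rule nn_integral_mono)
    fix N
    show "(\<integral>\<^sup>+W. ennreal (?F N W) \<partial>measure_pmf (Pi_pmf {1..n} ((0, 0), 0) (\<lambda>_. r))) \<le>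
        ennreal c + (indicator {N. 4 * N < n} N + indicator {N. n < N} N)"
    proof (cases "N > n \<or> 4 * N < n")
      case True
      have "(\<integral>\<^sup>+W. ennreal (?F N W) \<partial>measure_pmf (Pi_pmf {1..n} ((0, 0), 0) (\<lambda>_. r))) \<le>
          (\<integral>\<^sup>+W. 1 \<partial>measure_pmf (Pi_pmf {1..n} ((0, 0), 0) (\<lambda>_. r)))"
        by (intro nn_integral_mono) auto
      also have "\<dots> \<le> indicator {N. 4 * N < n} N + indicator {N. n < N} N"
        using True by auto
      also have "\<dots> \<le> ennreal c + \<dots>" by simp
      finally show ?thesis .
    next
      case False
      then show ?thesis using N[of N] by (auto simp: nn_integral_of_bool intro!: ennreal_leI)
    qed
  qed
  also have "\<dots> = ennreal c + (emeasure ?P {N. 4 * N < n} + emeasure ?P {N. n < N})"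
    by (simp add: nn_integral_add)
  also have "\<dots> \<le> ennreal c + (ennreal (exp (- real n / 16)) + ennreal (exp (- real n / 8)))"
    unfolding measure_pmf.emeasure_eq_measure
    by (intro add_mono order_refl ennreal_leI poisson_lower_tail poisson_upper_tail n)
  also have "\<dots> = ennreal (c + exp (- real n / 16) + exp (- real n / 8))"
    using c by (simp add: add.assoc)
  finally show ?thesis .
qed

end

lemma null_class_smooth:
  assumes L: "0 < L" and p: "p \<in> P0_TV2 l1 l2 L \<union> P0_TV l1 l2 L \<union> P0_chi2 l1 l2 L"
  obtains k where "p \<in> P0 l1 l2" "cond_XY p k"
    "\<And>z z' W l. z \<in> {0..1} \<Longrightarrow> z' \<in> {0..1} \<Longrightarrow> W \<in> {fst, snd} \<Longrightarrow>
      (\<Sum>x\<in>{1..l}. \<bar>pmf (map_pmf W (k z)) x - pmf (map_pmf W (k z')) x\<bar>) \<le> sqrt (2 * L * \<bar>z - z'\<bar>)"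
proof -
  have "\<exists>k. p \<in> P0 l1 l2 \<and> cond_XY p k \<and> (\<forall>z\<in>{0..1}. \<forall>z'\<in>{0..1}. \<forall>W\<in>{fst, snd}. \<forall>l.
      (\<Sum>x\<in>{1..l}. \<bar>pmf (map_pmf W (k z)) x - pmf (map_pmf W (k z')) x\<bar>) \<le> sqrt (2 * L * \<bar>z - z'\<bar>))"
    using p
  proof (elim UnE)
    assume "p \<in> P0_TV2 l1 l2 L"
    then obtain k where k: "p \<in> P0 l1 l2" "cond_XY p k" "\<forall>z\<in>{0..1}. \<forall>z'\<in>{0..1}. \<forall>W\<in>{fst, snd}.
        l1_dist (map_pmf W (k z)) (map_pmf W (k z')) \<le> sqrt (L * \<bar>z - z'\<bar>)"
      unfolding P0_TV2_def by blast
    have "(\<Sum>x\<in>{1..l}. \<bar>pmf (map_pmf W (k z)) x - pmf (map_pmf W (k z')) x\<bar>) \<le> sqrt (2 * L * \<bar>z - z'\<bar>)"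
      if "z \<in> {0..1}" "z' \<in> {0..1}" "W \<in> {fst, snd}" for z z' W l
    proof -
      have "(\<Sum>x\<in>{1..l}. \<bar>pmf (map_pmf W (k z)) x - pmf (map_pmf W (k z')) x\<bar>) \<le> l1_dist (map_pmf W (k z)) (map_pmf W (k z'))"
        by (rule sum_abs_diff_le_l1_dist) simp
      also have "\<dots> \<le> sqrt (L * \<bar>z - z'\<bar>)" using k(3) that by blast
      also have "\<dots> \<le> sqrt (2 * L * \<bar>z - z'\<bar>)" using L by (intro real_sqrt_le_mono mult_right_mono) auto
      finally show ?thesis .
    qed
    with k(1,2) show ?thesis by blast
  next
    assume "p \<in> P0_TV l1 l2 L"
    then obtain k where k: "p \<in> P0 l1 l2" "cond_XY p k" "\<forall>z\<in>{0..1}. \<forall>z'\<in>{0..1}. \<forall>W\<in>{fst, snd}.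
        l1_dist (map_pmf W (k z)) (map_pmf W (k z')) \<le> L * \<bar>z - z'\<bar>"
      unfolding P0_TV_def by blast
    have "(\<Sum>x\<in>{1..l}. \<bar>pmf (map_pmf W (k z)) x - pmf (map_pmf W (k z')) x\<bar>) \<le> sqrt (2 * L * \<bar>z - z'\<bar>)"
      if "z \<in> {0..1}" "z' \<in> {0..1}" "W \<in> {fst, snd}" for z z' W l
    proof (rule real_le_rsqrt)
      let ?s = "\<Sum>x\<in>{1..l}. \<bar>pmf (map_pmf W (k z)) x - pmf (map_pmf W (k z')) x\<bar>"
      have "?s \<le> l1_dist (map_pmf W (k z)) (map_pmf W (k z'))"
        by (rule sum_abs_diff_le_l1_dist) simp
      also have "\<dots> \<le> L * \<bar>z - z'\<bar>" using k(3) that by blast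
      finally have "?s * ?s \<le> 2 * (L * \<bar>z - z'\<bar>)"
        by (intro mult_mono sum_abs_diff_pmf_le_2) (auto intro: sum_nonneg)
      then show "?s\<^sup>2 \<le> 2 * L * \<bar>z - z'\<bar>" by (simp add: power2_eq_square mult.assoc)
    qed
    with k(1,2) show ?thesis by blast
  next
    assume "p \<in> P0_chi2 l1 l2 L"
    then obtain k where k: "p \<in> P0 l1 l2" "cond_XY p k" "\<forall>z\<in>{0..1}. \<forall>z'\<in>{0..1}. \<forall>W\<in>{fst, snd}.
        chi2_dist (map_pmf W (k z)) (map_pmf W (k z')) \<le> ennreal (L * \<bar>z - z'\<bar>)"
      unfolding P0_chi2_def by blast
    have "(\<Sum>x\<in>{1..l}. \<bar>pmf (map_pmf W (k z)) x - pmf (map_pmf W (k z')) x\<bar>) \<le> sqrt (2 * L * \<bar>z - z'\<bar>)"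
      if "z \<in> {0..1}" "z' \<in> {0..1}" "W \<in> {fst, snd}" for z z' W l
    proof -
      have "(\<Sum>x\<in>{1..l}. \<bar>pmf (map_pmf W (k z)) x - pmf (map_pmf W (k z')) x\<bar>) \<le> l1_dist (map_pmf W (k z)) (map_pmf W (k z'))"
        by (rule sum_abs_diff_le_l1_dist) simp
      also have "\<dots> \<le> sqrt (L * \<bar>z - z'\<bar>)"
        by (rule l1_dist_le_sqrt_chi2_dist) (use k(3) that L in \<open>auto simp: measure_pmf.prob_space_axioms\<close>)
      also have "\<dots> \<le> sqrt (2 * L * \<bar>z - z'\<bar>)" using L by (intro real_sqrt_le_mono mult_right_mono) auto
      finally show ?thesis .
    qed
    with k(1,2) show ?thesis by blast
  qed
  then show ?thesis using that by blast
qed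

lemma bins_scale:
  fixes n d :: nat and a :: real
  assumes n: "1 \<le> n"
  defines "a \<equiv> real n powr (1 / 5)" and "d \<equiv> nat \<lceil>real n powr (2 / 5)\<rceil>"
  shows "1 \<le> a" "real n = a ^ 5" "real n powr (-2/5) = 1 / a\<^sup>2" "a\<^sup>2 \<le> real d" "real d \<le> 2 * a\<^sup>2" "1 \<le> d"
proof -
  show a1: "1 \<le> a" using n unfolding a_def by (intro ge_one_powr_ge_zero) auto
  have pw: "a ^ k = real n powr (real k / 5)" for k
    using n unfolding a_def by (simp add: powr_realpow[symmetric] powr_powr)
  show "real n = a ^ 5" using pw[of 5] n by simp
  have a2: "a\<^sup>2 = real n powr (2 / 5)" using pw[of 2] by simp
  show "real n powr (-2/5) = 1 / a\<^sup>2" unfolding a2 by (simp add: powr_minus_divide[symmetric])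
  have d: "real d = real_of_int \<lceil>a\<^sup>2\<rceil>" unfolding d_def a2 by simp
  show ad: "a\<^sup>2 \<le> real d" unfolding d by (rule le_of_int_ceiling)
  have "1 \<le> a\<^sup>2" using a1 by simp
  then show "real d \<le> 2 * a\<^sup>2" unfolding d by linarith
  show "1 \<le> d" using ad \<open>1 \<le> a\<^sup>2\<close> by linarith
qed

text \<open>16 L^2 a bounds the conditional mean: n times 4 h^4, where h^2 = 2 L / d and d \<ge>
  a^2. The rest s of the lower bound on \<zeta> is a margin; as 122880 = 10 * 12288, it turns
  Chebyshev's bound into 1 / (10 s).\<close>

lemma type1_bound:
  assumes L: "0 < L" and p: "p \<in> P0_TV2 l1 l2 L \<union> P0_TV l1 l2 L \<union> P0_chi2 l1 l2 L" and n: "1 \<le> n"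
    and \<zeta>: "16 * L\<^sup>2 + 122880 * (16 * L\<^sup>2 + 2) \<le> \<zeta>"
  shows "expect n p (psi l1 l2 (nat \<lceil>real n powr (2/5)\<rceil>) (\<zeta> * real n powr (1/5)) n) \<le> ennreal (1/10)"
proof -
  define a where "a = real n powr (1 / 5)"
  define d where "d = nat \<lceil>real n powr (2 / 5)\<rceil>"
  note sc = bins_scale[OF n, folded a_def d_def]
  obtain k where kn: "p \<in> P0 l1 l2" "cond_XY p k"
    "\<And>z z' W l. z \<in> {0..1} \<Longrightarrow> z' \<in> {0..1} \<Longrightarrow> W \<in> {fst, snd} \<Longrightarrow>
      (\<Sum>x\<in>{1..l}. \<bar>pmf (map_pmf W (k z)) x - pmf (map_pmf W (k z')) x\<bar>) \<le> sqrt (2 * L * \<bar>z - z'\<bar>)"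
    using null_class_smooth[OF L p] by blast
  have pE: "p \<in> E0 l1 l2" using kn(1) by (simp add: P0_def)
  obtain k1 where k1: "cond_XY p k1" "AE z in distr_Z p. k1 z = pair_pmf (map_pmf fst (k1 z)) (map_pmf snd (k1 z))"
    using kn(1) by (auto simp: P0_def)
  obtain r where "cells p d r k" using cells_exists[OF pE kn(2) sc(6)] by blast
  then interpret cells p d r k .
  \<comment> \<open>Independence is known for the version \<open>k1\<close>, smoothness for
    \<open>k\<close>; both are required of the same kernel.\<close>
  have ind: "AE z in distr_Z p. k z = pair_pmf (map_pmf fst (k z)) (map_pmf snd (k z))"
    using cond_XY_AE_unique[OF p kn(2) k1(1)] k1(2) by eventually_elim simp
  define h where "h = sqrt (2 * L / real d)"
  define \<delta> where "\<delta> = 16 * L\<^sup>2 * a / real n"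
  define s where "s = 122880 * (16 * L\<^sup>2 + 2)"
  have h4: "4 * h ^ 4 = 16 * L\<^sup>2 / (real d)\<^sup>2"
  proof -
    have "h ^ 4 = (h\<^sup>2)\<^sup>2" by simp
    also have "\<dots> = (2 * L / real d)\<^sup>2" using L by (simp add: h_def)
    finally show ?thesis by (simp add: power_divide power_mult_distrib)
  qed
  have \<delta>: "real n * \<delta> = 16 * L\<^sup>2 * a" "0 \<le> \<delta>" using n sc(1) by (simp_all add: \<delta>_def)
  have D: "dependence (grid l1 l2) (cell_pmf r m) \<le> \<delta>" if m: "m \<in> snd ` set_pmf r" for m
  proof -
    have "dependence (grid l1 l2) (cell_pmf r m) \<le> 4 * h ^ 4"
    proof (rule dependence_cell_le_null[OF m ind])
      show "0 \<le> h" using L by (simp add: h_def)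
      fix z z' :: real and W :: "nat \<times> nat \<Rightarrow> nat" and l
      assume z: "z \<in> {0..1}" "z' \<in> {0..1}" "\<bar>z - z'\<bar> \<le> 1 / real d" "W \<in> {fst, snd}"
      have "2 * L * \<bar>z - z'\<bar> \<le> 2 * L * (1 / real d)" using z L by (intro mult_left_mono) auto
      then show "(\<Sum>x\<in>{1..l}. \<bar>pmf (map_pmf W (k z)) x - pmf (map_pmf W (k z')) x\<bar>) \<le> h"
        using order_trans[OF kn(3)[OF z(1,2,4), of l] real_sqrt_le_mono] by (simp add: h_def)
    qed
    also have "\<dots> = 16 * L\<^sup>2 / (real d)\<^sup>2" by (rule h4)
    also have "\<dots> \<le> 16 * L\<^sup>2 / (a\<^sup>2)\<^sup>2"
      using sc by (intro divide_left_mono power_mono mult_pos_pos) auto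
    also have "\<dots> = \<delta>"
      using sc(1) by (simp add: \<delta>_def sc(2) field_simps power_numeral_reduce)
    finally show ?thesis .
  qed
  have s: "1 \<le> s" "s \<le> \<zeta> - 16 * L\<^sup>2" using \<zeta> by (simp_all add: s_def)
  have "expect n p (psi l1 l2 d (\<zeta> * a) n) \<le> ennreal (1 / 10)"
  proof (rule expect_psi_le)
    fix N assume N: "N \<le> n"
    have lt: "real n * \<delta> < \<zeta> * a"
      using mult_strict_right_mono[of "16 * L\<^sup>2" \<zeta> a] s sc(1) by (simp add: \<delta>)
    have "measure_pmf.expectation (Pi_pmf {1..n} ((0, 0), 0) (\<lambda>_. r)) (\<lambda>W. of_bool (\<zeta> * a \<le> T_joint l1 l2 d N W))
        \<le> 12288 * (real n * \<delta> + real d) / (\<zeta> * a - real n * \<delta>)\<^sup>2"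
      by (rule type1_error_le[OF N \<delta>(2) lt]) (rule D)
    also have "\<dots> \<le> 12288 * ((16 * L\<^sup>2 + 2) * a\<^sup>2) / (s * a)\<^sup>2"
    proof (rule frac_le)
      have "16 * L\<^sup>2 * a \<le> 16 * L\<^sup>2 * a\<^sup>2" using sc(1) by (intro mult_left_mono) (auto simp: power2_eq_square)
      then show "12288 * (real n * \<delta> + real d) \<le> 12288 * ((16 * L\<^sup>2 + 2) * a\<^sup>2)"
        using sc(5) unfolding \<delta>(1) by (simp add: algebra_simps)
      have "s * a \<le> (\<zeta> - 16 * L\<^sup>2) * a" using s sc(1) by (intro mult_right_mono) auto
      then show "(s * a)\<^sup>2 \<le> (\<zeta> * a - real n * \<delta>)\<^sup>2"
        using s sc(1) unfolding \<delta>(1) by (intro power_mono) (auto simp: algebra_simps)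
    qed (use s sc(1) in auto)
    also have "\<dots> = 12288 * (16 * L\<^sup>2 + 2) / s\<^sup>2"
      using s sc(1) by (simp add: power_mult_distrib)
    also have "12288 * (16 * L\<^sup>2 + 2) = s / 10" by (simp add: s_def)
    also have "s / 10 / s\<^sup>2 = 1 / 10 * (1 / s)" using s(1) by (simp add: power2_eq_square)
    also have "\<dots> \<le> 1 / 10" using s(1) by simp
    finally show "measure_pmf.expectation (Pi_pmf {1..n} ((0, 0), 0) (\<lambda>_. r)) (\<lambda>W. of_bool (\<zeta> * a \<le> T_joint l1 l2 d N W)) \<le> (1 / 10 :: real)" .
  qed simp
  then show ?thesis by (simp add: a_def d_def)
qed

text \<open>Cauchy-Schwarz with each weight split into two square roots; the total weight is at most
  1.\<close>

lemma sum_squares_ge_of_sum_ge: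
  fixes q a :: "nat \<Rightarrow> real"
  assumes q: "\<And>m. m \<in> G \<Longrightarrow> 0 \<le> q m" "(\<Sum>m\<in>G. q m) \<le> 1"
    and x: "0 \<le> x" "x \<le> (\<Sum>m\<in>G. q m * a m)"
  shows "x\<^sup>2 \<le> (\<Sum>m\<in>G. q m * (a m)\<^sup>2)"
proof -
  have "x\<^sup>2 \<le> (\<Sum>m\<in>G. q m * a m)\<^sup>2" using x by (intro power_mono)
  also have "\<dots> = (\<Sum>m\<in>G. sqrt (q m) * (sqrt (q m) * a m))\<^sup>2"
    using q(1) by (intro arg_cong[where f = "\<lambda>x. x\<^sup>2"] sum.cong) (auto simp flip: mult.assoc)
  also have "\<dots> \<le> (\<Sum>m\<in>G. (sqrt (q m))\<^sup>2) * (\<Sum>m\<in>G. (sqrt (q m) * a m)\<^sup>2)"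
    by (rule Cauchy_Schwarz_ineq_sum)
  also have "\<dots> = (\<Sum>m\<in>G. q m) * (\<Sum>m\<in>G. q m * (a m)\<^sup>2)"
    using q(1) by (intro arg_cong2[where f = "(*)"] sum.cong) (auto simp: power_mult_distrib)
  also have "\<dots> \<le> 1 * (\<Sum>m\<in>G. q m * (a m)\<^sup>2)"
    using q by (intro mult_right_mono sum_nonneg mult_nonneg_nonneg) auto
  finally show ?thesis by simp
qed

text \<open>Cauchy-Schwarz over the l1 * l2 points of the grid. This is how the alphabet sizes come
  into c.\<close>

lemma sum_abs_gap_square_le: "(\<Sum>w\<in>grid l1 l2. \<bar>gap P w\<bar>)\<^sup>2 \<le> real l1 * real l2 * dependence (grid l1 l2) P"
proof -
  have "(\<Sum>w\<in>grid l1 l2. 1 * \<bar>gap P w\<bar>)\<^sup>2 \<le> (\<Sum>w\<in>grid l1 l2. 1\<^sup>2) * (\<Sum>w\<in>grid l1 l2. \<bar>gap P w\<bar>\<^sup>2)"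
    by (rule Cauchy_Schwarz_ineq_sum)
  then show ?thesis by (simp add: dependence_def grid_def)
qed

lemma (in cells) sum_labels: "G \<subseteq> {1..d} \<Longrightarrow> (\<Sum>m\<in>G. pmf (map_pmf snd r) m) \<le> 1"
  by (intro sum_pmf_le_1) (auto intro: finite_subset)

text \<open>In units of a^(-2), c pays L for the variation of the kernel within a bin, 96 for the
  sparse bins and \<kappa> for the signal; 640 (L + 3) rules out small n. In \<kappa>, the 4 stems
  from N \<ge> n/4, 8 \<zeta> from the condition 8 \<tau> \<le> N S, and 8000000 makes the error at
  most 1/20.\<close>

lemma type2_bound:
  assumes L: "0 < L" and l: "1 \<le> l1" "1 \<le> l2" and \<zeta>: "0 \<le> \<zeta>" and n: "1 \<le> n"
    and p: "p \<in> Q0_TV l1 l2 L" and \<epsilon>: "(INF q \<in> P0 l1 l2. l1_dist p q) \<ge> \<epsilon>"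
    and \<kappa>: "\<kappa> = 4 * real l1 * real l2 * (8000000 + 8 * \<zeta>)" and c: "\<kappa> + L + 96 + 640 * (L + 3) \<le> c"
    and \<epsilon>c: "c * real n powr (-2/5) \<le> \<epsilon>"
  shows "expect n p (\<lambda>N \<omega>. 1 - psi l1 l2 (nat \<lceil>real n powr (2/5)\<rceil>) (\<zeta> * real n powr (1/5)) n N \<omega>) \<le>
    ennreal (1/10 + exp (- real n / 8))"
proof -
  define a where "a = real n powr (1 / 5)"
  define d where "d = nat \<lceil>real n powr (2 / 5)\<rceil>"
  note sc = bins_scale[OF n, folded a_def d_def]
  obtain k where kn: "cond_XY p k" "\<forall>z \<in> {0..1}. \<forall>z' \<in> {0..1}. l1_dist (k z) (k z') \<le> L * \<bar>z - z'\<bar>"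
    using p by (auto simp: Q0_TV_def)
  have pE: "p \<in> E0 l1 l2" using p by (simp add: Q0_TV_def Q0_def)
  obtain r where rr: "cells p d r k" "AE z in distr_Z p. set_pmf (k z) \<subseteq> grid l1 l2"
    using cells_exists[OF pE kn(1) sc(6)] by blast
  interpret cells p d r k by (rule rr)
  define q where "q m = pmf (map_pmf snd r) m" for m
  define e where "e m = (\<Sum>w\<in>grid l1 l2. \<bar>gap (cell_pmf r m) w\<bar>)" for m
  have e: "0 \<le> e m" "e m \<le> 2" for m unfolding e_def by (auto intro: sum_nonneg sum_abs_gap_le)
  have q0: "0 \<le> q m" for m by (simp add: q_def)
  have a2: "0 < a\<^sup>2" using sc(1) by simp
  have d0: "0 < real d" using sc(4) a2 by linarith
  have Ld: "L / real d \<le> L / a\<^sup>2" using L sc(4) a2 d0 by (intro divide_left_mono mult_pos_pos) auto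
  \<comment> \<open>For the real-valued infimum \<open>cINF_lower\<close> asks for a lower bound of
    the distances, here 0.\<close>
  have "(INF q \<in> P0 l1 l2. l1_dist p q) \<le> l1_dist p ind_measure"
    using rr(2) pE by (intro cINF_lower ind_measure_in_P0 bdd_belowI[of _ 0]) (auto simp: l1_dist_nonneg E0_def)
  also have "\<dots> \<le> L / real d + (\<Sum>m\<in>{1..d}. q m * e m)"
    unfolding q_def e_def
  proof (rule l1_dist_ind_measure_le[OF rr(2)])
    show "0 \<le> L / real d" using L by simp
    fix z z' :: real assume z: "z \<in> {0..1}" "z' \<in> {0..1}" "\<bar>z - z'\<bar> \<le> 1 / real d"
    have "(\<Sum>u\<in>grid l1 l2. \<bar>pmf (k z) u - pmf (k z') u\<bar>) \<le> l1_dist (k z) (k z')"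
      by (rule sum_abs_diff_le_l1_dist) simp
    also have "\<dots> \<le> L * \<bar>z - z'\<bar>" using kn(2) z by blast
    also have "\<dots> \<le> L * (1 / real d)" using z L by (intro mult_left_mono) auto
    finally show "(\<Sum>u\<in>grid l1 l2. \<bar>pmf (k z) u - pmf (k z') u\<bar>) \<le> L / real d" by simp
  qed
  finally have "\<epsilon> \<le> L / a\<^sup>2 + (\<Sum>m\<in>{1..d}. q m * e m)" using \<epsilon> Ld by linarith
  then have main: "c / a\<^sup>2 \<le> L / a\<^sup>2 + (\<Sum>m\<in>{1..d}. q m * e m)" using \<epsilon>c unfolding sc(3) by simp
  have \<kappa>1: "32000000 \<le> \<kappa>" "32 * \<zeta> \<le> \<kappa>" "\<kappa> \<le> \<kappa>\<^sup>2 / (real l1 * real l2)"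
  proof -
    have l12: "1 \<le> real l1 * real l2"
      using l by (metis mult_le_mono nat_mult_1 of_nat_1 of_nat_le_iff of_nat_mult)
    have "1 * (4 * (8000000 + 8 * \<zeta>)) \<le> (real l1 * real l2) * (4 * (8000000 + 8 * \<zeta>))"
      using l12 \<zeta> by (intro mult_right_mono) auto
    then have *: "4 * (8000000 + 8 * \<zeta>) \<le> \<kappa>" by (simp add: \<kappa> mult_ac)
    then show "32000000 \<le> \<kappa>" "32 * \<zeta> \<le> \<kappa>" using \<zeta> by simp_all
    have "\<kappa> * (real l1 * real l2) \<le> \<kappa> * \<kappa>"
    proof (rule mult_left_mono)
      have "real l1 * real l2 * 1 \<le> real l1 * real l2 * (4 * (8000000 + 8 * \<zeta>))"
        using l12 \<zeta> by (intro mult_left_mono) auto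
      then show "real l1 * real l2 \<le> \<kappa>" by (simp add: \<kappa> mult_ac)
    qed (use \<open>32000000 \<le> \<kappa>\<close> in simp)
    then show "\<kappa> \<le> \<kappa>\<^sup>2 / (real l1 * real l2)"
      using l12 by (simp add: le_divide_eq power2_eq_square)
  qed
  \<comment> \<open>The weighted sum of the \<open>e m\<close> is at most 2, so the separation is at
    most L / a^2 + 2. For smaller n this contradicts the choice of c. The bound on n makes
    exp(-n/16) at most 1/20.\<close>
  have n640: "640 \<le> n"
  proof (rule ccontr)
    assume "\<not> 640 \<le> n"
    have "a\<^sup>2 \<le> a ^ 5" using sc(1) by (intro power_increasing) auto
    then have an: "a\<^sup>2 \<le> 640" using \<open>\<not> 640 \<le> n\<close> sc(2) by linarith
    have "(\<Sum>m\<in>{1..d}. q m * e m) \<le> (\<Sum>m\<in>{1..d}. q m * 2)"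
      using e q0 by (intro sum_mono mult_left_mono) auto
    also have "\<dots> \<le> 2" using sum_labels[of "{1..d}"] by (simp add: q_def flip: sum_distrib_right)
    finally have "(c - L) / a\<^sup>2 \<le> 2" using main by (simp add: diff_divide_distrib)
    then have "c - L \<le> 2 * a\<^sup>2" using a2 by (simp add: divide_le_eq)
    then show False using c an L \<kappa>1(1) by simp
  qed
  have "expect n p (\<lambda>N \<omega>. 1 - psi l1 l2 d (\<zeta> * a) n N \<omega>) \<le> ennreal (1 / 20 + exp (- real n / 16) + exp (- real n / 8))"
  proof (rule expect_one_minus_psi_le[OF n])
    fix N assume N: "N \<le> n" "n \<le> 4 * N"
    have N4: "real n \<le> 4 * real N" using N(2) by linarith
    then have N0: "0 < real N" using n by simp
    define G where "G = {m \<in> {1..d}. 6 \<le> real N * q m}"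
    define S where "S = (\<Sum>m\<in>G. q m * dependence (grid l1 l2) (cell_pmf r m))"
    have G: "G \<subseteq> {1..d}" "finite G" by (auto simp: G_def)
    \<comment> \<open>A sparse bin contributes at most (6 / N) * 2. With at most 2 a^2 bins and N
      \<ge> a^5 / 4 this adds up to 96 / a^3.\<close>
    have "(\<Sum>m\<in>{1..d} - G. q m * e m) \<le> (\<Sum>m\<in>{1..d} - G. 12 / real N)"
    proof (rule sum_mono)
      fix m assume "m \<in> {1..d} - G"
      then have "q m \<le> 6 / real N" using N0 by (auto simp: G_def field_simps)
      then have "q m * e m \<le> 6 / real N * 2" using e[of m] q0[of m] by (intro mult_mono) auto
      then show "q m * e m \<le> 12 / real N" by simp
    qed
    also have "\<dots> \<le> real d * (12 / real N)"
      using card_mono[of "{1..d}" "{1..d} - G"] N0 by (simp add: divide_right_mono)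
    also have "\<dots> \<le> (2 * a\<^sup>2) * (12 / (a ^ 5 / 4))"
      using sc N4 N0 by (intro mult_mono divide_left_mono) auto
    also have "\<dots> = 96 / a ^ 3" using sc(1) by (simp add: field_simps power_numeral_reduce)
    also have "\<dots> \<le> 96 / a\<^sup>2" using sc(1) by (intro divide_left_mono power_increasing) auto
    finally have small: "(\<Sum>m\<in>{1..d} - G. q m * e m) \<le> 96 / a\<^sup>2" .
    have "(\<Sum>m\<in>{1..d}. q m * e m) = (\<Sum>m\<in>{1..d} - G. q m * e m) + (\<Sum>m\<in>G. q m * e m)"
      by (rule sum.subset_diff) (use G in auto)
    then have "(c - L - 96) / a\<^sup>2 \<le> (\<Sum>m\<in>G. q m * e m)"
      using main small by (simp add: diff_divide_distrib)
    moreover have "\<kappa> / a\<^sup>2 \<le> (c - L - 96) / a\<^sup>2" using c L a2 by (intro divide_right_mono) auto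
    ultimately have "\<kappa> / a\<^sup>2 \<le> (\<Sum>m\<in>G. q m * e m)" by linarith
    then have "(\<kappa> / a\<^sup>2)\<^sup>2 \<le> (\<Sum>m\<in>G. q m * (e m)\<^sup>2)"
      using \<kappa>1(1) a2 q0 sum_labels[OF G(1)] by (intro sum_squares_ge_of_sum_ge) (auto simp: q_def)
    also have "\<dots> \<le> (\<Sum>m\<in>G. q m * (real l1 * real l2 * dependence (grid l1 l2) (cell_pmf r m)))"
      unfolding e_def by (intro sum_mono mult_left_mono sum_abs_gap_square_le q0)
    also have "\<dots> = real l1 * real l2 * S"
      unfolding S_def sum_distrib_left by (intro sum.cong) auto
    finally have "(\<kappa> / a\<^sup>2)\<^sup>2 / (real l1 * real l2) \<le> S"
      using l by (simp add: divide_le_eq mult.commute)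
    \<comment> \<open>Since \<kappa> carries the factor l1 * l2, one of the two factors in
      \<kappa>^2 pays for the division by the alphabet sizes.\<close>
    moreover have "\<kappa> / (a\<^sup>2)\<^sup>2 \<le> (\<kappa> / a\<^sup>2)\<^sup>2 / (real l1 * real l2)"
      using divide_right_mono[OF \<kappa>1(3), of "(a\<^sup>2)\<^sup>2"] by (simp add: power_divide mult_ac)
    ultimately have S: "\<kappa> / a ^ 4 \<le> S" by (simp flip: power_mult)
    then have S0: "0 < S" using \<kappa>1(1) sc(1) by (intro less_le_trans[OF _ S]) auto
    have "a ^ 5 / 4 * (\<kappa> / a ^ 4) \<le> real N * S"
      using N4 sc(1,2) S \<kappa>1(1) by (intro mult_mono) auto
    moreover have "a ^ 5 / 4 * (\<kappa> / a ^ 4) = \<kappa> / 4 * a"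
      using sc(1) by (simp add: field_simps power_numeral_reduce)
    ultimately have NS: "\<kappa> / 4 * a \<le> real N * S" by (simp only:)
    have \<tau>: "8 * (\<zeta> * a) \<le> real N * S"
    proof -
      have "32 * \<zeta> * a \<le> \<kappa> * a" using \<kappa>1(2) sc(1) by (intro mult_right_mono) auto
      then show ?thesis using NS by linarith
    qed
    have big: "8000000 * a \<le> real N * S"
    proof -
      have "32000000 * a \<le> \<kappa> * a" using \<kappa>1(1) sc(1) by (intro mult_right_mono) auto
      then show ?thesis using NS by linarith
    qed
    have "measure_pmf.expectation (Pi_pmf {1..n} ((0, 0), 0) (\<lambda>_. r)) (\<lambda>W. of_bool (T_joint l1 l2 d N W < \<zeta> * a)) \<le>
        200000 / (real N * S) + 800000 * real d / (real N * S)\<^sup>2"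
      unfolding S_def q_def
      by (rule type2_error_le) (use N(1) N0 G(1) S0 \<tau> in \<open>auto simp: S_def q_def G_def\<close>)
    \<comment> \<open>The first term is 1/40; in the second a^2 cancels because d is at most 2
      a^2.\<close>
    also have "\<dots> \<le> 200000 / 8000000 + 800000 * (2 * a\<^sup>2) / (8000000 * a)\<^sup>2"
    proof (intro add_mono frac_le mult_left_mono power_mono)
      show "8000000 \<le> real N * S" using big sc(1) by linarith
    qed (use big sc in auto)
    also have "\<dots> \<le> 1 / 20" using sc(1) by (simp add: power_mult_distrib)
    finally show "measure_pmf.expectation (Pi_pmf {1..n} ((0, 0), 0) (\<lambda>_. r)) (\<lambda>W. of_bool (T_joint l1 l2 d N W < \<zeta> * a)) \<le> (1 / 20 :: real)" .
  qed simp
  also have "\<dots> \<le> ennreal (1 / 10 + exp (- real n / 8))"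
  proof (rule ennreal_leI)
    have "exp (- real n / 16) \<le> exp (- 40)" using n640 by simp
    also have "\<dots> \<le> 1 / 41"
      using exp_ge_add_one_self[of 40] by (simp add: exp_minus field_simps)
    finally show "1 / 20 + exp (- real n / 16) + exp (- real n / 8) \<le> 1 / 10 + exp (- real n / 8)" by simp
  qed
  finally show ?thesis by (simp add: a_def d_def)
qed

theorem theorem5p2:
  fixes L :: real
  assumes "L > 0"
  shows "\<exists>\<zeta>0::real. \<forall>\<zeta>\<ge>\<zeta>0. \<forall>l1 l2 :: nat. l1 \<ge> 1 \<longrightarrow> l2 \<ge> 1 \<longrightarrow>
    (\<exists>c::real. \<forall>n::nat. n \<ge> 1 \<longrightarrow> (\<forall>\<epsilon>::real. \<epsilon> \<ge> c * real n powr (-2/5) \<longrightarrow>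
      (let d = nat \<lceil>real n powr (2/5)\<rceil>;
           \<tau> = \<zeta> * real n powr (1/5);
           \<psi> = psi l1 l2 d \<tau> n
       in (SUP p \<in> P0_TV2 l1 l2 L \<union> P0_TV l1 l2 L \<union> P0_chi2 l1 l2 L.
             expect n p \<psi>) \<le> ennreal (1/10) \<and>
          (SUP p \<in> {p \<in> Q0_TV l1 l2 L. (INF q \<in> P0 l1 l2. l1_dist p q) \<ge> \<epsilon>}.
             expect n p (\<lambda>N \<omega>. 1 - \<psi> N \<omega>)) \<le> ennreal (1/10 + exp (- real n / 8)))))"
proof (rule exI[of _ "16 * L\<^sup>2 + 122880 * (16 * L\<^sup>2 + 2)"], intro allI impI)
  fix \<zeta> :: real and l1 l2 :: nat
  assume \<zeta>: "16 * L\<^sup>2 + 122880 * (16 * L\<^sup>2 + 2) \<le> \<zeta>" and l: "1 \<le> l1" "1 \<le> l2"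
  have \<zeta>0: "0 \<le> \<zeta>" by (rule order_trans[OF _ \<zeta>]) simp
  define \<kappa> where "\<kappa> = 4 * real l1 * real l2 * (8000000 + 8 * \<zeta>)"
  show "\<exists>c::real. \<forall>n::nat. n \<ge> 1 \<longrightarrow> (\<forall>\<epsilon>::real. \<epsilon> \<ge> c * real n powr (-2/5) \<longrightarrow>
      (let d = nat \<lceil>real n powr (2/5)\<rceil>;
           \<tau> = \<zeta> * real n powr (1/5);
           \<psi> = psi l1 l2 d \<tau> n
       in (SUP p \<in> P0_TV2 l1 l2 L \<union> P0_TV l1 l2 L \<union> P0_chi2 l1 l2 L.
             expect n p \<psi>) \<le> ennreal (1/10) \<and>
          (SUP p \<in> {p \<in> Q0_TV l1 l2 L. (INF q \<in> P0 l1 l2. l1_dist p q) \<ge> \<epsilon>}.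
             expect n p (\<lambda>N \<omega>. 1 - \<psi> N \<omega>)) \<le> ennreal (1/10 + exp (- real n / 8))))"
    unfolding Let_def
  proof (intro exI[of _ "\<kappa> + L + 96 + 640 * (L + 3)"] allI impI conjI SUP_least)
    fix n :: nat and p assume "1 \<le> n" "p \<in> P0_TV2 l1 l2 L \<union> P0_TV l1 l2 L \<union> P0_chi2 l1 l2 L"
    then show "expect n p (psi l1 l2 (nat \<lceil>real n powr (2/5)\<rceil>) (\<zeta> * real n powr (1/5)) n) \<le> ennreal (1/10)"
      using assms \<zeta> by (intro type1_bound)
  next
    fix n :: nat and \<epsilon> :: real and p
    assume "1 \<le> n" "(\<kappa> + L + 96 + 640 * (L + 3)) * real n powr (-2/5) \<le> \<epsilon>"
      and "p \<in> {p \<in> Q0_TV l1 l2 L. (INF q \<in> P0 l1 l2. l1_dist p q) \<ge> \<epsilon>}"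
    then show "expect n p (\<lambda>N \<omega>. 1 - psi l1 l2 (nat \<lceil>real n powr (2/5)\<rceil>) (\<zeta> * real n powr (1/5)) n N \<omega>) \<le>
        ennreal (1/10 + exp (- real n / 8))"
      using assms l \<zeta>0 \<kappa>_def by (intro type2_bound[where \<epsilon> = \<epsilon> and \<kappa> = \<kappa>]) auto
  qed
qed

end
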